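(* Let $k$ and $m$ be positive integers, and let $G$ be an $m$-connected graph of order $n \ge 5k-2$. If $\sigma_{2}^{\lceil m/k \rceil + 1}(G) \ge n$, then $G$ has a 2-factor with exactly $k$ cycles.
   Context: All graphs are finite and simple; the order of a graph is its number of vertices. $\alpha(G)$ is the independence number of $G$, and $d_G(x)$ is the degree of $x$ in $G$. $G$ is $m$-connected if its vertex-connectivity $\kappa(G)$ is at least $m$ (with $\kappa(K_n)=n-1$). For $X \subseteq V(G)$ with $|X| \ge t$, let $\Delta_t(X) = \max\{\sum_{x\in Y} d_G(x) : Y \subseteq X,\ |Y| = t\}$. For integers $s \ge t \ge 1$, if $\alpha(G) \ge s$, let $\sigma_t^{s}(G) = \min\{\Delta_t(X) : X \text{ is an independent set of } G \text{ with } |X| = s\}$; otherwise $\sigma_t^{s}(G) = +\infty$. A 2-factor of $G$ is a spanning subgraph of $G$ in which every component is a cycle; it has exactly $k$ cycles if it has exactly $k$ components. *)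

theory Defs
  imports Complex_Main "HOL-Library.Extended_Nat" "Graph_Theory.Graph_Theory"
begin

text \<open>
  Finite simple graphs are the models of the locale \<^locale>\<open>graph\<close> (finite, symmetric, without
  loops and parallel arcs): an edge \<open>uv\<close> is the pair of opposite arcs between \<open>u\<close> and \<open>v\<close>.
  Hence the degree of \<open>x\<close> is \<open>out_degree G x\<close>, the subgraphs of a graph are its subdigraphs
  that satisfy \<^locale>\<open>graph\<close> themselves, and the connected components of a graph are the
  elements of \<open>pre_digraph.sccs\<close>.
\<close>

definition independent_set :: "('a,'b) pre_digraph \<Rightarrow> 'a set \<Rightarrow> bool" where
  "independent_set G X \<longleftrightarrow> X \<subseteq> verts G \<and> (\<forall>u\<in>X. \<forall>v\<in>X. \<not> u \<rightarrow>\<^bsub>G\<^esub> v)"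

definition independence_number :: "('a,'b) pre_digraph \<Rightarrow> nat" where
  "independence_number G = Max {card X | X. independent_set G X}"

definition max_degree_sum :: "('a,'b) pre_digraph \<Rightarrow> nat \<Rightarrow> 'a set \<Rightarrow> nat" where
  "max_degree_sum G t X = Max {\<Sum>x\<in>Y. out_degree G x | Y. Y \<subseteq> X \<and> card Y = t}"

text \<open>\<open>sigma G t s\<close> is \<open>\<sigma>\<^sub>t\<^sup>s(G)\<close>, meant for \<open>1 \<le> t \<le> s\<close>.\<close>

definition sigma :: "('a,'b) pre_digraph \<Rightarrow> nat \<Rightarrow> nat \<Rightarrow> enat" where
  "sigma G t s =
     (if s \<le> independence_number G
      then enat (Min {max_degree_sum G t X | X. independent_set G X \<and> card X = s})
      else \<infinity>)"

text \<open>
  The strict inclusion keeps the deletion of all vertices from counting as a separation: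
  \<^const>\<open>connected\<close> is false for the graph without vertices.
\<close>

definition separating_set :: "('a,'b) pre_digraph \<Rightarrow> 'a set \<Rightarrow> bool" where
  "separating_set G S \<longleftrightarrow> S \<subset> verts G \<and> \<not> connected (G \<restriction> (verts G - S))"

definition vertex_connectivity :: "('a,'b) pre_digraph \<Rightarrow> nat" where
  "vertex_connectivity G =
     (if complete_digraph (card (verts G)) G then card (verts G) - 1
      else Min {card S | S. separating_set G S})"

definition m_connected :: "nat \<Rightarrow> ('a,'b) pre_digraph \<Rightarrow> bool" where
  "m_connected m G \<longleftrightarrow> m \<le> vertex_connectivity G"

text \<open>
  The bound on the length is needed because \<open>pre_digraph.cycle\<close> also admits the closed walk
  \<open>u, v, u\<close> along the two arcs of a single edge.
\<close>

definition cycle_graph :: "('a,'b) pre_digraph \<Rightarrow> bool" where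
  "cycle_graph C \<longleftrightarrow> graph C \<and>
     (\<exists>p. pre_digraph.cycle C p \<and> 3 \<le> length p \<and> verts C = tail C ` set p \<and>
          arcs_ends C = arc_to_ends C ` set p \<union> (arc_to_ends C ` set p)\<inverse>)"

definition two_factor :: "('a,'b) pre_digraph \<Rightarrow> ('a,'b) pre_digraph \<Rightarrow> bool" where
  "two_factor H G \<longleftrightarrow> graph H \<and> spanning H G \<and> (\<forall>C \<in> pre_digraph.sccs H. cycle_graph C)"

end

theory Submission
  imports Defs
begin

text \<open>
  Put \<open>r = \<lceil>m/k\<rceil>\<close>, so that \<open>m > k(r - 1)\<close>, and call a vertex low if its degree is less than \<open>n/2\<close>.
  By the degree hypothesis an independent set of low vertices has at most \<open>r\<close> elements.

  If all degrees exceed \<open>k\<close>, then \<open>k\<close> disjoint cycles exist: add one cycle at a time, starting from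
  a family with as few covered vertices and then as many uncovered edges as possible. If
  \<open>r \<ge> 2\<close>, choose \<open>k\<close> disjoint cycles that leave as few low vertices as possible uncovered. A low
  vertex \<open>x\<close> left over has, by Menger's theorem, a fan of \<open>m > k(r - 1)\<close> paths to the cycles, so some
  cycle receives \<open>r\<close> of them; the first low vertices after these \<open>r\<close> ends form together with \<open>x\<close> an
  independent set, since otherwise the cycle can be rerouted through \<open>x\<close>. Hence all low vertices can
  be covered.

  Now take \<open>k\<close> disjoint cycles covering all low vertices and as many vertices as possible; let \<open>W\<close>
  be the set of uncovered vertices and \<open>N\<close> the set of their neighbours on the cycles. As \<open>W\<close> is
  dense, any two vertices of \<open>N\<close> are joined by a short path through \<open>W\<close>, and high vertices
  lost in a rerouting can be reinserted greedily. Therefore each segment between two vertices of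
  \<open>N\<close> contains a low vertex, and the first low ones on a cycle are independent. Since \<open>|N| \<ge> m\<close>,
  some cycle contains at least \<open>r\<close> of them, and one more low vertex, or an insertable one, gives a
  contradiction.

  For \<open>r = 1\<close> the hypothesis is Ore's condition. Either all degrees exceed \<open>k\<close>, and a largest
  family of \<open>k\<close> disjoint cycles already spans, or a vertex of degree at most \<open>k\<close> exists; then the
  vertices that are not its neighbours have degree at least \<open>n - k\<close>, the low vertices form a clique
  together with it, one cycle covers them, and the other \<open>k - 1\<close> cycles are found greedily.
\<close>

section \<open>Paths and cycles as lists\<close>

text \<open>The obstacle is that an exchange must keep the number of cycles at \<open>k\<close>, so
  it may merge two cycles only if a new one is found elsewhere. What governs this is the excess
  \<open>E = |vs F| - 2|N|\<close>. A vertex of \<open>W\<close> sees at most \<open>|N|\<close>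
  vertices of the cycles, hence at least \<open>(|W| + E)/2\<close> vertices of \<open>W\<close>. If
  \<open>E >= 2\<close>, then \<open>W\<close> still contains a cycle after a detour has been cut
  out of it, and this spare cycle pays for a merger. If \<open>E <= 1\<close>, then \<open>N\<close>
  is nearly every second vertex, and a suitable gap of \<open>N\<close> has two vertices, both of
  which can be moved to other cycles. The bound \<open>5k - 2\<close> enters through three
  independent vertices: \<open>(5k - 2) + (k + 1) = 6k - 1\<close> is the degree sum from which
  \<open>k\<close> disjoint cycles are constructed. The case \<open>r = 1\<close> stands apart
  because \<open>m\<close> may then be at most \<open>k\<close>: vertices of degree at most
  \<open>k\<close> can occur, and the general construction of disjoint cycles does not cover
  them.\<close>

definition steps :: "'a list \<Rightarrow> ('a \<times> 'a) set" where
  "steps xs = set (zip xs (tl xs))"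

text \<open>The pairs wrap around from the last entry to the first. They stay directed, so that a
  cycle has a successor map; the edge set is recovered by adding the converse.\<close>

definition csteps :: "'a list \<Rightarrow> ('a \<times> 'a) set" where
  "csteps xs = set (zip xs (rotate1 xs))"

definition rot :: "'a list \<Rightarrow> 'a list \<Rightarrow> bool" where
  "rot c c' \<longleftrightarrow> (\<exists>xs ys. c = xs @ ys \<and> c' = ys @ xs)"

lemma steps_simps [simp]:
  "steps [] = {}" "steps [x] = {}" "steps (x # y # zs) = insert (x, y) (steps (y # zs))"
  by (auto simp: steps_def)

lemma steps_append:
  "xs \<noteq> [] \<Longrightarrow> ys \<noteq> [] \<Longrightarrow> steps (xs @ ys) = insert (last xs, hd ys) (steps xs \<union> steps ys)"
proof (induction xs rule: induct_list012)
  case (2 x) then show ?case by (cases ys) auto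
qed auto

lemma steps_rev: "steps (rev xs) = (steps xs)\<inverse>"
proof (induction xs rule: induct_list012)
  case (3 x y zs)
  have "steps (rev (x # y # zs)) = steps (rev (y # zs) @ [x])" by simp
  also have "\<dots> = insert (y, x) (steps (rev (y # zs)))"
    by (subst steps_append) auto
  finally show ?case using 3 by auto
qed auto

lemma steps_in_set: "(x, y) \<in> steps p \<Longrightarrow> x \<in> set p \<and> y \<in> set p"
  by (induction p rule: induct_list012) auto

lemma zip_snoc: "set (zip (x # xs) (xs @ [z])) = insert (last (x # xs), z) (set (zip (x # xs) xs))"
  by (induction xs arbitrary: x) auto

lemma csteps_eq: "xs \<noteq> [] \<Longrightarrow> csteps xs = insert (last xs, hd xs) (steps xs)"
proof (cases xs)
  case (Cons x ys)
  then show ?thesis using zip_snoc[of x ys x] by (simp add: csteps_def steps_def)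
qed simp

lemma csteps_rot: "csteps (ys @ xs) = csteps (xs @ ys)"
proof (cases "xs = [] \<or> ys = []")
  case False
  then show ?thesis by (simp add: csteps_eq steps_append) blast
qed auto

lemma csteps_rev: "csteps (rev c) = (csteps c)\<inverse>"
  by (cases "c = []") (auto simp: csteps_eq steps_rev hd_rev last_rev, auto simp: csteps_def)

lemma csteps_in_set: "(x, y) \<in> csteps c \<Longrightarrow> x \<in> set c \<and> y \<in> set c"
  by (auto simp: csteps_def dest: set_zip_leftD set_zip_rightD)

text \<open>The cyclic successor as a bijection: it sends the \<open>i\<close>-th entry to the
  \<open>i\<close>-th entry of the rotated list. It is what makes a set of vertices and the set of
  their successors equinumerous.\<close>

lemma csteps_fun:
  assumes "distinct c"
  obtains f where "bij_betw f (set c) (set c)" "csteps c = {(x, f x) | x. x \<in> set c}"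
proof -
  define n where "n = length c"
  have g: "bij_betw ((!) c) {..<n} (set c)" using assms unfolding n_def
    by (simp add: bij_betw_nth)
  have h: "bij_betw ((!) (rotate1 c)) {..<n} (set c)" using assms unfolding n_def
    by (metis bij_betw_nth distinct1_rotate length_rotate1 set_rotate1)
  define g' where "g' = the_inv_into {..<n} ((!) c)"
  have g': "bij_betw g' (set c) {..<n}" unfolding g'_def by (rule bij_betw_the_inv_into[OF g])
  have gg: "g' (c ! i) = i" if "i < n" for i
    unfolding g'_def using that g by (simp add: bij_betw_def the_inv_into_f_f)
  define f where "f = (\<lambda>x. rotate1 c ! g' x)"
  have "bij_betw f (set c) (set c)" using bij_betw_trans[OF g' h] by (simp add: f_def comp_def)
  moreover have "csteps c = {(x, f x) | x. x \<in> set c}"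
  proof -
    have "csteps c = (\<lambda>i. (c ! i, rotate1 c ! i)) ` {..<n}" unfolding csteps_def set_zip n_def by auto
    also have "\<dots> = (\<lambda>i. (c ! i, f (c ! i))) ` {..<n}" by (rule image_cong) (simp_all add: f_def gg)
    also have "\<dots> = (\<lambda>x. (x, f x)) ` ((!) c ` {..<n})" by (simp add: image_image)
    also have "(!) c ` {..<n} = set c" using g by (simp add: bij_betw_def)
    finally show ?thesis by auto
  qed
  ultimately show thesis using that by blast
qed

lemma rot_refl: "rot c c"
  unfolding rot_def by (metis append_Nil2 append_Nil)

lemma rot_append: "rot c (xs @ ys) \<Longrightarrow> rot c (ys @ xs)"
proof -
  assume "rot c (xs @ ys)"
  then obtain us vs where c: "c = us @ vs" "xs @ ys = vs @ us" unfolding rot_def by blast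
  then consider z where "xs = vs @ z" "us = z @ ys" | z where "vs = xs @ z" "ys = z @ us"
    unfolding append_eq_append_conv2 by blast
  then show ?thesis
  proof cases
    case 1 then show ?thesis using c unfolding rot_def by (intro exI[of _ z] exI[of _ "ys @ vs"]) simp
  next
    case 2 then show ?thesis using c unfolding rot_def by (intro exI[of _ "us @ xs"] exI[of _ z]) simp
  qed
qed

lemma rot_props:
  assumes "rot c c'"
  shows "set c' = set c" "length c' = length c" "distinct c' = distinct c" "csteps c' = csteps c"
  using assms csteps_rot unfolding rot_def by auto

lemma rot_at:
  assumes "x \<in> set c"
  obtains R where "rot c (x # R)"
  by (metis append_Cons assms rot_def split_list)

text \<open>A vertex has only one position in a distinct list. This allows two decompositions of one
  cycle, found independently, to be compared.\<close>

lemma rot_unique: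
  assumes "distinct c" "rot c (x # A)" "rot c (x # B)"
  shows "A = B"
proof -
  have d: "distinct (x # A)" using assms rot_props(3) by blast
  obtain xs ys where 1: "c = xs @ ys" "x # A = ys @ xs" using assms(2) unfolding rot_def by blast
  obtain us vs where 2: "c = us @ vs" "x # B = vs @ us" using assms(3) unfolding rot_def by blast
  have "\<exists>P Q. c = P @ x # Q \<and> A = Q @ P" if "c = xs @ ys" "x # A = ys @ xs" for A xs ys
    using that by (cases ys) auto
  then obtain P Q P' Q' where "c = P @ x # Q" "A = Q @ P" "c = P' @ x # Q'" "B = Q' @ P'"
    using 1 2 by metis
  moreover from this assms(1) have "P = P' \<and> Q = Q'"
    using append_Cons_eq_iff[of x P Q P' Q'] by simp
  ultimately show ?thesis by blast
qed

lemma rot_step: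
  assumes "(x, y) \<in> csteps c" "distinct c"
  obtains R where "rot c (y # R)" "last (y # R) = x"
proof -
  obtain R where R: "rot c (y # R)" using csteps_in_set assms rot_at by metis
  then have "(last (y # R), y) \<in> csteps c" using rot_props(4)[OF R] csteps_eq[of "y # R"] by auto
  obtain f where f: "bij_betw f (set c) (set c)" "csteps c = {(x, f x) | x. x \<in> set c}"
    using csteps_fun assms(2) by blast
  have "last (y # R) = x"
    using f assms(1) \<open>(last (y # R), y) \<in> csteps c\<close> by (auto simp: bij_betw_def inj_on_def)
  then show thesis using R that by blast
qed

section \<open>Abstract graphs: degrees, paths, cycles, leaves of acyclic sets\<close>

locale sgraph =
  fixes V :: "'a set" and adj :: "'a \<Rightarrow> 'a \<Rightarrow> bool"
  assumes finV: "finite V"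
    and adj_sym: "adj x y \<Longrightarrow> adj y x"
    and adj_irrefl: "\<not> adj x x"
    and adj_V: "adj x y \<Longrightarrow> x \<in> V \<and> y \<in> V"
begin

definition nb :: "'a set \<Rightarrow> 'a \<Rightarrow> 'a set" where "nb S v = {u \<in> S. adj v u}"
definition dg :: "'a set \<Rightarrow> 'a \<Rightarrow> nat" where "dg S v = card (nb S v)"
abbreviation deg :: "'a \<Rightarrow> nat" where "deg \<equiv> dg V"

definition pth :: "'a list \<Rightarrow> bool" where
  "pth p \<longleftrightarrow> distinct p \<and> (\<forall>(x, y) \<in> steps p. adj x y)"

definition cyc :: "'a list \<Rightarrow> bool" where
  "cyc c \<longleftrightarrow> 3 \<le> length c \<and> distinct c \<and> (\<forall>(x, y) \<in> csteps c. adj x y)"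

lemma adj_neq: "adj x y \<Longrightarrow> x \<noteq> y" using adj_irrefl by blast

lemma adj_commute: "adj x y \<longleftrightarrow> adj y x" using adj_sym by blast

lemma finite_nb [simp]: "finite (nb S v)"
  by (rule finite_subset[OF _ finV]) (auto simp: nb_def dest: adj_V)

lemma dg_le_card: "finite S \<Longrightarrow> dg S v \<le> card S"
  unfolding dg_def nb_def by (rule card_mono) auto

lemma dg_less_card: "finite S \<Longrightarrow> v \<in> S \<Longrightarrow> dg S v < card S"
  unfolding dg_def nb_def by (rule psubset_card_mono) (use adj_irrefl in blast)+

lemma dg_Un: "S \<inter> T = {} \<Longrightarrow> dg (S \<union> T) v = dg S v + dg T v"
proof -
  assume "S \<inter> T = {}"
  have "nb (S \<union> T) v = nb S v \<union> nb T v" by (auto simp: nb_def)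
  then show ?thesis unfolding dg_def
    using \<open>S \<inter> T = {}\<close> by (simp add: card_Un_disjoint nb_def disjoint_iff finite_nb[unfolded nb_def])
qed

lemma dg_split: "S \<subseteq> T \<Longrightarrow> dg T v = dg S v + dg (T - S) v"
  using dg_Un[of S "T - S" v] by (simp add: Un_absorb1)

lemma dg_0: "(\<And>u. u \<in> S \<Longrightarrow> \<not> adj v u) \<Longrightarrow> dg S v = 0"
proof -
  assume "\<And>u. u \<in> S \<Longrightarrow> \<not> adj v u"
  then have "nb S v = {}" by (auto simp: nb_def)
  then show ?thesis by (simp add: dg_def)
qed

lemma dg_pos: "0 < dg S v \<longleftrightarrow> (\<exists>u\<in>S. adj v u)"
  unfolding dg_def by (auto simp: card_gt_0_iff) (auto simp: nb_def)

lemma pth_simps [simp]: "pth []" "pth [x]"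
  "pth (x # y # zs) \<longleftrightarrow> adj x y \<and> x \<notin> set (y # zs) \<and> pth (y # zs)"
  by (auto simp: pth_def)

lemma pth_append:
  "xs \<noteq> [] \<Longrightarrow> ys \<noteq> [] \<Longrightarrow>
   pth (xs @ ys) \<longleftrightarrow> pth xs \<and> pth ys \<and> set xs \<inter> set ys = {} \<and> adj (last xs) (hd ys)"
  by (auto simp: pth_def steps_append)

lemma pth_Cons: "pth (x # xs) \<longleftrightarrow> xs = [] \<or> adj x (hd xs) \<and> x \<notin> set xs \<and> pth xs"
  by (cases xs) auto

lemma pth_rev [simp]: "pth (rev p) \<longleftrightarrow> pth p"
  unfolding pth_def steps_rev using adj_sym by fastforce

lemma pth_appendD: "pth (xs @ ys) \<Longrightarrow> pth xs \<and> pth ys"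
  by (cases "xs = [] \<or> ys = []") (auto simp: pth_append)

lemma pth_distinct: "pth p \<Longrightarrow> distinct p" by (simp add: pth_def)

lemma cyc_iff: "cyc c \<longleftrightarrow> 3 \<le> length c \<and> pth c \<and> adj (last c) (hd c)"
  by (cases "c = []") (auto simp: cyc_def pth_def csteps_eq)

lemma cyc_rot: "rot c c' \<Longrightarrow> cyc c' \<longleftrightarrow> cyc c"
  using rot_props[of c c'] by (simp add: cyc_def)

lemma cyc_rev: "cyc (rev c) \<longleftrightarrow> cyc c"
  unfolding cyc_def csteps_rev using adj_sym by fastforce

lemma cyc_V: "cyc c \<Longrightarrow> set c \<subseteq> V"
proof
  fix x assume c: "cyc c" "x \<in> set c"
  then obtain R where R: "rot c (x # R)" using rot_at by metis
  then have "cyc (x # R)" using cyc_rot c by blast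
  then show "x \<in> V" using adj_V by (auto simp: cyc_iff)
qed

lemma cyc_card: "cyc c \<Longrightarrow> card (set c) = length c \<and> 3 \<le> card (set c)"
  by (simp add: cyc_def distinct_card)

lemma cyc_ne: "cyc c \<Longrightarrow> c \<noteq> []" by (auto simp: cyc_def)

lemma path_chord_cycle:
  assumes "pth (x # p)" "u \<in> set p" "adj x u" "u \<noteq> hd p"
  obtains A B where "p = A @ u # B" "cyc (x # A @ [u])"
proof -
  obtain A B where AB: "p = A @ u # B" using assms(2) split_list by metis
  then have "A \<noteq> []" using assms(4) by auto
  have "pth ((x # A @ [u]) @ B)" using assms(1) AB by simp
  then have "pth (x # A @ [u])" using pth_appendD by blast
  then have "cyc (x # A @ [u])" using \<open>A \<noteq> []\<close> assms(3) adj_sym by (cases A) (auto simp: cyc_iff)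
  then show thesis using that AB by blast
qed

lemma longest_path:
  assumes "finite S" "S \<noteq> {}"
  obtains p where "pth p" "set p \<subseteq> S" "p \<noteq> []" "\<forall>q. pth q \<and> set q \<subseteq> S \<longrightarrow> length q \<le> length p"
    "nb S (hd p) \<subseteq> set p" "nb S (last p) \<subseteq> set p"
proof -
  define P where "P = (\<lambda>p. pth p \<and> set p \<subseteq> S)"
  obtain s where "s \<in> S" using assms by blast
  then have "P [s]" by (simp add: P_def)
  have "length p \<le> card S" if "P p" for p
    using that assms by (metis P_def card_mono distinct_card pth_distinct)
  then have "\<forall>p. P p \<longrightarrow> length p < Suc (card S)" by (simp add: le_imp_less_Suc)
  then obtain p where p: "P p" "\<And>q. P q \<Longrightarrow> length q \<le> length p"
    using ex_has_greatest_nat[of P "[s]" length] \<open>P [s]\<close> by blast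
  then have ne: "p \<noteq> []" using \<open>P [s]\<close> by fastforce
  have "u \<in> set p" if "u \<in> nb S (hd p)" for u
  proof (rule ccontr)
    assume "u \<notin> set p"
    then have "P (u # p)" using that p ne by (auto simp: P_def pth_Cons nb_def adj_sym)
    then show False using p(2) by fastforce
  qed
  moreover have "u \<in> set p" if "u \<in> nb S (last p)" for u
  proof (rule ccontr)
    assume "u \<notin> set p"
    then have "P (p @ [u])" using that p ne by (auto simp: P_def pth_append nb_def)
    then show False using p(2) by fastforce
  qed
  ultimately show thesis using that p ne unfolding P_def by blast
qed

definition acyc :: "'a set \<Rightarrow> bool" where "acyc S \<longleftrightarrow> (\<nexists>c. cyc c \<and> set c \<subseteq> S)"

text \<open>Any further neighbour on the path would be the end of a chord and close a cycle inside
  \<open>S\<close>.\<close>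

lemma acyc_path_end:
  assumes "acyc S" "pth (x # p)" "set (x # p) \<subseteq> S" "p \<noteq> []"
  shows "nb (set (x # p)) x = {hd p}"
proof -
  have "u = hd p" if "u \<in> nb (set (x # p)) x" for u
  proof (rule ccontr)
    assume "u \<noteq> hd p"
    have "u \<in> set p" "adj x u" using that by (auto simp: nb_def adj_irrefl)
    then obtain A B where "p = A @ u # B" "cyc (x # A @ [u])"
      using path_chord_cycle[OF assms(2)] \<open>u \<noteq> hd p\<close> by metis
    then have "set (x # A @ [u]) \<subseteq> S" using assms(3) by auto
    then show False using \<open>cyc (x # A @ [u])\<close> assms(1) unfolding acyc_def by blast
  qed
  moreover have "hd p \<in> nb (set (x # p)) x" using assms by (auto simp: nb_def pth_Cons)
  ultimately show ?thesis by blast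
qed

text \<open>Maximality puts all neighbours of an end on the path, and acyclicity leaves only the
  next vertex, so the ends are leaves of \<open>S\<close>. The second end is the first end of the
  reversed path.\<close>

lemma acyc_longest_path:
  assumes "finite S" "S \<noteq> {}" "acyc S"
  obtains p where "pth p" "set p \<subseteq> S" "p \<noteq> []" "\<forall>q. pth q \<and> set q \<subseteq> S \<longrightarrow> length q \<le> length p"
    "length p = 1 \<longrightarrow> nb S (hd p) = {}"
    "2 \<le> length p \<longrightarrow> nb S (hd p) = {p ! 1}"
    "2 \<le> length p \<longrightarrow> nb S (last p) = {p ! (length p - 2)}"
proof -
  obtain p where p: "pth p" "set p \<subseteq> S" "p \<noteq> []" "\<forall>q. pth q \<and> set q \<subseteq> S \<longrightarrow> length q \<le> length p"
    "nb S (hd p) \<subseteq> set p" "nb S (last p) \<subseteq> set p"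
    by (rule longest_path[OF assms(1,2)])
  have main: "nb S (hd q) = {q ! 1}"
    if "pth q" "set q = set p" "2 \<le> length q" "nb S (hd q) \<subseteq> set q" for q
  proof -
    note len = that(3)
    obtain x y r where q: "q = x # y # r" using len
      by (cases q rule: list.exhaust; cases "tl q") auto
    have "nb (set q) x = {y}" using acyc_path_end[of S x "y # r"] assms(3) that(1,2) p(2) unfolding q by auto
    moreover have "nb S x = nb (set q) x" using that p(2) q by (auto simp: nb_def)
    ultimately show ?thesis using q by simp
  qed
  have "nb S (hd p) = {}" if "length p = 1"
  proof -
    obtain x where "p = [x]" using \<open>length p = 1\<close> by (cases p) auto
    then show ?thesis using p(5) by (auto simp: nb_def adj_irrefl)
  qed
  moreover have "nb S (last p) = {p ! (length p - 2)}" if "length p \<ge> 2"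
    using main[of "rev p"] p that by (simp add: hd_rev rev_nth numeral_2_eq_2)
  moreover have "nb S (hd p) = {p ! 1}" if "length p \<ge> 2" using main[of p] p that by simp
  ultimately show thesis using that[OF p(1-4)] by simp
qed

lemma min_deg2_cycle:
  assumes "finite S" "S \<noteq> {}" "\<And>v. v \<in> S \<Longrightarrow> 2 \<le> dg S v"
  obtains c where "cyc c" "set c \<subseteq> S"
proof -
  have "\<not> acyc S"
  proof
    assume "acyc S"
    obtain p where p: "pth p" "set p \<subseteq> S" "p \<noteq> []" "\<forall>q. pth q \<and> set q \<subseteq> S \<longrightarrow> length q \<le> length p"
      "length p = 1 \<longrightarrow> nb S (hd p) = {}"
      "2 \<le> length p \<longrightarrow> nb S (hd p) = {p ! 1}"
      "2 \<le> length p \<longrightarrow> nb S (last p) = {p ! (length p - 2)}"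
      by (rule acyc_longest_path[OF assms(1,2) \<open>acyc S\<close>])
    have "hd p \<in> S" using p by auto
    moreover have "dg S (hd p) \<le> 1"
    proof (cases "length p = 1")
      case False
      then have "length p \<ge> 2" using p(3) by (cases p) (auto simp: Suc_le_eq)
      then show ?thesis using p(6) by (simp add: dg_def)
    qed (simp add: dg_def p(5))
    ultimately show False using assms(3) by fastforce
  qed
  then show thesis using that by (auto simp: acyc_def)
qed

section \<open>Families of disjoint cycles\<close>

text \<open>Two rotations of one cycle are different lists; disjointness of the vertex sets keeps
  them from occurring together, so the cardinality of \<open>F\<close> is a number of
  cycles.\<close>

definition fam :: "'a list set \<Rightarrow> bool" where
  "fam F \<longleftrightarrow> finite F \<and> (\<forall>c\<in>F. cyc c) \<and> (\<forall>c\<in>F. \<forall>d\<in>F. c \<noteq> d \<longrightarrow> set c \<inter> set d = {})"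

definition vs :: "'a list set \<Rightarrow> 'a set" where "vs F = (\<Union>c\<in>F. set c)"

text \<open>Only the covered set is recorded: the extremal choices compare families by what they
  cover.\<close>

definition pk :: "nat \<Rightarrow> 'a set \<Rightarrow> bool" where
  "pk k S \<longleftrightarrow> (\<exists>F. fam F \<and> card F = k \<and> vs F = S)"

definition astep :: "'a list set \<Rightarrow> ('a \<times> 'a) set" where "astep F = (\<Union>c\<in>F. csteps c)"

text \<open>The classical insertable vertex: it fits between two consecutive vertices of some
  cycle.\<close>

definition ins :: "'a list set \<Rightarrow> 'a \<Rightarrow> bool" where
  "ins F v \<longleftrightarrow> (\<exists>(x, y) \<in> astep F. adj v x \<and> adj v y)"

lemma insE:
  assumes "ins F v" obtains x y where "(x, y) \<in> astep F" "adj v x" "adj v y"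
  using assms unfolding ins_def by blast

lemma insI: "(x, y) \<in> astep F \<Longrightarrow> adj v x \<Longrightarrow> adj v y \<Longrightarrow> ins F v"
  unfolding ins_def by blast

lemma pkI: "fam F \<Longrightarrow> pk (card F) (vs F)" by (auto simp: pk_def)

lemma fam_empty [simp]: "fam {}" "vs {} = {}" by (auto simp: fam_def vs_def)

lemma fam_V: "fam F \<Longrightarrow> vs F \<subseteq> V" using cyc_V by (fastforce simp: fam_def vs_def)

lemma fam_finite_vs: "fam F \<Longrightarrow> finite (vs F)" using fam_V finV finite_subset by blast

lemma pk_V: "pk k S \<Longrightarrow> S \<subseteq> V" using fam_V by (auto simp: pk_def)

lemma fam_Diff: "fam F \<Longrightarrow> fam (F - X)" by (auto simp: fam_def)

lemma fam_cyc: "fam F \<Longrightarrow> c \<in> F \<Longrightarrow> cyc c" by (auto simp: fam_def)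

lemma vs_Diff:
  assumes "fam F" "c \<in> F" shows "vs (F - {c}) = vs F - set c"
  using assms by (fastforce simp: fam_def vs_def)

lemma set_sub_vs: "c \<in> F \<Longrightarrow> set c \<subseteq> vs F" by (auto simp: vs_def)

lemma fam_insert:
  assumes "fam F" "cyc c" "set c \<inter> vs F = {}"
  shows "fam (insert c F)" "card (insert c F) = Suc (card F)" "vs (insert c F) = set c \<union> vs F" "c \<notin> F"
proof -
  show n: "c \<notin> F"
  proof
    assume "c \<in> F"
    then have "set c \<subseteq> vs F" by (auto simp: vs_def)
    then show False using assms cyc_ne[of c] by (cases c) auto
  qed
  show "fam (insert c F)" using assms by (fastforce simp: fam_def vs_def)
  show "card (insert c F) = Suc (card F)" using assms n by (simp add: fam_def)
  show "vs (insert c F) = set c \<union> vs F" by (auto simp: vs_def)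
qed

lemma pk_insert:
  assumes "pk k S" "cyc c" "set c \<inter> S = {}"
  shows "pk (Suc k) (S \<union> set c)"
  using assms fam_insert unfolding pk_def by (metis Un_commute)

lemma fam_card_Diff: "fam F \<Longrightarrow> c \<in> F \<Longrightarrow> Suc (card (F - {c})) = card F"
  unfolding fam_def by (metis card_Suc_Diff1)

lemma fam_replace:
  assumes "fam F" "c \<in> F" "cyc c'" "set c' \<inter> (vs F - set c) = {}"
  shows "fam (insert c' (F - {c}))" "card (insert c' (F - {c})) = card F"
    "vs (insert c' (F - {c})) = set c' \<union> (vs F - set c)"
  using fam_insert[OF fam_Diff[OF assms(1), of "{c}"] assms(3)] vs_Diff[OF assms(1,2)] assms(4)
    fam_card_Diff[OF assms(1,2)] by auto

lemma dg_fam: "fam F \<Longrightarrow> dg (vs F) v = (\<Sum>c\<in>F. dg (set c) v)"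
proof -
  assume F: "fam F"
  have "nb (vs F) v = (\<Union>c\<in>F. nb (set c) v)" by (auto simp: nb_def vs_def)
  moreover have "card (\<Union>c\<in>F. nb (set c) v) = (\<Sum>c\<in>F. card (nb (set c) v))"
    using F by (intro card_UN_disjoint) (auto simp: fam_def nb_def finite_nb[unfolded nb_def] disjoint_iff)
  ultimately show ?thesis by (simp add: dg_def)
qed

lemma card_vs: "fam F \<Longrightarrow> card (vs F) = (\<Sum>c\<in>F. card (set c))"
  unfolding vs_def by (rule card_UN_disjoint) (auto simp: fam_def)

lemma card_Int_vs: "fam F \<Longrightarrow> N \<subseteq> vs F \<Longrightarrow> card N = (\<Sum>c\<in>F. card (N \<inter> set c))"
proof -
  assume F: "fam F" "N \<subseteq> vs F"
  then have "N = (\<Union>c\<in>F. N \<inter> set c)" by (auto simp: vs_def)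
  moreover have "card (\<Union>c\<in>F. N \<inter> set c) = (\<Sum>c\<in>F. card (N \<inter> set c))"
    using F by (intro card_UN_disjoint) (auto simp: fam_def disjoint_iff)
  ultimately show ?thesis by simp
qed

lemma astep_in_vs: "(x, y) \<in> astep F \<Longrightarrow> x \<in> vs F \<and> y \<in> vs F"
  by (auto simp: astep_def vs_def dest: csteps_in_set)

text \<open>The successor maps of the single cycles, glued along their disjoint vertex sets.\<close>

lemma fam_succ:
  assumes "fam F"
  obtains f where "bij_betw f (vs F) (vs F)" "astep F = {(x, f x) | x. x \<in> vs F}"
    "\<forall>c\<in>F. bij_betw f (set c) (set c)"
    "\<forall>c\<in>F. csteps c = {(x, f x) | x. x \<in> set c}"
proof -
  have "\<forall>c\<in>F. \<exists>f. bij_betw f (set c) (set c) \<and> csteps c = {(x, f x) | x. x \<in> set c}"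
  proof
    fix c assume "c \<in> F"
    then have "distinct c" using assms by (simp add: fam_def cyc_def)
    then show "\<exists>f. bij_betw f (set c) (set c) \<and> csteps c = {(x, f x) | x. x \<in> set c}"
      by (rule csteps_fun) blast
  qed
  from bchoice[OF this] obtain g where g: "\<forall>c\<in>F. bij_betw (g c) (set c) (set c) \<and> csteps c = {(x, g c x) | x. x \<in> set c}"
    by blast
  define h where "h x = (THE c. c \<in> F \<and> x \<in> set c)" for x
  have h: "h x = c" if "c \<in> F" "x \<in> set c" for x c
    unfolding h_def using that assms by (intro the_equality) (auto simp: fam_def)
  define f where "f x = g (h x) x" for x
  have b: "bij_betw f (set c) (set c)" if "c \<in> F" for c
  proof -
    have "bij_betw (g c) (set c) (set c)" using g that by blast
    then show ?thesis by (rule bij_betw_cong[THEN iffD1, rotated]) (simp add: f_def h[OF that])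
  qed
  have s: "csteps c = {(x, f x) | x. x \<in> set c}" if "c \<in> F" for c
    using g that h by (fastforce simp: f_def)
  have "inj_on f (vs F)"
  proof (rule inj_onI)
    fix x y assume xy: "x \<in> vs F" "y \<in> vs F" "f x = f y"
    then obtain c d where cd: "c \<in> F" "x \<in> set c" "d \<in> F" "y \<in> set d" by (auto simp: vs_def)
    then have "f x \<in> set c" "f y \<in> set d" using b by (auto simp: bij_betw_def)
    then have "c = d" using cd xy assms by (auto simp: fam_def)
    then show "x = y" using cd xy b[of c] by (auto simp: bij_betw_def inj_on_def)
  qed
  moreover have "f ` vs F = vs F" using b by (force simp: vs_def bij_betw_def)
  ultimately have "bij_betw f (vs F) (vs F)" by (simp add: bij_betw_def)
  moreover have "astep F = {(x, f x) | x. x \<in> vs F}" using s by (auto simp: astep_def vs_def)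
  ultimately show thesis using that b s by blast
qed

text \<open>The neighbours of a vertex that is not insertable and their successors are disjoint sets
  of equal size.\<close>

lemma not_ins_dg:
  assumes "fam F" "\<not> ins F v"
  shows "2 * dg (vs F) v \<le> card (vs F)"
proof -
  obtain f where f: "bij_betw f (vs F) (vs F)" "astep F = {(x, f x) | x. x \<in> vs F}"
    "\<forall>c\<in>F. bij_betw f (set c) (set c)"
    "\<forall>c\<in>F. csteps c = {(x, f x) | x. x \<in> set c}"
    by (rule fam_succ[OF assms(1)])
  have "f ` nb (vs F) v \<inter> nb (vs F) v = {}" using assms(2) f(2) by (auto simp: ins_def nb_def)
  moreover have "f ` nb (vs F) v \<subseteq> vs F" using bij_betwE[OF f(1)] by (auto simp: nb_def)
  moreover have "card (f ` nb (vs F) v) = dg (vs F) v"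
    unfolding dg_def by (intro card_image inj_on_subset[OF bij_betw_imp_inj_on[OF f(1)]]) (auto simp: nb_def)
  ultimately have "2 * dg (vs F) v = card (f ` nb (vs F) v \<union> nb (vs F) v)"
    by (simp add: card_Un_disjoint dg_def)
  also have "\<dots> \<le> card (vs F)"
    using \<open>f ` nb (vs F) v \<subseteq> vs F\<close> fam_finite_vs[OF assms(1)] by (intro card_mono) (auto simp: nb_def)
  finally show ?thesis .
qed

lemma ins_mono: "ins F v \<Longrightarrow> F \<subseteq> F' \<Longrightarrow> ins F' v"
  by (fastforce simp: ins_def astep_def)

text \<open>The last conclusion is the point for iteration: only the pair \<open>(x, y)\<close> is
  destroyed, so vertices that can be inserted elsewhere remain insertable.\<close>

lemma insert_path:
  assumes "fam F" "(x, y) \<in> astep F" "pth p" "p \<noteq> []" "set p \<inter> vs F = {}"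
    "adj x (hd p)" "adj (last p) y"
  obtains F' where "fam F'" "card F' = card F" "vs F' = vs F \<union> set p" "astep F - {(x, y)} \<subseteq> astep F'"
proof -
  obtain c where c: "c \<in> F" "(x, y) \<in> csteps c" using assms(2) by (auto simp: astep_def)
  have cc: "cyc c" using assms(1) c by (simp add: fam_def)
  then obtain R where R: "rot c (y # R)" "last (y # R) = x" using rot_step c cyc_def by metis
  have yR: "cyc (y # R)" "set (y # R) = set c" using R cyc_rot cc rot_props by blast+
  have dis: "set p \<inter> set (y # R) = {}" using assms(5) yR c set_sub_vs by blast
  let ?c' = "(y # R) @ p"
  have cyc': "cyc ?c'"
    using yR dis R assms by (subst cyc_iff, subst pth_append) (auto simp: cyc_iff)
  have dis': "set ?c' \<inter> (vs F - set c) = {}" using assms(5) yR by auto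
  note new = fam_replace[OF assms(1) c(1) cyc' dis']
  have "csteps c = insert (x, y) (steps (y # R))" using rot_props(4)[OF R(1)] R(2) by (simp add: csteps_eq)
  moreover have "steps (y # R) \<subseteq> csteps ?c'" using assms(4) by (subst csteps_eq, simp, subst steps_append) auto
  ultimately have "csteps c - {(x, y)} \<subseteq> csteps ?c'" by blast
  then have "astep F - {(x, y)} \<subseteq> astep (insert ?c' (F - {c}))" by (auto simp: astep_def)
  moreover have "vs (insert ?c' (F - {c})) = vs F \<union> set p"
    unfolding new(3) using yR(2) set_sub_vs[OF c(1)] by auto
  ultimately show thesis using that new by blast
qed

text \<open>Several vertices of the path may compete for the same edge. If the first one fits at
  \<open>(x, y)\<close>, the whole initial part up to the last vertex \<open>w\<close> that also
  fits there is put between \<open>x\<close> and \<open>y\<close>. No later vertex fits at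
  \<open>(x, y)\<close>, so all later ones keep their places and the induction continues.\<close>

lemma path_insertion:
  assumes "fam F" "pth p" "set p \<inter> vs F = {}" "\<And>v. v \<in> set p \<Longrightarrow> ins F v"
  obtains F' where "fam F'" "card F' = card F" "vs F' = vs F \<union> set p"
  using assms
proof (induction "length p" arbitrary: p F thesis rule: less_induct)
  case less
  show ?case
  proof (cases p)
    case Nil then show ?thesis using less by auto
  next
    case (Cons v q)
    then have "ins F v" using less(6) by simp
    then obtain x y where xy: "(x, y) \<in> astep F" "adj v x" "adj v y" by (rule insE)
    have "\<exists>w\<in>set p. adj w x \<and> adj w y" using xy Cons by auto
    then obtain A w B where p: "p = A @ w # B" "adj w x" "adj w y" "\<forall>u\<in>set B. \<not> (adj u x \<and> adj u y)"
      using split_list_last_prop[of p "\<lambda>w. adj w x \<and> adj w y"] by blast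
    let ?q = "A @ [w]"
    have pq: "p = ?q @ B" using p by simp
    have q: "pth ?q" "pth B" using less(4) pth_appendD[of ?q B] pq by auto
    have hq: "hd ?q = v" using Cons p(1) by (cases A) auto
    obtain F1 where F1: "fam F1" "card F1 = card F" "vs F1 = vs F \<union> set ?q" "astep F - {(x, y)} \<subseteq> astep F1"
    proof (rule insert_path[OF less(3) xy(1) q(1)])
      show "set ?q \<inter> vs F = {}" using less(5) p(1) by auto
      show "adj x (hd ?q)" using xy adj_sym hq by simp
      show "adj (last ?q) y" using p by simp
    qed auto
    have "ins F1 u" if "u \<in> set B" for u
    proof -
      have "u \<in> set p" using that p by auto
      then have "ins F u" using less(6) by simp
      then obtain x' y' where "(x', y') \<in> astep F" "adj u x'" "adj u y'" by (rule insE)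
      moreover from this have "(x', y') \<noteq> (x, y)" using p(4) that by blast
      ultimately show ?thesis using F1(4) insI by blast
    qed
    moreover have "set B \<inter> vs F1 = {}"
      using less(4,5) F1(3) p(1) by (auto dest!: pth_distinct)
    moreover have "length B < length p" using p(1) by simp
    ultimately obtain F2 where "fam F2" "card F2 = card F1" "vs F2 = vs F1 \<union> set B"
      using less(1)[of B F1] F1(1) q(2) by metis
    then show ?thesis using less(2)[of F2] F1 p(1) by (simp add: Un_assoc)
  qed
qed

lemma absorb_greedy:
  assumes "fam G0" "I \<subseteq> V" "I \<inter> vs G0 = {}"
  obtains F1 where "fam F1" "card F1 = card G0" "vs G0 \<subseteq> vs F1" "vs F1 \<subseteq> vs G0 \<union> I"
    "\<And>v. v \<in> I - vs F1 \<Longrightarrow> \<not> ins F1 v"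
proof -
  define P where "P = (\<lambda>F1. fam F1 \<and> card F1 = card G0 \<and> vs G0 \<subseteq> vs F1 \<and> vs F1 \<subseteq> vs G0 \<union> I)"
  have "P G0" using assms by (auto simp: P_def)
  moreover have "\<forall>F1. P F1 \<longrightarrow> card (vs F1) < Suc (card V)"
    using fam_V finV by (auto simp: P_def less_Suc_eq_le intro: card_mono)
  ultimately obtain F1 where F1: "P F1" "\<And>F2. P F2 \<Longrightarrow> card (vs F2) \<le> card (vs F1)"
    using ex_has_greatest_nat[of P G0 "\<lambda>F. card (vs F)"] by blast
  have "\<not> ins F1 v" if v: "v \<in> I - vs F1" for v
  proof
    assume "ins F1 v"
    then obtain F2 where F2: "fam F2" "card F2 = card F1" "vs F2 = vs F1 \<union> set [v]"
      using path_insertion[of F1 "[v]"] F1(1) v by (auto simp: P_def)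
    then have "P F2" using F1(1) v by (auto simp: P_def)
    moreover have "card (vs F2) = Suc (card (vs F1))"
      using F2(3) v F1(1) fam_finite_vs by (auto simp: P_def)
    ultimately show False using F1(2) by fastforce
  qed
  then show thesis using that F1(1) by (auto simp: P_def)
qed

end

section \<open>Menger's theorem and fans\<close>

definition wlk :: "('a \<times> 'a) set \<Rightarrow> 'a list \<Rightarrow> bool" where
  "wlk E p \<longleftrightarrow> p \<noteq> [] \<and> distinct p \<and> steps p \<subseteq> E"

text \<open>One-vertex walks count, so a separator contains \<open>A \<inter> B\<close>. The
  relation \<open>E\<close> is directed.\<close>

definition sep :: "('a \<times> 'a) set \<Rightarrow> 'a set \<Rightarrow> 'a set \<Rightarrow> 'a set \<Rightarrow> bool" where
  "sep E A B S \<longleftrightarrow> (\<forall>p. wlk E p \<and> hd p \<in> A \<and> last p \<in> B \<longrightarrow> set p \<inter> S \<noteq> {})"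

lemma steps_append_subset: "steps xs \<subseteq> steps (xs @ ys)" "steps ys \<subseteq> steps (xs @ ys)"
  by (cases "xs = [] \<or> ys = []"; auto simp: steps_append)+

lemma walk_shorten:
  assumes "p \<noteq> []" "steps p \<subseteq> E"
  obtains q where "wlk E q" "hd q = hd p" "last q = last p" "set q \<subseteq> set p"
  using assms
proof (induction "length p" arbitrary: p thesis rule: less_induct)
  case less
  show ?case
  proof (cases "distinct p")
    case True then show ?thesis using less(2)[of p] less(3,4) by (auto simp: wlk_def)
  next
    case False
    then obtain xs ys zs y where p: "p = xs @ [y] @ ys @ [y] @ zs" using not_distinct_decomp by blast
    let ?q = "(xs @ [y]) @ zs"
    have "steps (xs @ [y]) \<subseteq> steps p" "steps (y # zs) \<subseteq> steps p"
      using steps_append_subset(1)[of "xs @ [y]" "ys @ [y] @ zs"] steps_append_subset(2)[of "y # zs" "xs @ [y] @ ys"]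
      by (simp_all add: p)
    moreover have "steps ?q \<subseteq> steps (xs @ [y]) \<union> steps (y # zs)"
      using steps_append[of "xs @ [y]" zs] by (cases zs) auto
    ultimately have "steps ?q \<subseteq> E" using less(4) by blast
    moreover have "length ?q < length p" "?q \<noteq> []" by (simp_all add: p)
    ultimately obtain q where "wlk E q" "hd q = hd ?q" "last q = last ?q" "set q \<subseteq> set ?q"
      using less(1)[of ?q] by metis
    moreover have "hd ?q = hd p" by (cases xs) (simp_all add: p)
    moreover have "last ?q = last p" by (cases zs) (simp_all add: p)
    moreover have "set ?q \<subseteq> set p" by (auto simp: p)
    ultimately show ?thesis using less(2)[of q] by auto
  qed
qed

lemma steps_snoc_fst: "(x, y) \<in> steps (xs @ [s]) \<Longrightarrow> x \<in> set xs"
  by (cases "xs = []") (auto simp: steps_append dest: steps_in_set)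

lemma steps_snoc_cover: "a \<in> set xs \<Longrightarrow> \<exists>b. (a, b) \<in> steps (xs @ [s])"
proof (induction xs)
  case (Cons x xs)
  then show ?case by (cases xs) auto
qed simp

lemma steps_Cons_snd: "(x, y) \<in> steps (s # xs) \<Longrightarrow> y \<in> set xs"
  by (cases xs) (auto dest: steps_in_set)

lemma wlk_prefix: "wlk E (xs @ ys) \<Longrightarrow> xs \<noteq> [] \<Longrightarrow> wlk E xs"
  using steps_append_subset(1)[of xs ys] by (auto simp: wlk_def)

lemma wlk_suffix: "wlk E (xs @ ys) \<Longrightarrow> ys \<noteq> [] \<Longrightarrow> wlk E ys"
  using steps_append_subset(2)[of ys xs] by (auto simp: wlk_def)

text \<open>Cut a walk at its first vertex in \<open>X\<close>. The initial part cannot use a step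
  out of \<open>x\<close>, because \<open>x\<close> lies in \<open>X\<close> and can only be its
  end.\<close>

lemma sep_first:
  assumes "sep E A B X" "x \<in> X" "sep (E - {(x, y)}) A X T"
  shows "sep E A B T"
  unfolding sep_def
proof (intro allI impI)
  fix p assume p: "wlk E p \<and> hd p \<in> A \<and> last p \<in> B"
  then have "\<exists>s\<in>set p. s \<in> X" using assms(1) by (auto simp: sep_def)
  then obtain p1 s p2 where s: "p = p1 @ s # p2" "s \<in> X" "\<forall>v\<in>set p1. v \<notin> X"
    using split_list_first_prop[of p "\<lambda>s. s \<in> X"] by blast
  then have w: "wlk E (p1 @ [s])" using wlk_prefix[of E "p1 @ [s]" p2] p by simp
  have "(x, y) \<notin> steps (p1 @ [s])" using steps_snoc_fst s(3) assms(2) by metis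
  then have "wlk (E - {(x, y)}) (p1 @ [s])" using w by (auto simp: wlk_def)
  moreover have "hd (p1 @ [s]) = hd p" using s(1) by (cases p1) auto
  ultimately have "set (p1 @ [s]) \<inter> T \<noteq> {}" using assms(3) p s(2) unfolding sep_def by (metis last_snoc)
  then show "set p \<inter> T \<noteq> {}" using s(1) by auto
qed

text \<open>The mirror image: after its last visit to \<open>Y\<close> a walk makes no step into
  \<open>y\<close>.\<close>

lemma sep_last:
  assumes "sep E A B Y" "y \<in> Y" "sep (E - {(x, y)}) Y B T"
  shows "sep E A B T"
  unfolding sep_def
proof (intro allI impI)
  fix p assume p: "wlk E p \<and> hd p \<in> A \<and> last p \<in> B"
  then have "\<exists>s\<in>set p. s \<in> Y" using assms(1) by (auto simp: sep_def)
  then obtain p1 s p2 where s: "p = p1 @ s # p2" "s \<in> Y" "\<forall>v\<in>set p2. v \<notin> Y"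
    using split_list_last_prop[of p "\<lambda>s. s \<in> Y"] by blast
  then have w: "wlk E (s # p2)" using wlk_suffix[of E p1 "s # p2"] p by simp
  have "(x, y) \<notin> steps (s # p2)" using steps_Cons_snd s(3) assms(2) by metis
  then have "wlk (E - {(x, y)}) (s # p2)" using w by (auto simp: wlk_def)
  moreover have "last (s # p2) = last p" using s(1) by auto
  ultimately have "set (s # p2) \<inter> T \<noteq> {}" using assms(3) p s(2) unfolding sep_def by (metis list.sel(1))
  then show "set p \<inter> T \<noteq> {}" using s(1) by auto
qed

definition dpaths :: "('a \<times> 'a) set \<Rightarrow> 'a set \<Rightarrow> 'a set \<Rightarrow> nat \<Rightarrow> 'a list set \<Rightarrow> bool" where
  "dpaths E A B k Ps \<longleftrightarrow> finite Ps \<and> card Ps = k \<and> (\<forall>p\<in>Ps. wlk E p \<and> hd p \<in> A \<and> last p \<in> B) \<and>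
     (\<forall>p\<in>Ps. \<forall>q\<in>Ps. p \<noteq> q \<longrightarrow> set p \<inter> set q = {})"

text \<open>There are as many disjoint paths as vertices in \<open>X\<close>, so their ends exhaust
  \<open>X\<close> and the paths can be indexed by them. The selector \<open>f\<close> is
  \<open>hd\<close> or \<open>last\<close>.\<close>

lemma dpaths_ends:
  assumes "dpaths E A B k Ps" "\<And>p. wlk E p \<Longrightarrow> f p \<in> set p" "\<And>p. p \<in> Ps \<Longrightarrow> f p \<in> X" "finite X" "card X = k"
  obtains P where "\<And>s. s \<in> X \<Longrightarrow> P s \<in> Ps \<and> f (P s) = s \<and> set (P s) \<inter> X = {s}"
proof -
  have "inj_on f Ps"
  proof (rule inj_onI)
    fix p q assume "p \<in> Ps" "q \<in> Ps" "f p = f q"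
    then show "p = q" using assms(1,2) unfolding dpaths_def by (metis disjoint_iff)
  qed
  then have "card (f ` Ps) = card X" using assms(1,5) by (simp add: card_image dpaths_def)
  then have "f ` Ps = X" using assms(3,4) by (simp add: card_subset_eq image_subset_iff)
  then have "\<forall>s\<in>X. \<exists>p\<in>Ps. f p = s" by blast
  then obtain P where P: "\<And>s. s \<in> X \<Longrightarrow> P s \<in> Ps \<and> f (P s) = s" by metis
  have w: "wlk E p" if "p \<in> Ps" for p using that assms(1) by (simp add: dpaths_def)
  have "set (P s) \<inter> X = {s}" if s: "s \<in> X" for s
  proof
    show "{s} \<subseteq> set (P s) \<inter> X" using P[OF s] assms(2)[OF w] s by fastforce
    show "set (P s) \<inter> X \<subseteq> {s}"
    proof
      fix t assume t: "t \<in> set (P s) \<inter> X"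
      then have "t \<in> set (P t)" using P[of t] assms(2)[OF w, of "P t"] by auto
      then have "P s = P t" using assms(1) P s t unfolding dpaths_def by blast
      then show "t \<in> {s}" using P s t by (metis IntD2 singletonI)
    qed
  qed
  then show thesis using that P by blast
qed

text \<open>Goering's induction on the number of edges.\<close>

theorem menger:
  assumes "finite E" "finite A" "finite B" "\<And>x. (x, x) \<notin> E"
    and "\<And>S. finite S \<Longrightarrow> sep E A B S \<Longrightarrow> k \<le> card S"
  shows "\<exists>Ps. dpaths E A B k Ps"
  using assms
proof (induction "card E" arbitrary: E A B rule: less_induct)
  case less
  show ?case
  proof (cases "E = {}")
    case True
    have "sep {} A B (A \<inter> B)"
      unfolding sep_def
    proof (intro allI impI)
      fix p :: "'a list" assume p: "wlk {} p \<and> hd p \<in> A \<and> last p \<in> B"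
      then obtain x where "p = [x]" by (cases p; cases "tl p") (auto simp: wlk_def)
      then show "set p \<inter> (A \<inter> B) \<noteq> {}" using p by auto
    qed
    then have "k \<le> card (A \<inter> B)" using less(6) less(3) True by simp
    then obtain X where X: "X \<subseteq> A \<inter> B" "card X = k" "finite X"
      using obtain_subset_with_card_n by metis
    have "dpaths E A B k ((\<lambda>x. [x]) ` X)"
      using X by (auto simp: dpaths_def wlk_def card_image inj_on_def)
    then show ?thesis by blast
  next
    case False
    then obtain x y where e: "(x, y) \<in> E" by auto
    define D where "D = E - {(x, y)}"
    have D: "card D < card E" "finite D" "\<And>x. (x, x) \<notin> D" "D \<subseteq> E"
      unfolding D_def using card_Diff1_less[OF less(2) e] less(2,5) by auto
    have neq: "x \<noteq> y" using e less(5) by blast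
    show ?thesis
    proof (cases "\<forall>S. finite S \<longrightarrow> sep D A B S \<longrightarrow> k \<le> card S")
      case True
      then obtain Ps where "dpaths D A B k Ps" using less(1)[OF D(1,2) less(3,4) D(3)] by blast
      then have "dpaths E A B k Ps" using D(4) unfolding dpaths_def wlk_def by blast
      then show ?thesis by blast
    next
      case False
      then obtain S where S: "finite S" "sep D A B S" "card S < k" by fastforce
      \<comment> \<open>A walk that avoids \<open>S\<close> must use the removed step and so
        contains both its ends. Hence \<open>S\<close> has exactly \<open>k - 1\<close> elements,
        and \<open>X\<close> and \<open>Y\<close> are separators of size \<open>k\<close>.\<close>
      have sx: "sep E A B (insert x S)" and sy: "sep E A B (insert y S)"
      proof -
        have *: "set p \<inter> S \<noteq> {} \<or> x \<in> set p \<and> y \<in> set p" if p: "wlk E p" "hd p \<in> A" "last p \<in> B" for p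
        proof (cases "(x, y) \<in> steps p")
          case True then show ?thesis using steps_in_set by metis
        next
          case False
          then have "wlk D p" using p(1) by (auto simp: wlk_def D_def)
          then show ?thesis using S(2) p by (auto simp: sep_def)
        qed
        show "sep E A B (insert x S)" "sep E A B (insert y S)"
          unfolding sep_def using * by blast+
      qed
      have kx: "k \<le> card (insert x S)" "k \<le> card (insert y S)"
        using less(6) sx sy S(1) by simp_all
      define X where "X = insert x S"
      define Y where "Y = insert y S"
      have xy: "x \<notin> S" "y \<notin> S" and card: "card X = k" "card Y = k" "finite X" "finite Y"
        using kx S by (auto simp: X_def Y_def card_insert_if split: if_splits)
      have "\<And>T. finite T \<Longrightarrow> sep D A X T \<Longrightarrow> k \<le> card T"
        using less(6) sep_first[OF sx, of x y] unfolding D_def X_def by blast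
      then obtain Ps where Ps: "dpaths D A X k Ps" using less(1)[OF D(1,2) less(3) card(3) D(3)] by blast
      have "\<And>T. finite T \<Longrightarrow> sep D Y B T \<Longrightarrow> k \<le> card T"
        using less(6) sep_last[OF sy, of y x] unfolding D_def Y_def by blast
      then obtain Qs where Qs: "dpaths D Y B k Qs" using less(1)[OF D(1,2) card(4) less(4) D(3)] by blast
      have "last p \<in> X" if "p \<in> Ps" for p using that Ps by (simp add: dpaths_def)
      then obtain P where P: "\<And>s. s \<in> X \<Longrightarrow> P s \<in> Ps \<and> last (P s) = s \<and> set (P s) \<inter> X = {s}"
        using dpaths_ends[OF Ps, of last X] card by (auto simp: wlk_def)
      have "hd p \<in> Y" if "p \<in> Qs" for p using that Qs by (simp add: dpaths_def)
      then obtain Q where Q: "\<And>s. s \<in> Y \<Longrightarrow> Q s \<in> Qs \<and> hd (Q s) = s \<and> set (Q s) \<inter> Y = {s}"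
        using dpaths_ends[OF Qs, of hd Y] card by (auto simp: wlk_def)
      have wP: "wlk D (P s)" "hd (P s) \<in> A" if "s \<in> X" for s
        using P[OF that] Ps by (simp_all add: dpaths_def)
      have wQ: "wlk D (Q s)" "last (Q s) \<in> B" if "s \<in> Y" for s
        using Q[OF that] Qs by (simp_all add: dpaths_def)
      have PP: "set (P s) \<inter> set (P t) = {}" if "s \<in> X" "t \<in> X" "s \<noteq> t" for s t
        using P that Ps unfolding dpaths_def by metis
      have QQ: "set (Q s) \<inter> set (Q t) = {}" if "s \<in> Y" "t \<in> Y" "s \<noteq> t" for s t
        using Q that Qs unfolding dpaths_def by metis
      \<comment> \<open>Splicing the two paths at a common vertex \<open>v\<close> gives an
        \<open>A\<close>-\<open>B\<close> walk without the step \<open>(x, y)\<close>. It must meet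
        \<open>S\<close>, which is possible only if \<open>v\<close> is the last vertex of the first
        path and the first of the second.\<close>
      have PQ: "v = s \<and> s = t" if st: "s \<in> X" "t \<in> Y" "v \<in> set (P s)" "v \<in> set (Q t)" for s t v
      proof -
        obtain p1 p2 where p: "P s = p1 @ v # p2" using st(3) split_list by metis
        obtain q1 q2 where q: "Q t = q1 @ v # q2" using st(4) split_list by metis
        let ?w = "(p1 @ [v]) @ q2"
        have "steps (p1 @ [v]) \<subseteq> D" "steps (v # q2) \<subseteq> D"
          using steps_append_subset(1)[of "p1 @ [v]" p2] steps_append_subset(2)[of "v # q2" q1]
            wP[OF st(1)] wQ[OF st(2)] p q by (auto simp: wlk_def)
        moreover have "steps ?w \<subseteq> steps (p1 @ [v]) \<union> steps (v # q2)"
          using steps_append[of "p1 @ [v]" q2] by (cases q2) auto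
        ultimately have "steps ?w \<subseteq> D" by blast
        then obtain w where w: "wlk D w" "hd w = hd ?w" "last w = last ?w" "set w \<subseteq> set ?w"
          using walk_shorten[of ?w D] by blast
        have "hd ?w = hd (P s)" by (cases p1) (auto simp: p)
        moreover have "last ?w = last (Q t)" by (auto simp: q)
        ultimately have "set w \<inter> S \<noteq> {}"
          using S(2) w wP(2)[OF st(1)] wQ(2)[OF st(2)] unfolding sep_def by metis
        then obtain z where z: "z \<in> S" "z \<in> set ?w" using w(4) by blast
        have dP: "distinct (p1 @ v # p2)" and dQ: "distinct (q1 @ v # q2)"
          using wP[OF st(1)] wQ[OF st(2)] p q by (auto simp: wlk_def)
        show ?thesis
        proof (cases "z \<in> set (p1 @ [v])")
          case True
          then have "z \<in> set (P s) \<inter> X" using z(1) by (auto simp: p X_def)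
          then have "z \<in> {s}" using P[OF st(1)] by metis
          then have "z = s" by simp
          have "p2 = []"
          proof (rule ccontr)
            assume "p2 \<noteq> []"
            then have "last (P s) = last p2" by (simp add: p)
            then have "s \<in> set p2" using P[OF st(1)] last_in_set[OF \<open>p2 \<noteq> []\<close>] by simp
            then show False using \<open>z = s\<close> True dP by auto
          qed
          then have "v = s" using P[OF st(1)] p by simp
          then have "v \<in> set (Q t) \<inter> Y" using z(1) \<open>z = s\<close> st(4) by (simp add: Y_def)
          then have "v \<in> {t}" using Q[OF st(2)] by metis
          then show ?thesis using \<open>v = s\<close> by simp
        next
          case False
          then have "z \<in> set (v # q2)" using z(2) by auto
          then have "z \<in> set (Q t) \<inter> Y" using z(1) by (auto simp: q Y_def)
          then have "z \<in> {t}" using Q[OF st(2)] by metis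
          then have "z = t" by simp
          have "q1 = []"
          proof (rule ccontr)
            assume "q1 \<noteq> []"
            then have "hd (Q t) = hd q1" by (simp add: q)
            then have "t \<in> set q1" using Q[OF st(2)] hd_in_set[OF \<open>q1 \<noteq> []\<close>] by simp
            then show False using \<open>z = t\<close> \<open>z \<in> set (v # q2)\<close> dQ by auto
          qed
          then have "v = t" using Q[OF st(2)] q by simp
          then have "v \<in> set (P s) \<inter> X" using z(1) \<open>z = t\<close> st(3) by (simp add: X_def)
          then have "v \<in> {s}" using P[OF st(1)] by metis
          then show ?thesis using \<open>v = t\<close> by simp
        qed
      qed
      \<comment> \<open>The path ending in \<open>s\<close> is continued by the path starting in
        \<open>s\<close>, where \<open>tl\<close> avoids repeating \<open>s\<close>; only the path
        ending in \<open>x\<close> crosses the removed step and continues from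
        \<open>y\<close>.\<close>
      define g where "g s = (if s = x then y else s)" for s
      define Q' where "Q' s = (if s = x then Q y else tl (Q s))" for s
      define R where "R s = P s @ Q' s" for s
      have g: "g s \<in> Y" if "s \<in> X" for s using that by (auto simp: g_def X_def Y_def)
      have Q'g: "set (Q' s) \<subseteq> set (Q (g s))" for s
        by (cases "Q s") (auto simp: Q'_def g_def)
      have yX: "y \<notin> X" using xy neq by (simp add: X_def)
      have ginj: "s = t" if "s \<in> X" "t \<in> X" "g s = g t" for s t
        using that yX unfolding g_def by (cases "s = x"; cases "t = x") auto
      have sg: "g t \<noteq> s" if "s \<in> X" "t \<in> X" "s \<noteq> t" for s t
        using that yX unfolding g_def by (cases "t = x") auto
      have disj: "set (R s) \<inter> set (R t) = {}" if st: "s \<in> X" "t \<in> X" "s \<noteq> t" for s t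
      proof -
        have "set (P s) \<inter> set (Q (g t)) = {}"
          using PQ[OF st(1) g[OF st(2)]] sg[OF st] by fastforce
        moreover have "set (P t) \<inter> set (Q (g s)) = {}"
          using PQ[OF st(2) g[OF st(1)]] sg[OF st(2,1)] st(3) by fastforce
        moreover have "set (Q (g s)) \<inter> set (Q (g t)) = {}"
          using QQ[OF g[OF st(1)] g[OF st(2)]] ginj[OF st(1,2)] st(3) by blast
        ultimately show ?thesis using PP[OF st] Q'g[of s] Q'g[of t] unfolding R_def by auto
      qed
      have good: "wlk E (R s) \<and> hd (R s) \<in> A \<and> last (R s) \<in> B" if s: "s \<in> X" for s
      proof -
        have ne: "P s \<noteq> []" using wP[OF s] by (simp add: wlk_def)
        have dP: "distinct (P s)" "steps (P s) \<subseteq> E" using wP[OF s] D(4) by (auto simp: wlk_def)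
        have hd: "hd (R s) \<in> A" using ne wP(2)[OF s] by (simp add: R_def)
        show ?thesis
        proof (cases "s = x")
          case True
          have y: "y \<in> Y" by (simp add: Y_def)
          have Qy: "Q y \<noteq> []" "distinct (Q y)" "steps (Q y) \<subseteq> E" using wQ[OF y] D(4) by (auto simp: wlk_def)
          have "set (P s) \<inter> set (Q y) = {}" using PQ[OF s y] True neq by blast
          moreover have "steps (R s) = insert (x, y) (steps (P s) \<union> steps (Q y))"
            using ne Qy(1) P[OF s] Q[OF y] True by (simp add: R_def Q'_def steps_append)
          ultimately show ?thesis using hd e dP Qy wQ[OF y] True ne by (auto simp: wlk_def R_def Q'_def)
        next
          case False
          then have y: "s \<in> Y" using s by (simp add: X_def Y_def)
          then obtain r where r: "Q s = s # r" using wQ[OF y] Q[OF y] by (cases "Q s") (auto simp: wlk_def)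
          have Qr: "distinct (s # r)" "steps (s # r) \<subseteq> E" using wQ[OF y] D(4) r by (auto simp: wlk_def)
          have Rs: "R s = P s @ r" using False r by (simp add: R_def Q'_def)
          have "set (P s) \<inter> set r = {}" using PQ[OF s y] r Qr(1) by fastforce
          moreover have "steps (R s) \<subseteq> E"
          proof (cases r)
            case Nil then show ?thesis using Rs dP by simp
          next
            case (Cons b r') then show ?thesis using Rs dP Qr(2) P[OF s] ne by (auto simp: steps_append)
          qed
          moreover have "last (R s) \<in> B"
            using wQ(2)[OF y] Rs r P[OF s] ne by (cases "r = []") auto
          ultimately show ?thesis using hd dP ne Qr(1) Rs by (auto simp: wlk_def)
        qed
      qed
      have "inj_on R X"
      proof (rule inj_onI)
        fix s t assume st: "s \<in> X" "t \<in> X" "R s = R t"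
        have "R s \<noteq> []" using good[OF st(1)] by (auto simp: wlk_def)
        then show "s = t" using disj[OF st(1,2)] st(3) by auto
      qed
      then have "card (R ` X) = k" using card by (simp add: card_image)
      then have "dpaths E A B k (R ` X)"
        unfolding dpaths_def using good disj card(3) by fastforce
      then show ?thesis by blast
    qed
  qed
qed

context sgraph
begin

text \<open>Connectivity as an edge across every partition of what remains. A complete graph
  satisfies it for every \<open>m\<close>, so the lower bound on the degrees is supplied
  separately.\<close>

definition conn :: "nat \<Rightarrow> bool" where
  "conn m \<longleftrightarrow> (\<forall>A B S. A \<noteq> {} \<longrightarrow> B \<noteq> {} \<longrightarrow> A \<inter> B = {} \<longrightarrow> A \<union> B = V - S \<longrightarrow> card S < m \<longrightarrow> finite S \<longrightarrow>
     (\<exists>a\<in>A. \<exists>b\<in>B. adj a b))"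

text \<open>Menger's theorem without the edges at \<open>x\<close>, from the neighbours of
  \<open>x\<close> to \<open>T\<close>. Each path is cut at its first vertex in \<open>T\<close>, so
  the inner part \<open>q u\<close>, possibly empty, avoids \<open>T\<close>.\<close>

lemma fan:
  assumes "conn m" "T \<subseteq> V" "x \<in> V - T" "t \<le> m" "t \<le> card T"
  obtains U q where "U \<subseteq> T" "card U = t"
    "\<And>u. u \<in> U \<Longrightarrow> pth (x # q u) \<and> set (q u) \<subseteq> V - T \<and> adj (last (x # q u)) u"
    "\<And>u v. u \<in> U \<Longrightarrow> v \<in> U \<Longrightarrow> u \<noteq> v \<Longrightarrow> set (q u) \<inter> set (q v) = {}"
proof -
  define E where "E = {(a, b). adj a b \<and> a \<noteq> x \<and> b \<noteq> x}"
  have "E \<subseteq> V \<times> V" using adj_V by (auto simp: E_def)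
  then have finE: "finite E" using finV finite_subset by blast
  have fT: "finite T" using assms(2) finV finite_subset by blast
  have sep: "t \<le> card S" if S: "finite S" "sep E (nb V x) T S" for S
  proof (rule ccontr)
    assume "\<not> t \<le> card S"
    then have lt: "card S < m" "card S < card T" using assms by auto
    define S' where "S' = S - {x}"
    have S': "card S' < m" "card S' < card T" "finite S'"
      using lt S(1) card_Diff1_le[of S x] unfolding S'_def by (auto intro: le_less_trans)
    \<comment> \<open>What \<open>x\<close> can reach without meeting \<open>S\<close>. The part of
      \<open>T\<close> outside \<open>S'\<close> is not reached, so connectivity gives an edge
      leaving \<open>R\<close>, and this edge would extend a walk.\<close>
    define R where "R = insert x {y. \<exists>p. wlk E p \<and> hd p \<in> nb V x \<and> last p = y \<and> set p \<inter> S = {}}"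
    have "E \<subseteq> V \<times> V" by fact
    have RV: "R \<subseteq> V - S'"
    proof
      fix y assume "y \<in> R"
      then consider "y = x" | p where "wlk E p" "hd p \<in> nb V x" "last p = y" "set p \<inter> S = {}"
        unfolding R_def by blast
      then show "y \<in> V - S'"
      proof cases
        case 1 then show ?thesis using assms(3) by (simp add: S'_def)
      next
        case 2
        have "set p \<subseteq> V"
        proof (cases "length p \<le> 1")
          case True
          then have "p = [hd p]" using 2(1) by (cases p) (auto simp: wlk_def)
          then show ?thesis using 2(2) by (metis (no_types, lifting) list.set(1,2) mem_Collect_eq nb_def
                empty_subsetI insert_subset)
        next
          case False
          obtain p' s where p: "p = p' @ [s]" "p' \<noteq> []" using False by (cases p rule: rev_cases) auto
          have st: "steps p \<subseteq> V \<times> V" using 2(1) \<open>E \<subseteq> V \<times> V\<close> by (auto simp: wlk_def)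
          have "(last p', s) \<in> steps p" using p by (simp add: steps_append)
          then have "s \<in> V" using st by blast
          moreover have "z \<in> V" if "z \<in> set p'" for z
            using steps_snoc_cover[OF that, of s] st p(1) by blast
          ultimately show ?thesis using p(1) by auto
        qed
        moreover have "y \<in> set p" using 2 by (auto simp: wlk_def)
        ultimately show ?thesis using 2(4) by (auto simp: S'_def)
      qed
    qed
    have "\<not> T \<subseteq> S'" using S' fT by (meson card_mono leD)
    then obtain z where z: "z \<in> T" "z \<notin> S'" by blast
    have "z \<notin> R"
    proof
      assume "z \<in> R"
      then show False using S(2) z assms(3) unfolding R_def sep_def by auto
    qed
    then have "V - S' - R \<noteq> {}" using z assms(2) by blast
    moreover have "R \<inter> (V - S' - R) = {}" "R \<union> (V - S' - R) = V - S'" using RV by auto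
    moreover have "R \<noteq> {}" by (simp add: R_def)
    ultimately obtain a b where ab: "a \<in> R" "b \<in> V - S' - R" "adj a b"
      using assms(1) S'(1,3) unfolding conn_def by meson
    have bx: "b \<noteq> x" "b \<notin> S" using ab(2) by (auto simp: R_def S'_def)
    have "b \<in> R"
    proof (cases "a = x")
      case True
      then have "wlk E [b] \<and> hd [b] \<in> nb V x \<and> last [b] = b \<and> set [b] \<inter> S = {}"
        using ab bx by (auto simp: wlk_def nb_def)
      then show ?thesis unfolding R_def by blast
    next
      case False
      then obtain p where p: "wlk E p" "hd p \<in> nb V x" "last p = a" "set p \<inter> S = {}" using ab(1) by (auto simp: R_def)
      have "steps (p @ [b]) \<subseteq> E" using p ab(3) bx False by (auto simp: wlk_def steps_append E_def)
      then obtain q where q: "wlk E q" "hd q = hd (p @ [b])" "last q = last (p @ [b])" "set q \<subseteq> set (p @ [b])"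
        using walk_shorten[of "p @ [b]" E] by blast
      moreover have "hd (p @ [b]) = hd p" using p by (simp add: wlk_def)
      ultimately have "wlk E q \<and> hd q \<in> nb V x \<and> last q = b \<and> set q \<inter> S = {}" using p bx by auto
      then show ?thesis unfolding R_def by blast
    qed
    then show False using ab(2) by blast
  qed
  have "\<And>a. (a, a) \<notin> E" using adj_irrefl by (auto simp: E_def)
  then obtain Ps where Ps: "dpaths E (nb V x) T t Ps"
    using menger[OF finE finite_nb fT _ sep] by blast
  have "\<exists>q u r. p = q @ u # r \<and> u \<in> T \<and> set q \<inter> T = {}" if p: "p \<in> Ps" for p
  proof -
    have "\<exists>u\<in>set p. u \<in> T" using Ps p unfolding dpaths_def wlk_def by (metis last_in_set)
    then show ?thesis using split_list_first_prop[of p "\<lambda>u. u \<in> T"] by blast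
  qed
  then obtain fq fu fr where f: "\<And>p. p \<in> Ps \<Longrightarrow> p = fq p @ fu p # fr p \<and> fu p \<in> T \<and> set (fq p) \<inter> T = {}"
    by metis
  have fp: "fu p \<in> set p" "set (fq p) \<subseteq> set p" if "p \<in> Ps" for p
    using f[OF that] by (metis in_set_conv_decomp, metis set_append Un_upper1)
  have inj: "inj_on fu Ps"
  proof (rule inj_onI)
    fix p q assume "p \<in> Ps" "q \<in> Ps" "fu p = fu q"
    then show "p = q" using Ps fp(1) unfolding dpaths_def by (metis disjoint_iff)
  qed
  define h where "h = the_inv_into Ps fu"
  have h: "h (fu p) = p" if "p \<in> Ps" for p using that inj by (simp add: h_def the_inv_into_f_f)
  show thesis
  proof (rule that[of "fu ` Ps" "\<lambda>u. fq (h u)"])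
    show "fu ` Ps \<subseteq> T" using f by blast
    show "card (fu ` Ps) = t" using inj Ps by (simp add: card_image dpaths_def)
  next
    fix u assume "u \<in> fu ` Ps"
    then obtain p where p: "p \<in> Ps" "u = fu p" by blast
    let ?q = "fq p"
    have w: "wlk E (?q @ u # fr p)" "hd (?q @ u # fr p) \<in> nb V x" using Ps p f[OF p(1)] by (auto simp: dpaths_def)
    have "wlk E ((?q @ [u]) @ fr p)" using w by simp
    then have w2: "distinct (?q @ [u])" "steps (?q @ [u]) \<subseteq> E"
      using wlk_prefix[of E "?q @ [u]" "fr p"] by (auto simp: wlk_def)
    have nx: "adj a b \<and> a \<noteq> x" if "(a, b) \<in> steps (?q @ [u])" for a b using w2(2) that by (auto simp: E_def)
    have uT: "u \<in> T" using f p by blast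
    have "pth (x # ?q) \<and> set ?q \<subseteq> V - T \<and> adj (last (x # ?q)) u"
    proof (cases "?q = []")
      case True then show ?thesis using w(2) by (auto simp: nb_def)
    next
      case False
      have st: "steps (?q @ [u]) = insert (last ?q, u) (steps ?q)" using False by (simp add: steps_append)
      have pq: "pth ?q" using w2 nx st by (auto simp: pth_def)
      have q1: "\<exists>b. (a, b) \<in> steps (?q @ [u])" if "a \<in> set ?q" for a
        using steps_snoc_cover[OF that] .
      have "x \<notin> set ?q" using q1 nx by blast
      moreover have "set ?q \<subseteq> V" using q1 nx adj_V by blast
      moreover have "set ?q \<inter> T = {}" using f p by blast
      moreover have "adj x (hd ?q)" using w(2) False by (auto simp: nb_def)
      moreover have "adj (last ?q) u" using nx st by blast
      ultimately show ?thesis using False pq by (auto simp: pth_Cons)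
    qed
    then show "pth (x # fq (h u)) \<and> set (fq (h u)) \<subseteq> V - T \<and> adj (last (x # fq (h u))) u"
      using h p by simp
  next
    fix u v assume "u \<in> fu ` Ps" "v \<in> fu ` Ps" "u \<noteq> v"
    then obtain p p' where p: "p \<in> Ps" "u = fu p" "p' \<in> Ps" "v = fu p'" by blast
    then have "p \<noteq> p'" using \<open>u \<noteq> v\<close> by blast
    have "set p \<inter> set p' = {}" using Ps p \<open>p \<noteq> p'\<close> unfolding dpaths_def by simp
    then show "set (fq (h u)) \<inter> set (fq (h v)) = {}"
      unfolding p(2,4) h[OF p(1)] h[OF p(3)] using fp(2)[OF p(1)] fp(2)[OF p(3)] by blast
  qed
qed

end

section \<open>Existence of disjoint cycles\<close>

context sgraph
begin

lemma subpath:
  assumes "pth p" "u \<in> set p" "v \<in> set p"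
  obtains s where "pth s" "s \<noteq> []" "hd s = u" "last s = v" "set s \<subseteq> set p" "u \<noteq> v \<Longrightarrow> 2 \<le> length s"
proof -
  have main: "\<exists>s. pth s \<and> s \<noteq> [] \<and> hd s = a \<and> last s = b \<and> set s \<subseteq> set p \<and> 2 \<le> length s"
    if "pth (A @ a # B @ b # C)" "set (A @ a # B @ b # C) \<subseteq> set p" for A B C a b
  proof -
    have "pth (a # B @ [b])"
      using that(1) pth_appendD[of A "a # B @ b # C"] pth_appendD[of "a # B @ [b]" C] by simp
    then show ?thesis using that(2) by (intro exI[of _ "a # B @ [b]"]) auto
  qed
  consider "u = v" | A B C where "p = A @ u # B @ v # C" | A B C where "p = A @ v # B @ u # C"
  proof -
    obtain A B where AB: "p = A @ u # B" using assms(2) split_list by metis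
    then consider "u = v" | "v \<in> set A" | "v \<in> set B" using assms(3) by auto
    then show thesis
    proof cases
      case 2 then obtain A1 A2 where "A = A1 @ v # A2" using split_list by metis
      then show thesis using that(3) AB by simp
    next
      case 3 then obtain B1 B2 where "B = B1 @ v # B2" using split_list by metis
      then show thesis using that(2) AB by simp
    qed (use that in blast)
  qed
  then show thesis
  proof cases
    case 1 then show thesis using that[of "[u]"] assms by simp
  next
    case (2 A B C)
    then obtain s where "pth s" "s \<noteq> []" "hd s = u" "last s = v" "set s \<subseteq> set p" "2 \<le> length s"
      using main[of A u B v C] assms(1) by blast
    then show thesis using that by blast
  next
    case (3 A B C)
    then obtain s where "pth s" "s \<noteq> []" "hd s = v" "last s = u" "set s \<subseteq> set p" "2 \<le> length s"
      using main[of A v B u C] assms(1) by blast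
    then show thesis using that[of "rev s"] by (simp add: hd_rev last_rev)
  qed
qed

lemma link_paths:
  assumes "pth s" "pth t" "set s \<inter> set t = {}" "s \<noteq> []" "t \<noteq> []" "3 \<le> length s + length t"
    "adj (last s) (hd t)" "adj (last t) (hd s)"
  shows "cyc (s @ t)"
  using assms by (simp add: cyc_iff pth_append)

lemma two_links:
  assumes "pth p" "pth q" "set p \<inter> set q = {}" "u \<in> set p" "v \<in> set p" "a \<in> set q" "b \<in> set q"
    "adj u a" "adj v b" "u \<noteq> v \<or> a \<noteq> b"
  obtains c where "cyc c" "set c \<subseteq> set p \<union> set q"
proof -
  obtain s where s: "pth s" "s \<noteq> []" "hd s = u" "last s = v" "set s \<subseteq> set p" "u \<noteq> v \<Longrightarrow> 2 \<le> length s"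
    using subpath[OF assms(1,4,5)] by metis
  obtain t where t: "pth t" "t \<noteq> []" "hd t = b" "last t = a" "set t \<subseteq> set q" "b \<noteq> a \<Longrightarrow> 2 \<le> length t"
    using subpath[OF assms(2,7,6)] by metis
  have "1 \<le> length s" "1 \<le> length t" using s(2) t(2) by (simp_all add: Suc_le_eq)
  then have "3 \<le> length s + length t" using s(6) t(6) assms(10) by fastforce
  then have "cyc (s @ t)" using s t assms adj_sym by (intro link_paths) auto
  moreover have "set (s @ t) \<subseteq> set p \<union> set q" using s(5) t(5) by auto
  ultimately show thesis using that by blast
qed

lemma cyc_path:
  assumes "cyc c" "rot c (x # R)" shows "pth R" "pth (x # R)" "set R = set c - {x}" "x \<in> set c" "R \<noteq> []"
proof -
  have c: "cyc (x # R)" using cyc_rot assms by blast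
  then show "pth (x # R)" by (simp add: cyc_iff)
  then show "pth R" by (simp add: pth_Cons) fastforce
  have "set c = insert x (set R)" using rot_props(1)[OF assms(2)] by simp
  moreover have "x \<notin> set R" using c by (simp add: cyc_def)
  ultimately show "set R = set c - {x}" "x \<in> set c" by auto
  show "R \<noteq> []" using c by (auto simp: cyc_def)
qed

lemma rot_two:
  assumes "u \<in> set c" "v \<in> set c" "u \<noteq> v"
  obtains A B where "rot c (u # A @ v # B)"
proof -
  obtain R where R: "rot c (u # R)" using rot_at assms(1) by metis
  then have "v \<in> set R" using rot_props(1)[OF R] assms by auto
  then show thesis using that R by (metis split_list)
qed

lemma pth_arc: "pth (u # A @ v # B) \<Longrightarrow> pth (u # A @ [v])"
  using pth_appendD[of "u # A @ [v]" B] by simp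

lemma two_nbrs_cycles:
  assumes "cyc c" "w \<notin> set c" "rot c (u # A @ v # B)" "adj w u" "adj w v"
  shows "cyc (w # u # A @ [v])" "cyc (w # v # B @ [u])"
proof -
  have c: "cyc (u # A @ v # B)" "set (u # A @ v # B) = set c" using cyc_rot assms rot_props(1) by blast+
  have "rot c (v # B @ u # A)" using rot_append[of c "u # A" "v # B"] assms(3) by simp
  then have c': "cyc (v # B @ u # A)" using cyc_rot assms by blast
  have "pth (u # A @ [v])" "pth (v # B @ [u])" using c c' by (auto simp: cyc_iff intro: pth_arc)
  then show "cyc (w # u # A @ [v])" "cyc (w # v # B @ [u])"
    using c(2) assms adj_sym by (auto simp: cyc_iff)
qed

lemma sum_dg_swap:
  assumes "finite A" "finite B"
  shows "(\<Sum>a\<in>A. dg B a) = (\<Sum>b\<in>B. dg A b)"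
proof -
  have eq: "dg S x = (\<Sum>y\<in>S. if adj x y then 1 else 0)" if "finite S" for S x
    using that by (simp add: dg_def nb_def sum.If_cases Int_def)
  have "(\<Sum>a\<in>A. dg B a) = (\<Sum>a\<in>A. \<Sum>b\<in>B. if adj a b then 1 else 0)" using eq[OF assms(2)] by simp
  also have "\<dots> = (\<Sum>b\<in>B. \<Sum>a\<in>A. if adj b a then 1 else 0)"
    using adj_commute by (subst sum.swap) simp
  finally show ?thesis using eq[OF assms(1)] by simp
qed

text \<open>Twice the number of edges inside \<open>T\<close>.\<close>

definition ne :: "'a set \<Rightarrow> nat" where "ne T = (\<Sum>a\<in>T. dg T a)"

lemma dg_insert: "a \<notin> T \<Longrightarrow> dg (insert a T) v = dg T v + (if adj v a then 1 else 0)"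
proof -
  assume "a \<notin> T"
  then have "dg (T \<union> {a}) v = dg T v + dg {a} v" by (intro dg_Un) auto
  moreover have "nb {a} v = (if adj v a then {a} else {})" by (auto simp: nb_def)
  ultimately show ?thesis by (simp add: dg_def)
qed

lemma ne_insert:
  assumes "finite T" "a \<notin> T"
  shows "ne (insert a T) = ne T + 2 * dg T a"
proof -
  have "(\<Sum>t\<in>T. if adj t a then 1 else 0) = dg T a"
    using assms(1) by (simp add: dg_def nb_def sum.If_cases Int_def adj_commute)
  then show ?thesis using assms by (simp add: ne_def dg_insert sum.distrib adj_irrefl)
qed

text \<open>The gain is the proper inclusion. A vertex of \<open>Q\<close> with two links closes a
  cycle with \<open>L\<close> alone and misses the rest of \<open>Q\<close>. Otherwise three
  vertices of \<open>Q\<close> are linked, and a cycle through the first two misses the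
  third.\<close>

lemma short_cycle_in_two_paths:
  assumes "pth Q" "2 \<le> length Q" "pth L" "set Q \<inter> set L = {}" "3 \<le> (\<Sum>p\<in>set L. dg (set Q) p)"
  obtains t where "cyc t" "set t \<subset> set Q \<union> set L"
proof (cases "\<exists>a\<in>set Q. 2 \<le> dg (set L) a")
  case True
  then obtain a where a: "a \<in> set Q" "2 \<le> dg (set L) a" by blast
  then obtain b b' where b: "b \<in> set L" "b' \<in> set L" "b \<noteq> b'" "adj a b" "adj a b'"
    by (auto simp: dg_def nb_def numeral_2_eq_2 card_le_Suc_iff)
  have "set [a] \<inter> set L = {}" using a assms by auto
  then obtain t where t: "cyc t" "set t \<subseteq> set [a] \<union> set L"
    using two_links[of "[a]" L a a b b'] b assms(3) by auto
  obtain a' where "a' \<in> set Q" "a' \<noteq> a"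
  proof -
    have "card (set Q) \<ge> 2" using assms(1,2) by (simp add: pth_def distinct_card)
    then have "\<not> set Q \<subseteq> {a}" using card_mono[of "{a}" "set Q"] by auto
    then show thesis using that by blast
  qed
  then have "set t \<subset> set Q \<union> set L" using t(2) a(1) assms(4) by auto
  then show thesis using that t(1) by blast
next
  case False
  define A where "A = {a \<in> set Q. \<exists>b\<in>set L. adj a b}"
  have "(\<Sum>p\<in>set L. dg (set Q) p) = (\<Sum>a\<in>set Q. dg (set L) a)" by (simp add: sum_dg_swap)
  also have "\<dots> \<le> (\<Sum>a\<in>set Q. if a \<in> A then 1 else 0)"
    using False dg_pos[of "set L"] by (intro sum_mono) (force simp: A_def not_le numeral_2_eq_2 less_Suc_eq_le)
  also have "\<dots> = card A" by (simp add: sum.If_cases Int_def A_def)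
  finally have cA: "3 \<le> card A" using assms(5) by simp
  have fA: "finite A" by (simp add: A_def)
  have "A \<noteq> {}" using cA by (metis card.empty not_numeral_le_zero)
  then have "\<exists>a\<in>set Q. a \<in> A" by (auto simp: A_def)
  then obtain Q1 a1 R where Q: "Q = Q1 @ a1 # R" "a1 \<in> A" "\<forall>x\<in>set Q1. x \<notin> A"
    using split_list_first_prop[of Q "\<lambda>a. a \<in> A"] by blast
  have AR: "A - {a1} \<subseteq> set R" using Q by (auto simp: A_def)
  have c2: "2 \<le> card (A - {a1})" using cA fA Q(2) by simp
  then have "A - {a1} \<noteq> {}" by (metis card.empty not_numeral_le_zero)
  then have "\<exists>a\<in>set R. a \<in> A" using AR by blast
  then obtain R1 a2 R2 where R: "R = R1 @ a2 # R2" "a2 \<in> A" "\<forall>x\<in>set R1. x \<notin> A"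
    using split_list_first_prop[of R "\<lambda>a. a \<in> A"] by blast
  have dQ: "distinct Q" using assms(1) by (simp add: pth_def)
  have "card (A - {a1}) - card {a2} \<le> card (A - {a1} - {a2})" by (rule diff_card_le_card_Diff) simp
  then have "card (A - {a1} - {a2}) \<ge> 1" using c2 by simp
  then have "A - {a1} - {a2} \<noteq> {}" by (metis card.empty not_one_le_zero)
  then obtain a3 where a3: "a3 \<in> A - {a1} - {a2}" by blast
  have "a3 \<in> set Q" using a3 by (auto simp: A_def)
  have "a3 \<notin> set (a1 # R1 @ [a2])" using a3 R by auto
  have "pth (Q1 @ a1 # R1 @ a2 # R2)" using assms(1) Q(1) R(1) by simp
  then have "pth (a1 # R1 @ a2 # R2)" using pth_appendD by blast
  then have p1: "pth (a1 # R1 @ [a2])" by (rule pth_arc)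
  obtain b1 b2 where b: "b1 \<in> set L" "adj a1 b1" "b2 \<in> set L" "adj a2 b2" using Q R by (auto simp: A_def)
  have sub: "set (a1 # R1 @ [a2]) \<subseteq> set Q" using Q R by auto
  have "a1 \<noteq> a2" using dQ Q R by auto
  then obtain t where t: "cyc t" "set t \<subseteq> set (a1 # R1 @ [a2]) \<union> set L"
    using two_links[of "a1 # R1 @ [a2]" L a1 a2 b1 b2] p1 assms(3,4) sub b by auto
  have "a3 \<notin> set t" using t(2) \<open>a3 \<notin> set (a1 # R1 @ [a2])\<close> \<open>a3 \<in> set Q\<close> assms(4) by auto
  then have "set t \<subset> set Q \<union> set L" using t(2) sub \<open>a3 \<in> set Q\<close> by auto
  then show thesis using that t(1) by blast
qed

lemma common_nbr:
  assumes "finite S" "card S < dg S y + dg S z"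
  obtains a where "a \<in> S" "adj y a" "adj z a"
proof -
  have "nb S y \<inter> nb S z \<noteq> {}"
  proof
    assume "nb S y \<inter> nb S z = {}"
    then have "card (nb S y \<union> nb S z) = dg S y + dg S z" by (simp add: card_Un_disjoint dg_def)
    moreover have "card (nb S y \<union> nb S z) \<le> card S" using assms(1) by (intro card_mono) (auto simp: nb_def)
    ultimately show False using assms(2) by simp
  qed
  then show thesis using that by (auto simp: nb_def)
qed

text \<open>Three summands of at most 3 with sum 7 include a 3, and the other two, if suitably
  ordered, exceed the three available vertices: they add up to at least 4.\<close>

lemma three_vertices_seven_edges:
  assumes "finite S" "card S = 3" "7 \<le> dg S x + dg S y + dg S z"
  shows "(dg S x = 3 \<and> (\<exists>a\<in>S. adj y a \<and> adj z a)) \<or> (dg S y = 3 \<and> (\<exists>a\<in>S. adj x a \<and> adj z a)) \<or>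
    (dg S z = 3 \<and> (\<exists>a\<in>S. adj x a \<and> adj y a))"
proof -
  have le: "dg S v \<le> 3" for v using dg_le_card[OF assms(1), of v] assms(2) by simp
  have com: "\<exists>a\<in>S. adj u a \<and> adj v a" if "4 \<le> dg S u + dg S v" for u v
  proof -
    have "card S < dg S u + dg S v" using that assms(2) by simp
    then show ?thesis using common_nbr[OF assms(1)] by metis
  qed
  consider "dg S x = 3" | "dg S y = 3" | "dg S z = 3" using assms(3) le[of x] le[of y] le[of z] by linarith
  then show ?thesis
  proof cases
    case 1 then show ?thesis using com[of y z] assms(3) by simp
  next
    case 2 then show ?thesis using com[of x z] assms(3) by simp
  next
    case 3 then show ?thesis using com[of x y] assms(3) by simp
  qed
qed

lemma dg_full: "finite S \<Longrightarrow> dg S x = card S \<Longrightarrow> a \<in> S \<Longrightarrow> adj x a"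
proof -
  assume S: "finite S" "dg S x = card S" "a \<in> S"
  have "nb S x \<subseteq> S" by (auto simp: nb_def)
  then have "nb S x = S" using S card_subset_eq unfolding dg_def by blast
  then show "adj x a" using S(3) by (auto simp: nb_def)
qed

lemma triangle_sides:
  assumes "cyc c" "length c = 3" "a \<in> set c"
  obtains b e where "set c = {a, b, e}" "adj a b" "adj b e" "adj e a" "a \<noteq> b" "b \<noteq> e" "a \<noteq> e"
proof -
  obtain R where R: "rot c (a # R)" using rot_at assms(3) by metis
  then have c: "cyc (a # R)" "length (a # R) = 3" "set (a # R) = set c"
    using cyc_rot[OF R] assms rot_props[OF R] by auto
  then obtain b e where "R = [b, e]" by (cases R; cases "tl R") auto
  then show thesis using that c by (auto simp: cyc_iff)
qed

end

text \<open>
  A counterexample to the induction step: \<open>F\<close> covers as few vertices as possible, so no exchange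
  shortens its cycles, and then leaves as many edges uncovered as possible, which excludes swapping a
  vertex of a triangle with an uncovered vertex of small degree.
\<close>

locale mincyc = sgraph +
  fixes F :: "'a list set" and j :: nat
  assumes cardV: "5 * j + 3 \<le> card V"
    and mindeg: "v \<in> V \<Longrightarrow> j + 2 \<le> deg v"
    and triple: "x \<in> V \<Longrightarrow> y \<in> V \<Longrightarrow> z \<in> V \<Longrightarrow> x \<noteq> y \<Longrightarrow> x \<noteq> z \<Longrightarrow> y \<noteq> z \<Longrightarrow>
      \<not> adj x y \<Longrightarrow> \<not> adj x z \<Longrightarrow> \<not> adj y z \<Longrightarrow> 6 * j + 5 \<le> deg x + deg y + deg z"
    and j1: "1 \<le> j"
    and nopk: "\<not> pk (Suc j) S"
    and F: "fam F" and cardF: "card F = j"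
    and min1: "pk j S \<Longrightarrow> card (vs F) \<le> card S"
    and max2: "pk j S \<Longrightarrow> card S = card (vs F) \<Longrightarrow> ne (V - S) \<le> ne (V - vs F)"
begin

abbreviation W :: "'a set" where "W \<equiv> V - vs F"

lemma finF: "finite F" using F by (simp add: fam_def)
lemma finW: "finite W" using finV by simp

lemma acycW: "acyc W"
  unfolding acyc_def
proof
  assume "\<exists>c. cyc c \<and> set c \<subseteq> W"
  then obtain c where "cyc c" "set c \<inter> vs F = {}" by blast
  then show False using pk_insert[OF pkI[OF F]] nopk cardF by metis
qed

text \<open>The last conclusion is minimality in usable form: an exchange of \<open>c\<close> within
  its own vertices and \<open>W\<close> never yields a shorter cycle.\<close>

lemma replace_cycle:
  assumes "c \<in> F" "cyc c'" "set c' \<subseteq> set c \<union> W"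
  shows "fam (insert c' (F - {c}))" "card (insert c' (F - {c})) = j"
    "vs (insert c' (F - {c})) = set c' \<union> (vs F - set c)"
    "card (vs (insert c' (F - {c}))) + length c = card (vs F) + length c'"
    "length c \<le> length c'"
proof -
  have dis: "set c' \<inter> (vs F - set c) = {}" using assms(3) by blast
  note r = fam_replace[OF F assms(1,2) dis]
  show "fam (insert c' (F - {c}))" "card (insert c' (F - {c})) = j"
    "vs (insert c' (F - {c})) = set c' \<union> (vs F - set c)" using r cardF by simp_all
  have c: "cyc c" using F assms(1) fam_cyc by blast
  have "card (set c' \<union> (vs F - set c)) = length c' + card (vs F - set c)"
    using dis fam_finite_vs[OF F] cyc_card[OF assms(2)] by (simp add: card_Un_disjoint)
  moreover have "card (vs F - set c) + length c = card (vs F)"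
    using set_sub_vs[OF assms(1)] fam_finite_vs[OF F] cyc_card[OF c]
    by (metis card_Diff_subset card_mono le_add_diff_inverse2 List.finite_set)
  ultimately show *: "card (vs (insert c' (F - {c}))) + length c = card (vs F) + length c'" using r(3) by simp
  have "pk j (vs (insert c' (F - {c})))" using pkI[OF r(1)] r(2) cardF by simp
  then show "length c \<le> length c'" using min1 * by fastforce
qed

lemma replace_two_cycles:
  assumes "c \<in> F" "d \<in> F" "c \<noteq> d" "cyc c'" "cyc d'" "set c' \<inter> set d' = {}"
    "set c' \<union> set d' \<subseteq> set c \<union> set d \<union> W"
  shows "length c + length d \<le> length c' + length d'"
proof -
  let ?G = "F - {c} - {d}"
  have Fc: "fam (F - {c})" "d \<in> F - {c}" using fam_Diff F assms by blast+
  have G: "fam ?G" "vs ?G = vs F - set c - set d" using fam_Diff[OF Fc(1)] vs_Diff[OF Fc] vs_Diff[OF F assms(1)] by auto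
  have cG: "Suc (Suc (card ?G)) = j" using fam_card_Diff[OF Fc] fam_card_Diff[OF F assms(1)] cardF by simp
  have i1: "set c' \<inter> vs ?G = {}" "set d' \<inter> (set c' \<union> vs ?G) = {}" using G assms(6,7) by auto
  note a = fam_insert[OF G(1) assms(4) i1(1)]
  have i2: "set d' \<inter> vs (insert c' ?G) = {}" using a(3) i1(2) by simp
  note b = fam_insert[OF a(1) assms(5) i2]
  have "pk j (vs (insert d' (insert c' ?G)))" using pkI[OF b(1)] b(2) a(2) cG by simp
  then have "card (vs F) \<le> card (set d' \<union> (set c' \<union> vs ?G))" using min1 b(3) a(3) by metis
  also have "\<dots> \<le> card (set d') + card (set c') + card (vs ?G)"
    using card_Un_le[of "set d'" "set c' \<union> vs ?G"] card_Un_le[of "set c'" "vs ?G"] by simp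
  finally have le: "card (vs F) \<le> card (set d') + card (set c') + card (vs ?G)" .
  have "card (vs ?G) + (length c + length d) = card (vs F)"
  proof -
    have cd: "cyc c" "cyc d" "set c \<inter> set d = {}" using F assms by (auto simp: fam_def)
    then have "card (set c \<union> set d) = length c + length d" using cyc_card by (simp add: card_Un_disjoint)
    moreover have "vs ?G = vs F - (set c \<union> set d)" using G(2) by blast
    moreover have "set c \<union> set d \<subseteq> vs F" using set_sub_vs assms(1,2) by blast
    ultimately show ?thesis using fam_finite_vs[OF F]
      by (metis card_Diff_subset card_mono finite_Un finite_set le_add_diff_inverse2)
  qed
  then show ?thesis using le cyc_card[OF assms(4)] cyc_card[OF assms(5)] by linarith
qed

lemma no_two_cycles:
  assumes "c \<in> F" "cyc c'" "cyc d'" "set c' \<inter> set d' = {}" "set c' \<union> set d' \<subseteq> set c \<union> W"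
  shows False
proof -
  have "set c' \<subseteq> set c \<union> W" using assms by blast
  note e = replace_cycle[OF assms(1,2) this]
  have "set d' \<inter> vs (insert c' (F - {c})) = {}" using e(3) assms(4,5) by auto
  then show False using pk_insert[OF pkI[OF e(1)] assms(3)] e(2) nopk by metis
qed

lemma cycF: "c \<in> F \<Longrightarrow> cyc c" using F fam_cyc by blast
lemma W_not_c: "w \<in> W \<Longrightarrow> c \<in> F \<Longrightarrow> w \<notin> set c" using set_sub_vs by blast

text \<open>Two neighbours of \<open>w\<close> cut \<open>c\<close> into arcs which close through
  \<open>w\<close> to cycles of lengths \<open>|A| + 3\<close> and \<open>|B| + 3\<close>, while
  \<open>c\<close> has length \<open>|A| + |B| + 2\<close>. Neither is shorter only if both arcs
  have at most one inner vertex.\<close>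

lemma dgW_le1:
  assumes "w \<in> W" "c \<in> F" "5 \<le> length c" shows "dg (set c) w \<le> 1"
proof (rule ccontr)
  assume "\<not> dg (set c) w \<le> 1"
  then have "\<exists>u v. u \<in> nb (set c) w \<and> v \<in> nb (set c) w \<and> u \<noteq> v"
    using card_le_Suc0_iff_eq[OF finite_nb[of "set c" w]] by (auto simp: dg_def)
  then obtain u v where uv: "u \<in> set c" "v \<in> set c" "u \<noteq> v" "adj w u" "adj w v" by (auto simp: nb_def)
  then obtain A B where r: "rot c (u # A @ v # B)" using rot_two by metis
  have sc: "set (u # A @ v # B) = set c" "length c = length A + length B + 2" using rot_props[OF r] by auto
  note cc = two_nbrs_cycles[OF cycF[OF assms(2)] W_not_c[OF assms(1,2)] r uv(4,5)]
  have "set (w # u # A @ [v]) \<subseteq> set c \<union> W" "set (w # v # B @ [u]) \<subseteq> set c \<union> W" using sc assms(1) by auto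
  then have "length c \<le> length A + 3" "length c \<le> length B + 3"
    using replace_cycle(5)[OF assms(2) cc(1)] replace_cycle(5)[OF assms(2) cc(2)] by simp_all
  then show False using sc(2) assms(3) by linarith
qed

text \<open>For the last conclusion: two consecutive neighbours would form a triangle with
  \<open>w\<close>, shorter than \<open>c\<close>.\<close>

lemma four_cycle:
  assumes "c \<in> F" "length c = 4" "x \<in> set c"
  obtains a b d where "rot c [x, a, b, d]" "set c = {x, a, b, d}" "adj x a" "adj a b" "adj b d" "adj d x"
    "distinct [x, a, b, d]"
    "\<And>w. w \<in> W \<Longrightarrow> \<not> (adj w x \<and> adj w a) \<and> \<not> (adj w a \<and> adj w b) \<and> \<not> (adj w b \<and> adj w d) \<and> \<not> (adj w d \<and> adj w x)"
proof -
  obtain R where R: "rot c (x # R)" using rot_at assms(3) by metis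
  then have c: "cyc (x # R)" "length (x # R) = 4" "set (x # R) = set c"
    using cyc_rot[OF R] cycF[OF assms(1)] rot_props[OF R] assms by auto
  then obtain a b d where r: "R = [a, b, d]" by (cases R; cases "tl R"; cases "tl (tl R)") auto
  have ad: "adj x a" "adj a b" "adj b d" "adj d x" "distinct [x, a, b, d]" using c r by (auto simp: cyc_iff)
  have no: "\<not> (adj w u \<and> adj w v)" if w: "w \<in> W" "u \<in> set c" "v \<in> set c" "adj u v" for w u v
  proof
    assume uv: "adj w u \<and> adj w v"
    have "w \<notin> set c" using W_not_c w assms by blast
    then have "cyc [w, u, v]" using uv w adj_sym adj_neq by (auto simp: cyc_iff)
    moreover have "set [w, u, v] \<subseteq> set c \<union> W" using w by auto
    ultimately show False using replace_cycle(5)[OF assms(1)] assms(2) by fastforce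
  qed
  have s: "set c = {x, a, b, d}" using c r by simp
  then have "\<And>w. w \<in> W \<Longrightarrow> \<not> (adj w x \<and> adj w a) \<and> \<not> (adj w a \<and> adj w b) \<and> \<not> (adj w b \<and> adj w d) \<and> \<not> (adj w d \<and> adj w x)"
    using no[of _ x a] no[of _ a b] no[of _ b d] no[of _ d x] ad by auto
  then show thesis using that[of a b d] R r s ad by blast
qed

lemma dgW_le2:
  assumes "w \<in> W" "c \<in> F" "4 \<le> length c" shows "dg (set c) w \<le> 2"
proof (cases "5 \<le> length c")
  case True then show ?thesis using dgW_le1 assms by fastforce
next
  case False
  then have l: "length c = 4" using assms(3) by simp
  obtain x where "x \<in> set c" using l by (cases c) auto
  then obtain a b d where s: "set c = {x, a, b, d}" and no:
    "\<And>w. w \<in> W \<Longrightarrow> \<not> (adj w x \<and> adj w a) \<and> \<not> (adj w a \<and> adj w b) \<and> \<not> (adj w b \<and> adj w d) \<and> \<not> (adj w d \<and> adj w x)"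
    using four_cycle[OF assms(2) l] by metis
  have "nb (set c) w \<subseteq> {x, b} \<or> nb (set c) w \<subseteq> {a, d}"
    using no[OF assms(1)] unfolding s nb_def by auto
  moreover have "card {x, b} \<le> 2" "card {a, d} \<le> 2" by (auto simp: card_insert_if)
  ultimately show ?thesis unfolding dg_def by (meson card_mono finite.emptyI finite_insert order_trans)
qed

text \<open>The extreme cases are \<open>3 + 3\<close>, \<open>2 + 4\<close> and
  \<open>1 + 5\<close>: each additional vertex of the cycle costs a neighbour.\<close>

lemma dgW_le:
  assumes "w \<in> W" "c \<in> F" "length c \<le> 5" shows "dg (set c) w + length c \<le> 6"
proof -
  have "3 \<le> length c" "card (set c) = length c" using cyc_card[OF cycF[OF assms(2)]] by auto
  then consider "length c = 3" | "length c = 4" | "length c = 5" using assms(3) by linarith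
  then show ?thesis
    using dgW_le1[OF assms(1,2)] dgW_le2[OF assms(1,2)] dg_le_card[of "set c" w] \<open>card (set c) = length c\<close>
    by cases auto
qed

lemma deg_split: "deg v = dg W v + (\<Sum>c\<in>F. dg (set c) v)"
  using dg_split[of "vs F" V v] fam_V[OF F] dg_fam[OF F] by simp

text \<open>At least \<open>6j + 1\<close> of the degree sum goes to the \<open>j\<close> cycles, so
  some cycle receives 7. A cycle with four or more vertices receives at most 2 from each
  vertex.\<close>

lemma triangle_seven_edges:
  assumes "x \<in> W" "y \<in> W" "z \<in> W" "x \<noteq> y" "x \<noteq> z" "y \<noteq> z" "\<not> adj x y" "\<not> adj x z" "\<not> adj y z"
    "dg W x + dg W y + dg W z \<le> 4"
  obtains c where "c \<in> F" "length c = 3" "7 \<le> dg (set c) x + dg (set c) y + dg (set c) z"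
proof -
  have "6 * j + 5 \<le> deg x + deg y + deg z" using assms triple by blast
  then have "6 * j + 1 \<le> (\<Sum>c\<in>F. dg (set c) x + dg (set c) y + dg (set c) z)"
    using assms(10) deg_split[of x] deg_split[of y] deg_split[of z] by (simp add: sum.distrib)
  moreover have "(\<Sum>c\<in>F. (6::nat)) = 6 * j" using cardF by simp
  ultimately have "\<not> (\<forall>c\<in>F. dg (set c) x + dg (set c) y + dg (set c) z \<le> 6)"
    using sum_mono[of F "\<lambda>c. dg (set c) x + dg (set c) y + dg (set c) z" "\<lambda>_. 6"] by fastforce
  then obtain c where c: "c \<in> F" "7 \<le> dg (set c) x + dg (set c) y + dg (set c) z" by fastforce
  have "length c < 4" using dgW_le2[OF assms(1) c(1)] dgW_le2[OF assms(2) c(1)] dgW_le2[OF assms(3) c(1)] c(2)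
    by (cases "4 \<le> length c") auto
  moreover have "3 \<le> length c" using cycF[OF c(1)] by (simp add: cyc_def)
  ultimately show thesis using that c by simp
qed

text \<open>The last equation is the edge balance of trading \<open>x\<close> for \<open>a\<close>:
  the edges of \<open>x\<close> in \<open>W\<close> are lost and those of \<open>a\<close> gained,
  each counted twice by \<open>ne\<close>.\<close>

lemma swap_triangle:
  assumes "c \<in> F" "set c = {a, b, e}" "length c = 3" "adj b e" "x \<in> W" "adj x b" "adj x e" "a \<noteq> b" "a \<noteq> e"
  shows "fam (insert [x, b, e] (F - {c}))" "card (insert [x, b, e] (F - {c})) = j"
    "V - vs (insert [x, b, e] (F - {c})) = insert a (W - {x})"
    "card (vs (insert [x, b, e] (F - {c}))) = card (vs F)"
    "ne (insert a (W - {x})) + 2 * dg W x = ne W + 2 * dg (W - {x}) a"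
proof -
  have xc: "x \<notin> set c" using W_not_c assms by blast
  have cy: "cyc [x, b, e]" using assms xc adj_sym adj_neq by (auto simp: cyc_iff)
  have sub: "set [x, b, e] \<subseteq> set c \<union> W" using assms by auto
  note ex = replace_cycle[OF assms(1) cy sub]
  show "fam (insert [x, b, e] (F - {c}))" "card (insert [x, b, e] (F - {c})) = j"
    "card (vs (insert [x, b, e] (F - {c}))) = card (vs F)" using ex assms(3) by simp_all
  have cv: "set c \<subseteq> vs F" "vs F \<subseteq> V" using set_sub_vs assms(1) fam_V[OF F] by auto
  show "V - vs (insert [x, b, e] (F - {c})) = insert a (W - {x})"
    unfolding ex(3) using cv assms xc by auto
  have aW: "a \<notin> W - {x}" using cv assms(2) by auto
  have fW: "finite (W - {x})" using finW by simp
  have "W = insert x (W - {x})" using assms(5) by blast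
  then have "ne W = ne (W - {x}) + 2 * dg (W - {x}) x" using ne_insert[OF fW, of x] by simp
  moreover have "dg W x = dg (W - {x}) x" using dg_insert[of x "W - {x}" x] \<open>W = insert x (W - {x})\<close> adj_irrefl by simp
  ultimately show "ne (insert a (W - {x})) + 2 * dg W x = ne W + 2 * dg (W - {x}) a"
    using ne_insert[OF fW aW] by simp
qed

text \<open>Trading \<open>x\<close> for \<open>a\<close> loses at most one uncovered edge and gains
  the edges from \<open>a\<close> to \<open>y\<close> and \<open>z\<close>, against the second
  extremal choice.\<close>

lemma no_swap:
  assumes "c \<in> F" "length c = 3" "dg (set c) x = 3" "x \<in> W" "dg W x \<le> 1" "a \<in> set c"
    "y \<in> W" "z \<in> W" "x \<noteq> y" "x \<noteq> z" "y \<noteq> z" "adj y a" "adj z a"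
  shows False
proof -
  obtain b e where be: "set c = {a, b, e}" "adj a b" "adj b e" "adj e a" "a \<noteq> b" "b \<noteq> e" "a \<noteq> e"
    using triangle_sides[OF cycF[OF assms(1)] assms(2,6)] by metis
  have "card (set c) = 3" using cyc_card[OF cycF[OF assms(1)]] assms(2) by simp
  then have x: "adj x b" "adj x e" using dg_full[of "set c" x] assms(3) be(1) by auto
  note s = swap_triangle[OF assms(1) be(1) assms(2) be(3) assms(4) x be(5,7)]
  have "{y, z} \<subseteq> nb (W - {x}) a" using assms adj_sym by (auto simp: nb_def)
  then have "card {y, z} \<le> dg (W - {x}) a" unfolding dg_def by (rule card_mono[OF finite_nb])
  then have "2 \<le> dg (W - {x}) a" using assms(11) by simp
  moreover have "ne (insert a (W - {x})) \<le> ne W" using max2 pkI[OF s(1)] s(2,3,4) by metis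
  ultimately show False using s(5) assms(5) by linarith
qed

text \<open>Seven edges to one triangle make one of the three vertices complete to it and give the
  other two a common neighbour there, which is then traded for the first.\<close>

lemma no_triple:
  assumes "x \<in> W" "y \<in> W" "z \<in> W" "x \<noteq> y" "x \<noteq> z" "y \<noteq> z" "\<not> adj x y" "\<not> adj x z" "\<not> adj y z"
    "dg W x \<le> 1" "dg W y \<le> 1" "dg W z \<le> 1"
  shows False
proof -
  obtain c where c: "c \<in> F" "length c = 3" "7 \<le> dg (set c) x + dg (set c) y + dg (set c) z"
  proof (rule triangle_seven_edges[OF assms(1-9)])
    show "dg W x + dg W y + dg W z \<le> 4" using assms(10-12) by linarith
  qed
  have "card (set c) = 3" using cyc_card[OF cycF[OF c(1)]] c(2) by simp
  then consider a where "dg (set c) x = 3" "a \<in> set c" "adj y a" "adj z a"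
    | a where "dg (set c) y = 3" "a \<in> set c" "adj x a" "adj z a"
    | a where "dg (set c) z = 3" "a \<in> set c" "adj x a" "adj y a"
    using three_vertices_seven_edges[OF _ _ c(3)] by auto
  then show False
  proof cases
    case 1 then show False using no_swap[OF c(1,2) 1(1) assms(1,10) 1(2) assms(2,3,4,5,6)] by blast
  next
    case 2 then show False using no_swap[OF c(1,2) 2(1) assms(2,11) 2(2) assms(1,3)] assms by blast
  next
    case 3 then show False using no_swap[OF c(1,2) 3(1) assms(3,12) 3(2) assms(1,2)] assms by blast
  qed
qed

end

context sgraph
begin

lemma two_nbr_path_cycle:
  assumes "pth p" "z \<notin> set p" "u \<in> set p" "v \<in> set p" "u \<noteq> v" "adj z u" "adj z v"
  obtains c where "cyc c" "set c \<subseteq> insert z (set p)"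
  using two_links[of "[z]" p z z u v] assms by auto

lemma acyc_link1:
  assumes "acyc T" "pth p" "set p \<subseteq> T" "z \<in> T" "z \<notin> set p"
  shows "dg (set p) z \<le> 1"
proof (rule ccontr)
  assume "\<not> dg (set p) z \<le> 1"
  then have "\<exists>u v. u \<in> nb (set p) z \<and> v \<in> nb (set p) z \<and> u \<noteq> v"
    using card_le_Suc0_iff_eq[OF finite_nb[of "set p" z]] by (auto simp: dg_def)
  then obtain u v where uv: "u \<in> set p" "v \<in> set p" "u \<noteq> v" "adj z u" "adj z v" by (auto simp: nb_def)
  obtain c where c: "cyc c" "set c \<subseteq> insert z (set p)"
    using two_nbr_path_cycle[OF assms(2,5) uv] by blast
  then have "set c \<subseteq> T" using assms(3,4) by blast
  then show False using c(1) assms(1) by (auto simp: acyc_def)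
qed

lemma nbI: "u \<in> S \<Longrightarrow> adj v u \<Longrightarrow> u \<in> nb S v"
  by (simp add: nb_def)

lemma nbD: "u \<in> nb S v \<Longrightarrow> u \<in> S \<and> adj v u"
  by (simp add: nb_def)

lemma four_cycleI:
  assumes "adj a b" "adj b c" "adj c d" "adj d a" "a \<noteq> c" "b \<noteq> d"
  shows "cyc [a, b, c, d]"
  using assms adj_neq by (auto simp: cyc_iff)

lemma finite_sets_two:
  assumes "2 \<le> card S"
  obtains a b where "a \<in> S" "b \<in> S" "a \<noteq> b"
proof -
  have "\<not> card S \<le> Suc 0" using assms by simp
  moreover have "finite S" using assms by (metis card.infinite not_numeral_le_zero)
  ultimately show thesis using that card_le_Suc0_iff_eq by metis
qed

end

section \<open>At most four vertices are uncovered\<close>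

context mincyc
begin

text \<open>The ends of a longest path are leaves. If that path has fewer than three vertices, all
  degrees in \<open>W\<close> are at most one, and any nonadjacent pair will do.\<close>

lemma leaf_pair:
  assumes "3 \<le> card W"
  obtains x y where "x \<in> W" "y \<in> W" "x \<noteq> y" "\<not> adj x y" "dg W x \<le> 1" "dg W y \<le> 1"
proof -
  have "W \<noteq> {}" using assms by (metis card.empty not_numeral_le_zero)
  obtain p where p: "pth p" "set p \<subseteq> W" "p \<noteq> []" "\<forall>q. pth q \<and> set q \<subseteq> W \<longrightarrow> length q \<le> length p"
    "length p = 1 \<longrightarrow> nb W (hd p) = {}"
    "2 \<le> length p \<longrightarrow> nb W (hd p) = {p ! 1}"
    "2 \<le> length p \<longrightarrow> nb W (last p) = {p ! (length p - 2)}"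
    by (rule acyc_longest_path[OF finW \<open>W \<noteq> {}\<close> acycW])
  show thesis
  proof (cases "3 \<le> length p")
    case True
    then obtain a b d R where q: "p = a # b # d # R" by (cases p; cases "tl p"; cases "tl (tl p)") auto
    have n: "nb W a = {b}" using p(6) True by (simp add: q)
    have l: "last p \<in> set (d # R)" by (simp add: q)
    then have "last p \<noteq> a" "last p \<noteq> b" using p(1) q by (auto dest!: pth_distinct)
    moreover have "last p \<in> W" "a \<in> W" using p(2) l q by auto
    moreover have "\<not> adj a (last p)" using n \<open>last p \<noteq> b\<close> \<open>last p \<in> W\<close> by (auto simp: nb_def)
    moreover have "dg W (last p) \<le> 1" "dg W a \<le> 1" using p(7) True n by (simp_all add: dg_def)
    ultimately show thesis using that[of a "last p"] by blast
  next
    case False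
    have le: "dg W v \<le> 1" if v: "v \<in> W" for v
    proof (rule ccontr)
      assume "\<not> dg W v \<le> 1"
      then obtain a b where ab: "a \<in> nb W v" "b \<in> nb W v" "a \<noteq> b" using finite_sets_two[of "nb W v"] by (auto simp: dg_def)
      then have "pth [a, v, b]" "set [a, v, b] \<subseteq> W" using adj_sym adj_irrefl v by (auto simp: nb_def)
      then show False using p(4)[rule_format, of "[a, v, b]"] False by simp
    qed
    obtain x where x: "x \<in> W" using \<open>W \<noteq> {}\<close> by blast
    have "card ({x} \<union> nb W x) \<le> 2" using card_Un_le[of "{x}" "nb W x"] le[OF x] by (simp add: dg_def)
    then have "\<not> W \<subseteq> {x} \<union> nb W x" using card_mono[of "{x} \<union> nb W x" W] assms by auto
    then obtain y where "y \<in> W" "y \<noteq> x" "\<not> adj x y" by (auto simp: nb_def)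
    then show thesis using that[of x y] x le by blast
  qed
qed

text \<open>The ends of a longest path are two nonadjacent leaves. A vertex off the path would lead
  to a third leaf independent of both, which \<open>no_triple\<close> excludes.\<close>

lemma W_is_path:
  assumes "5 \<le> card W"
  obtains p where "pth p" "set p = W"
proof -
  have "W \<noteq> {}" using assms by (metis card.empty not_numeral_le_zero)
  obtain p where p: "pth p" "set p \<subseteq> W" "p \<noteq> []" "\<forall>q. pth q \<and> set q \<subseteq> W \<longrightarrow> length q \<le> length p"
    "length p = 1 \<longrightarrow> nb W (hd p) = {}"
    "2 \<le> length p \<longrightarrow> nb W (hd p) = {p ! 1}"
    "2 \<le> length p \<longrightarrow> nb W (last p) = {p ! (length p - 2)}"
    by (rule acyc_longest_path[OF finW \<open>W \<noteq> {}\<close> acycW])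
  have "3 \<le> length p"
  proof (rule ccontr)
    assume short: "\<not> 3 \<le> length p"
    have le: "dg W v \<le> 1" if v: "v \<in> W" for v
    proof (rule ccontr)
      assume "\<not> dg W v \<le> 1"
      then obtain a b where ab: "a \<in> nb W v" "b \<in> nb W v" "a \<noteq> b" using finite_sets_two[of "nb W v"] by (auto simp: dg_def)
      then have "pth [a, v, b]" "set [a, v, b] \<subseteq> W" using adj_sym adj_irrefl v by (auto simp: nb_def)
      then show False using p(4)[rule_format, of "[a, v, b]"] short by simp
    qed
    obtain x where x: "x \<in> W" using \<open>W \<noteq> {}\<close> by blast
    \<comment> \<open>With all degrees at most one, a chosen vertex blocks at most two, so five
      vertices leave room for three independent ones.\<close>
    have c2: "card ({x} \<union> nb W x) \<le> 2" if "x \<in> W" for x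
      using card_Un_le[of "{x}" "nb W x"] le[OF that] by (simp add: dg_def)
    have "\<not> W \<subseteq> {x} \<union> nb W x" using c2[OF x] card_mono[of "{x} \<union> nb W x" W] assms by auto
    then obtain y where y: "y \<in> W" "y \<noteq> x" "\<not> adj x y" by (auto simp: nb_def)
    have "card (({x} \<union> nb W x) \<union> ({y} \<union> nb W y)) \<le> 4"
      using card_Un_le[of "{x} \<union> nb W x" "{y} \<union> nb W y"] c2[OF x] c2[OF y(1)] by simp
    then have "\<not> W \<subseteq> ({x} \<union> nb W x) \<union> ({y} \<union> nb W y)"
      using card_mono[of "({x} \<union> nb W x) \<union> ({y} \<union> nb W y)" W] assms by auto
    then obtain z where z: "z \<in> W" "z \<noteq> x" "z \<noteq> y" "\<not> adj x z" "\<not> adj y z" by (auto simp: nb_def)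
    show False using no_triple[OF x y(1) z(1)] y z le[OF x] le[OF y(1)] le[OF z(1)] by blast
  qed
  then obtain a b d R where q: "p = a # b # d # R" by (cases p; cases "tl p"; cases "tl (tl p)") auto
  define e where "e = last p"
  have n: "nb W a = {b}" using p(6) q by simp
  have l: "e \<in> set (d # R)" by (simp add: q e_def)
  have ne: "e \<noteq> a" "e \<noteq> b" using p(1) q l by (auto dest!: pth_distinct)
  have eW: "e \<in> W" "a \<in> W" using p(2) l q by auto
  have ae: "\<not> adj a e" using n ne eW by (auto simp: nb_def)
  have d1: "dg W e \<le> 1" "dg W a \<le> 1" using p(7) q n by (simp_all add: dg_def e_def)
  have ne2: "nb W e = {p ! (length p - 2)}" using p(7) q by (simp add: e_def)
  have eb: "\<not> adj z a \<and> \<not> adj z e" if z: "z \<in> W" "z \<notin> set p" for z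
  proof -
    have "length p - 2 < length p" using q by simp
    then have "p ! (length p - 2) \<in> set p" by (rule nth_mem)
    moreover have "b \<in> set p" using q by simp
    ultimately have "z \<notin> nb W a" "z \<notin> nb W e" using n ne2 z by auto
    then show ?thesis using z adj_sym by (auto simp: nb_def)
  qed
  have "set p = W"
  proof (rule ccontr)
    assume "set p \<noteq> W"
    define Z where "Z = W - set p"
    have Z: "Z \<noteq> {}" "finite Z" "Z \<subseteq> W" using \<open>set p \<noteq> W\<close> p(2) finW by (auto simp: Z_def)
    have aZ: "acyc Z" using acycW Z(3) by (auto simp: acyc_def)
    have dgZ: "dg W z = dg (set p) z + dg Z z" for z using dg_split[OF p(2)] by (simp add: Z_def)
    obtain q where q: "pth q" "set q \<subseteq> Z" "q \<noteq> []" "\<forall>q'. pth q' \<and> set q' \<subseteq> Z \<longrightarrow> length q' \<le> length q"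
      "length q = 1 \<longrightarrow> nb Z (hd q) = {}"
      "2 \<le> length q \<longrightarrow> nb Z (hd q) = {q ! 1}"
      "2 \<le> length q \<longrightarrow> nb Z (last q) = {q ! (length q - 2)}"
      by (rule acyc_longest_path[OF Z(2,1) aZ])
    have pz: "dg (set p) z \<le> 1" if "z \<in> Z" for z
      using acyc_link1[OF acycW p(1,2)] that by (auto simp: Z_def)
    have hq: "hd q \<in> Z" "last q \<in> Z" using q(2,3) by auto
    \<comment> \<open>The ends of a longest path \<open>q\<close> in the remainder have at most one
      neighbour there. They cannot both be attached to \<open>p\<close> as well, since this would
      close a cycle in \<open>W\<close>.\<close>
    have "\<exists>z\<in>Z. dg W z \<le> 1"
    proof (cases "length q \<ge> 2")
      case False
      moreover have "length q \<noteq> 0" using q(3) by simp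
      ultimately have "length q = 1" by linarith
      then have "dg Z (hd q) = 0" using q(5) by (simp add: dg_def)
      then have "dg W (hd q) \<le> 1" using pz[OF hq(1)] dgZ[of "hd q"] by linarith
      then show ?thesis using hq(1) by blast
    next
      case True
      have neq: "hd q \<noteq> last q" using True q(1) by (cases q) (auto dest!: pth_distinct)
      have z1: "dg Z (hd q) = 1" "dg Z (last q) = 1" using q(6,7) True by (simp_all add: dg_def)
      have "dg (set p) (hd q) = 0 \<or> dg (set p) (last q) = 0"
      proof (rule ccontr)
        assume "\<not> ?thesis"
        then obtain u v where uv: "u \<in> set p" "adj (hd q) u" "v \<in> set p" "adj (last q) v"
          using dg_pos[of "set p" "hd q"] dg_pos[of "set p" "last q"] by auto
        have "set q \<inter> set p = {}" using q(2) by (auto simp: Z_def)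
        then obtain c where "cyc c" "set c \<subseteq> set q \<union> set p"
          using two_links[OF q(1) p(1), of "hd q" "last q" u v] uv q(3) neq by auto
        moreover have "set q \<union> set p \<subseteq> W" using q(2) p(2) Z(3) by blast
        ultimately show False using acycW unfolding acyc_def by blast
      qed
      then have "dg W (hd q) \<le> 1 \<or> dg W (last q) \<le> 1" using z1 dgZ[of "hd q"] dgZ[of "last q"] by linarith
      then show ?thesis using hq by blast
    qed
    then obtain z where z: "z \<in> W" "z \<notin> set p" "dg W z \<le> 1" by (auto simp: Z_def)
    have "z \<noteq> a" "z \<noteq> e" using z(2) q l \<open>p = a # b # d # R\<close> by auto
    then show False
      using no_triple[OF eW(2,1) z(1)] ae ne eb[OF z(1,2)] d1 z(3) adj_sym by blast
  qed
  then show thesis using that p(1) by blast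
qed

text \<open>A trade that keeps both extremal values yields another counterexample, to whose
  uncovered set all the results apply again.\<close>

lemma other_mincyc:
  assumes "fam F'" "card F' = j" "card (vs F') = card (vs F)" "ne (V - vs F) \<le> ne (V - vs F')"
  shows "mincyc V adj F' j"
proof (unfold_locales)
  show "5 * j + 3 \<le> card V" by (rule cardV)
  show "j + 2 \<le> deg v" if "v \<in> V" for v using that by (rule mindeg)
  show "6 * j + 5 \<le> deg x + deg y + deg z" if "x \<in> V" "y \<in> V" "z \<in> V" "x \<noteq> y" "x \<noteq> z" "y \<noteq> z"
      "\<not> adj x y" "\<not> adj x z" "\<not> adj y z" for x y z
    using that by (rule triple)
  show "1 \<le> j" by (rule j1)
  show "\<not> pk (Suc j) S" for S by (rule nopk)
  show "fam F'" "card F' = j" by fact+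
  show "card (vs F') \<le> card S" if "pk j S" for S using min1[OF that] assms(3) by simp
  show "ne (V - S) \<le> ne (V - vs F')" if "pk j S" "card S = card (vs F')" for S
    using max2[OF that(1)] that(2) assms(3,4) by simp
qed

text \<open>Otherwise \<open>W\<close> is a path \<open>w1 w2 w3 ... wp\<close>. The vertices
  \<open>w1\<close>, \<open>w3\<close>, \<open>wp\<close> are independent with degree sum
  \<open>1 + 2 + 1\<close> in \<open>W\<close>, so a triangle receives seven edges from them. Either
  the triangle and \<open>W\<close> contain two disjoint cycles, or a trade makes \<open>w2\<close>
  a leaf and produces three independent leaves.\<close>

lemma cardW4: "card W \<le> 4"
proof (rule ccontr)
  assume "\<not> card W \<le> 4"
  then have c5: "5 \<le> card W" by simp
  obtain p where p: "pth p" "set p = W" by (rule W_is_path[OF c5])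
  have "length p = card W" using distinct_card[OF pth_distinct[OF p(1)]] p(2) by simp
  then have len: "5 \<le> length p" using c5 by simp
  then obtain w1 w2 w3 w4 R where pR: "p = w1 # w2 # w3 # w4 # R" "R \<noteq> []"
    by (cases p; cases "tl p"; cases "tl (tl p)"; cases "tl (tl (tl p))"; cases "tl (tl (tl (tl p)))") auto
  define wp where "wp = last R"
  have dp: "distinct p" using p(1) pth_distinct by blast
  have wpR: "wp \<in> set R" using pR(2) by (simp add: wp_def)
  have WW: "w1 \<in> W" "w2 \<in> W" "w3 \<in> W" "w4 \<in> W" "wp \<in> W" using p(2) pR wpR by auto
  have neqs: "w1 \<noteq> w2" "w1 \<noteq> w3" "w1 \<noteq> w4" "w1 \<noteq> wp" "w2 \<noteq> w3" "w2 \<noteq> w4" "w2 \<noteq> wp" "w3 \<noteq> w4" "w3 \<noteq> wp" "w4 \<noteq> wp"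
    using dp pR wpR by auto
  have n1: "nb W w1 = {w2}" using acyc_path_end[OF acycW, of w1 "w2 # w3 # w4 # R"] p pR by auto
  have n3a: "nb (set (w3 # w4 # R)) w3 = {w4}"
    using acyc_path_end[OF acycW, of w3 "w4 # R"] p pR by auto
  have n3b: "nb (set [w3, w2, w1]) w3 = {w2}"
    using acyc_path_end[OF acycW, of w3 "[w2, w1]"] p pR adj_sym by auto
  have n3: "nb W w3 = {w2, w4}"
  proof -
    have "W = set (w3 # w4 # R) \<union> set [w3, w2, w1]" using p(2) pR by auto
    then have "nb W w3 = nb (set (w3 # w4 # R)) w3 \<union> nb (set [w3, w2, w1]) w3" by (auto simp: nb_def)
    then show ?thesis using n3a n3b by auto
  qed
  have n2: "nb W w2 = {w1, w3}"
  proof -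
    have a: "nb (set (w2 # w3 # w4 # R)) w2 = {w3}"
      using acyc_path_end[OF acycW, of w2 "w3 # w4 # R"] p pR by auto
    have "adj w2 w1" using p(1) pR adj_sym by auto
    have "W = set (w2 # w3 # w4 # R) \<union> {w1}" using p(2) pR by auto
    then have "nb W w2 = nb (set (w2 # w3 # w4 # R)) w2 \<union> nb {w1} w2" by (auto simp: nb_def)
    then show ?thesis using a \<open>adj w2 w1\<close> by (auto simp: nb_def)
  qed
  obtain wq where np: "nb W wp = {wq}"
  proof -
    obtain r rs where r: "rev p = r # rs" using pR by (cases "rev p") auto
    have "length (rev p) = Suc (length rs)" by (simp only: r list.size add_Suc_right add_0_right)
    then have rs: "rs \<noteq> []" using len by auto
    have "r = hd (rev p)" using r by simp
    also have "\<dots> = wp" using pR by (simp add: hd_rev wp_def)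
    finally have "r = wp" .
    moreover have "pth (r # rs)" using p(1) r by (metis pth_rev)
    moreover have "set (r # rs) = W" using p(2) r by (metis set_rev)
    ultimately show thesis using that acyc_path_end[OF acycW, of r rs] rs by auto
  qed
  have dgs: "dg W w1 = 1" "dg W w3 = 2" "dg W wp = 1" using n1 n3 np neqs by (simp_all add: dg_def)
  have nadj: "\<not> adj w1 w3" "\<not> adj w1 wp" "\<not> adj w3 wp"
    using nbI[OF WW(3), of w1] nbI[OF WW(5), of w1] nbI[OF WW(5), of w3] n1 n3 neqs by auto
  obtain c where c: "c \<in> F" "length c = 3" "7 \<le> dg (set c) w1 + dg (set c) w3 + dg (set c) wp"
    using triangle_seven_edges[OF WW(1,3,5) neqs(2,4,9) nadj] dgs by auto
  have cs: "card (set c) = 3" "finite (set c)" using cyc_card[OF cycF[OF c(1)]] c(2) by simp_all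
  have Wc: "w \<notin> set c" if "w \<in> W" for w using W_not_c[OF that c(1)] .
  have tail: "pth (w3 # w4 # R)" "last (w3 # w4 # R) = wp" "pth [w1, w2, w3]"
    using p(1) pR adj_sym by (auto simp: wp_def)
  have sub: "set (w3 # w4 # R) \<subseteq> W" "w1 \<notin> set (w3 # w4 # R)" using p(2) dp pR by auto
  have cyc_tail: "cyc ((w3 # w4 # R) @ [a])" if "a \<in> set c" "adj w3 a" "adj wp a" for a
  proof (rule link_paths)
    show "set (w3 # w4 # R) \<inter> set [a] = {}" using sub(1) Wc that by auto
    show "adj (last (w3 # w4 # R)) (hd [a])" using tail(2) that by simp
  qed (use tail that adj_sym in auto)
  have tri: "cyc [x, b, e]" if "x \<in> W" "b \<in> set c" "e \<in> set c" "adj x b" "adj x e" "adj b e" for x b e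
    using that adj_sym adj_neq by (auto simp: cyc_iff)
  \<comment> \<open>Two disjoint cycles: \<open>w1\<close> with two vertices of the triangle, and
    the tail from \<open>w3\<close> to \<open>wp\<close> closed by the third. The next claim does
    the same from the other end.\<close>
  have case_end: False if h: "dg (set c) w1 = 3" "\<exists>a\<in>set c. adj w3 a \<and> adj wp a"
  proof -
    obtain a where a: "a \<in> set c" "adj w3 a" "adj wp a" using h(2) by blast
    obtain b e where be: "set c = {a, b, e}" "adj b e" "a \<noteq> b" "a \<noteq> e"
      using triangle_sides[OF cycF[OF c(1)] c(2) a(1)] by metis
    have "adj w1 b" "adj w1 e" using dg_full[OF cs(2), of w1] h(1) cs(1) be(1) by auto
    then have "cyc [w1, b, e]" using tri WW(1) be by auto
    moreover have "set [w1, b, e] \<inter> set ((w3 # w4 # R) @ [a]) = {}"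
      using sub Wc be WW(1) a(1) by auto
    moreover have "set [w1, b, e] \<union> set ((w3 # w4 # R) @ [a]) \<subseteq> set c \<union> W" using sub be WW by auto
    ultimately show False using no_two_cycles[OF c(1) _ cyc_tail[OF a]] by blast
  qed
  have case_wp: False if h: "dg (set c) wp = 3" "\<exists>a\<in>set c. adj w1 a \<and> adj w3 a"
  proof -
    obtain a where a: "a \<in> set c" "adj w1 a" "adj w3 a" using h(2) by blast
    obtain b e where be: "set c = {a, b, e}" "adj b e" "a \<noteq> b" "a \<noteq> e"
      using triangle_sides[OF cycF[OF c(1)] c(2) a(1)] by metis
    have "adj wp b" "adj wp e" using dg_full[OF cs(2), of wp] h(1) cs(1) be(1) by auto
    then have 1: "cyc [wp, b, e]" using tri WW(5) be by auto
    have 2: "cyc ([w1, w2, w3] @ [a])"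
      using Wc a WW tail(3) adj_sym by (intro link_paths) auto
    have "set [wp, b, e] \<inter> set ([w1, w2, w3] @ [a]) = {}"
      using Wc be WW neqs by auto
    moreover have "set [wp, b, e] \<union> set ([w1, w2, w3] @ [a]) \<subseteq> set c \<union> W" using be WW by auto
    ultimately show False using no_two_cycles[OF c(1) 1 2] by blast
  qed
  have le3: "dg (set c) v \<le> 3" for v using dg_le_card[OF cs(2), of v] cs(1) by simp
  have com: "\<exists>a\<in>set c. adj u a \<and> adj v a" if "4 \<le> dg (set c) u + dg (set c) v" for u v
  proof -
    have "card (set c) < dg (set c) u + dg (set c) v" using that cs by simp
    then show ?thesis using common_nbr[OF cs(2)] by metis
  qed
  have l1: "dg (set c) w1 \<le> 2"
  proof (rule ccontr)
    assume "\<not> ?thesis"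
    then have "dg (set c) w1 = 3" using le3[of w1] by simp
    then show False using case_end com[of w3 wp] c(3) by simp
  qed
  have lp: "dg (set c) wp \<le> 2"
  proof (rule ccontr)
    assume "\<not> ?thesis"
    then have "dg (set c) wp = 3" using le3[of wp] by simp
    then show False using case_wp com[of w1 w3] c(3) by simp
  qed
  \<comment> \<open>The only distribution of seven edges that is left.\<close>
  have exact: "dg (set c) w1 = 2" "dg (set c) wp = 2" "dg (set c) w3 = 3"
    using c(3) l1 lp le3[of w3] by linarith+
  have w3all: "adj w3 a" if "a \<in> set c" for a using dg_full[OF cs(2) _ that] exact(3) cs(1) by simp
  have "card (nb (set c) w1) = 2" "nb (set c) w1 \<subseteq> set c" using exact(1) by (auto simp: dg_def nb_def)
  then have "card (set c - nb (set c) w1) = 1" using cs by (simp add: card_Diff_subset)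
  then obtain e where e: "set c - nb (set c) w1 = {e}" using card_1_singletonE by blast
  then have ec: "e \<in> set c" "\<not> adj w1 e" by (auto simp: nb_def)
  obtain a b where ab: "set c = {e, a, b}" "adj a b" "e \<noteq> a" "e \<noteq> b" "a \<noteq> b"
    using triangle_sides[OF cycF[OF c(1)] c(2) ec(1)] by metis
  have w1ab: "adj w1 a" "adj w1 b" using e ab by (auto simp: nb_def)
  have c1: "cyc [w1, a, b]" using tri WW(1) ab w1ab by auto
  have "\<not> adj wp e"
  proof
    assume "adj wp e"
    then have 2: "cyc ((w3 # w4 # R) @ [e])" using cyc_tail ec(1) w3all by blast
    have "set [w1, a, b] \<inter> set ((w3 # w4 # R) @ [e]) = {}" using sub Wc ab WW(1) by auto
    moreover have "set [w1, a, b] \<union> set ((w3 # w4 # R) @ [e]) \<subseteq> set c \<union> W" using sub ab WW by auto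
    ultimately show False using no_two_cycles[OF c(1) c1 2] by blast
  qed
  \<comment> \<open>Trading \<open>w1\<close> for \<open>e\<close> loses the single edge at
    \<open>w1\<close> and gains the edge from \<open>e\<close> to \<open>w3\<close>, so the new
    family is extremal too.\<close>
  note s = swap_triangle[OF c(1) ab(1) c(2) ab(2) WW(1) w1ab ab(3,4)]
  let ?F = "insert [w1, a, b] (F - {c})"
  let ?W = "insert e (W - {w1})"
  have "adj e w3" using w3all[OF ec(1)] adj_sym by blast
  then have "1 \<le> dg (W - {w1}) e" using dg_pos[of "W - {w1}" e] WW neqs by (auto simp: Suc_le_eq)
  then have "ne W \<le> ne ?W" using s(5) dgs(1) by linarith
  then interpret F': mincyc V adj ?F j using other_mincyc[OF s(1,2,4)] s(3) by simp
  have eW: "e \<notin> W" using Wc ec(1) by blast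
  have W': "V - vs ?F = ?W" by (rule s(3))
  have P': "pth (w2 # w3 # w4 # R)" "set (w2 # w3 # w4 # R) = W - {w1}" using p dp pR by auto
  have "acyc ?W" using F'.acycW W' by simp
  then have dge: "dg (W - {w1}) e \<le> 1"
    using acyc_link1[of ?W "w2 # w3 # w4 # R" e] P' eW by auto
  have "nb (W - {w1}) e = {w3}"
  proof -
    have "w3 \<in> nb (W - {w1}) e" using \<open>adj e w3\<close> WW neqs by (auto simp: nb_def)
    moreover have "\<forall>u\<in>nb (W - {w1}) e. \<forall>v\<in>nb (W - {w1}) e. u = v"
      using dge card_le_Suc0_iff_eq[OF finite_nb[of "W - {w1}" e]] by (simp add: dg_def)
    ultimately show ?thesis by blast
  qed
  then have e_only: "u = w3" if "u \<in> W" "u \<noteq> w1" "adj e u" for u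
    using that nbI[of u "W - {w1}" e] by simp
  have "\<not> adj w2 e" using e_only[OF WW(2)] neqs adj_sym by blast
  have "u = w3" if "u \<in> nb ?W w2" for u
    using nbD[OF that] nbI[of u W w2] n2 \<open>\<not> adj w2 e\<close> by auto
  then have "nb ?W w2 \<subseteq> {w3}" by blast
  then have d2: "dg ?W w2 \<le> 1" unfolding dg_def using card_mono[of "{w3}"] by fastforce
  have "u = wq" if "u \<in> nb ?W wp" for u
    using nbD[OF that] nbI[of u W wp] np \<open>\<not> adj wp e\<close> by auto
  then have "nb ?W wp \<subseteq> {wq}" by blast
  then have dp': "dg ?W wp \<le> 1" unfolding dg_def using card_mono[of "{wq}"] by fastforce
  have "dg ?W e \<le> 1" using dg_insert[of e "W - {w1}" e] eW dge adj_irrefl by simp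
  moreover have "\<not> adj w2 e" "\<not> adj w2 wp" "\<not> adj e wp"
    using \<open>\<not> adj w2 e\<close> nbI[OF WW(5), of w2] n2 neqs \<open>\<not> adj wp e\<close> adj_sym by auto
  ultimately show False
    using F'.no_triple[unfolded W', of w2 e wp] WW neqs eW d2 dp' by auto
qed

end

section \<open>Long cycles, pentagons and the final 4-cycle\<close>

context mincyc
begin

text \<open>A chord would close one side of the cycle to a cycle on fewer vertices.\<close>

lemma chordless:
  assumes "c \<in> F" "rot c (u # A @ v # B)" "A \<noteq> []" "B \<noteq> []"
  shows "\<not> adj u v"
proof
  assume uv: "adj u v"
  have c: "cyc (u # A @ v # B)" "set (u # A @ v # B) = set c" "length c = length A + length B + 2"
    using cyc_rot[OF assms(2)] cycF[OF assms(1)] rot_props[OF assms(2)] by auto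
  have "pth (u # A @ v # B)" using c(1) by (simp add: cyc_iff)
  then have "pth (u # A @ [v])" by (rule pth_arc)
  then have "cyc (u # A @ [v])" using assms(3) uv adj_sym by (cases A) (auto simp: cyc_iff)
  moreover have "set (u # A @ [v]) \<subseteq> set c \<union> W" using c(2) by auto
  ultimately have "length c \<le> length (u # A @ [v])" using replace_cycle(5)[OF assms(1)] by blast
  then show False using c(3) assms(4) by (cases B) auto
qed

lemma dg_cyc_le2:
  assumes "c \<in> F" "x \<in> set c" shows "dg (set c) x \<le> 2"
proof -
  obtain R where R: "rot c (x # R)" using rot_at assms(2) by metis
  have c: "cyc (x # R)" "set (x # R) = set c"
    using cyc_rot[OF R] cycF[OF assms(1)] rot_props[OF R] by auto
  have "nb (set c) x \<subseteq> {hd R, last R}"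
  proof
    fix u assume "u \<in> nb (set c) x"
    then have "u \<in> set c" "adj x u" by (auto simp: nb_def)
    then have u: "u \<in> set R" "adj x u" using c(2) adj_neq[of x u] by auto
    obtain A B where AB: "R = A @ u # B" using u(1) split_list by metis
    then have "A = [] \<or> B = []" using chordless[OF assms(1)] R u(2) by metis
    then show "u \<in> {hd R, last R}" using AB by auto
  qed
  then have "dg (set c) x \<le> card {hd R, last R}" unfolding dg_def by (intro card_mono) auto
  also have "\<dots> \<le> 2" by (simp add: card_insert_if)
  finally show ?thesis .
qed

text \<open>One new cycle runs from \<open>c\<close> along the arc between its neighbours. The rest
  of \<open>C\<close> and the leftover arc \<open>L\<close> are disjoint paths with three edges
  between them, so they contain a cycle missing some vertex. Together the two new cycles cover less
  than \<open>C\<close> and \<open>C'\<close>.\<close>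

lemma leftover_arc:
  assumes "C \<in> F" "C' \<in> F" "C \<noteq> C'" "c \<in> set C" "rot C' (p # A @ p' # L)" "adj c p" "adj c p'"
    "3 \<le> (\<Sum>x\<in>set L. dg (set C - {c}) x)"
  shows False
proof -
  have C: "cyc C" "cyc C'" using assms cycF by blast+
  have disCC: "set C \<inter> set C' = {}" using F assms unfolding fam_def by blast
  have C': "cyc (p # A @ p' # L)" "set (p # A @ p' # L) = set C'" "length C' = length A + length L + 2"
    using cyc_rot[OF assms(5)] C rot_props[OF assms(5)] by auto
  have "c \<notin> set C'" using disCC assms(4) by blast
  then have d: "cyc (c # p # A @ [p'])" using two_nbrs_cycles(1)[OF C(2) _ assms(5-7)] by blast
  obtain Q where Q: "rot C (c # Q)" using rot_at assms(4) by metis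
  note q = cyc_path[OF C(1) Q]
  have lC: "length C = Suc (length Q)" using rot_props(2)[OF Q] by simp
  have lQ: "2 \<le> length Q" using C(1) lC by (simp add: cyc_def)
  have pL: "pth L" using C'(1) pth_appendD[of "p # A @ [p']" L] by (simp add: cyc_iff)
  have "set Q \<inter> set L = {}" using q(3) C'(2) disCC by auto
  then obtain t where t: "cyc t" "set t \<subset> set Q \<union> set L"
    using short_cycle_in_two_paths[OF q(1) lQ pL] assms(8) q(3) by metis
  have dC': "distinct (p # A @ p' # L)" using C'(1) by (simp add: cyc_def)
  have "set (c # p # A @ [p']) \<inter> set t = {}"
  proof -
    have "set (c # p # A @ [p']) \<inter> set Q = {}" using q(3) C'(2) disCC by auto
    moreover have "set (c # p # A @ [p']) \<inter> set L = {}" using dC' \<open>c \<notin> set C'\<close> C'(2) by auto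
    ultimately show ?thesis using t(2) by blast
  qed
  moreover have "set (c # p # A @ [p']) \<union> set t \<subseteq> set C \<union> set C' \<union> W"
    using t(2) q(3) C'(2) assms(4) by auto
  ultimately have le: "length C + length C' \<le> length (c # p # A @ [p']) + length t"
    using replace_two_cycles[OF assms(1-3) d t(1)] by blast
  have "length t < card (set Q \<union> set L)" using cyc_card[OF t(1)] psubset_card_mono[OF _ t(2)] by simp
  also have "\<dots> \<le> length Q + length L"
    using card_Un_le[of "set Q" "set L"] card_length[of Q] card_length[of L] by linarith
  finally show False using le lC C'(3) by simp
qed

text \<open>Three neighbours of \<open>c\<close> cut \<open>C'\<close> into three arcs. Removing any
  one arc with its ends leaves a path, and the three paths obtained so cover \<open>C'\<close>.
  Hence one of them receives at least three of the seven edges.\<close>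

lemma three_arcs:
  assumes "C \<in> F" "C' \<in> F" "C \<noteq> C'" "c \<in> set C" "3 \<le> dg (set C') c"
    "7 \<le> (\<Sum>x\<in>set C'. dg (set C - {c}) x)"
  shows False
proof -
  have "2 \<le> card (nb (set C') c)" using assms(5) by (simp add: dg_def)
  then obtain p1 where "p1 \<in> nb (set C') c" using finite_sets_two by metis
  then have p1: "p1 \<in> set C'" "adj c p1" by (auto simp: nb_def)
  obtain R where R: "rot C' (p1 # R)" using rot_at p1(1) by metis
  have dR: "distinct (p1 # R)" "set (p1 # R) = set C'"
    using cycF[OF assms(2)] rot_props[OF R] by (simp_all add: cyc_def)
  have "nb (set C') c = insert p1 (nb (set R) c)" using dR p1 by (auto simp: nb_def)
  then have "3 \<le> card (insert p1 (nb (set R) c))" using assms(5) by (simp add: dg_def)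
  moreover have "p1 \<notin> nb (set R) c" using dR by (auto simp: nb_def)
  ultimately have "2 \<le> card (nb (set R) c)" by simp
  then obtain a b where ab: "a \<in> nb (set R) c" "b \<in> nb (set R) c" "a \<noteq> b" using finite_sets_two by metis
  then have "\<exists>x\<in>set R. adj c x" by (auto simp: nb_def)
  then obtain A1 p2 R1 where s1: "R = A1 @ p2 # R1" "adj c p2" "\<forall>x\<in>set A1. \<not> adj c x"
    using split_list_first_prop[of R "adj c"] by blast
  have "\<exists>x\<in>set R1. adj c x" using ab s1 by (auto simp: nb_def)
  then obtain A2 p3 A3 where s2: "R1 = A2 @ p3 # A3" "adj c p3"
    using split_list_first_prop[of R1 "adj c"] by blast
  have r1: "rot C' (p1 # A1 @ p2 # (A2 @ p3 # A3))" using R s1 s2 by simp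
  have r2: "rot C' (p2 # A2 @ p3 # (A3 @ p1 # A1))" using rot_append[of C' "p1 # A1" "p2 # A2 @ p3 # A3"] r1 by simp
  have r3: "rot C' (p3 # A3 @ p1 # (A1 @ p2 # A2))"
    using rot_append[of C' "p1 # A1 @ p2 # A2" "p3 # A3"] r1 by simp
  define g where "g = dg (set C - {c})"
  have sl: "(\<Sum>x\<in>set L. g x) = sum_list (map g L)" if "distinct L" for L
    using that by (simp add: sum_list_distinct_conv_sum_set)
  have "distinct (p1 # A1 @ p2 # (A2 @ p3 # A3))" using dR s1 s2 by simp
  then have dd: "distinct (A2 @ p3 # A3)" "distinct (A3 @ p1 # A1)" "distinct (A1 @ p2 # A2)"
    "distinct (p1 # A1 @ p2 # (A2 @ p3 # A3))" by auto
  have "set C' = set (p1 # A1 @ p2 # (A2 @ p3 # A3))" using dR s1 s2 by simp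
  then have "7 \<le> (\<Sum>x\<in>set (p1 # A1 @ p2 # (A2 @ p3 # A3)). g x)" using assms(6) by (simp only: g_def)
  then have "7 \<le> sum_list (map g (p1 # A1 @ p2 # (A2 @ p3 # A3)))" by (simp only: sl[OF dd(4)])
  then have "3 \<le> sum_list (map g (A2 @ p3 # A3)) \<or> 3 \<le> sum_list (map g (A3 @ p1 # A1)) \<or> 3 \<le> sum_list (map g (A1 @ p2 # A2))"
    by (simp, linarith)
  then have "3 \<le> (\<Sum>x\<in>set (A2 @ p3 # A3). g x) \<or> 3 \<le> (\<Sum>x\<in>set (A3 @ p1 # A1). g x) \<or> 3 \<le> (\<Sum>x\<in>set (A1 @ p2 # A2). g x)"
    by (simp only: sl dd)
  then show False unfolding g_def
    using leftover_arc[OF assms(1-4) r1] leftover_arc[OF assms(1-4) r2] leftover_arc[OF assms(1-4) r3]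
      p1 s1(2) s2(2) by blast
qed

lemma sum_deg_C:
  assumes "finite B"
  shows "(\<Sum>v\<in>B. deg v) = (\<Sum>v\<in>B. dg W v) + (\<Sum>c\<in>F. \<Sum>v\<in>B. dg (set c) v)"
proof -
  have "(\<Sum>v\<in>B. deg v) = (\<Sum>v\<in>B. dg W v) + (\<Sum>v\<in>B. \<Sum>c\<in>F. dg (set c) v)"
    by (simp add: deg_split sum.distrib)
  also have "(\<Sum>v\<in>B. \<Sum>c\<in>F. dg (set c) v) = (\<Sum>c\<in>F. \<Sum>v\<in>B. dg (set c) v)" by (rule sum.swap)
  finally show ?thesis .
qed

text \<open>In a chordless cycle with six or more vertices, a vertex and those two and four steps
  further are independent. Averaging the triple condition around the cycle forces many edges to
  another cycle.\<close>

lemma no_long_cycle: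
  assumes "C \<in> F" "\<forall>C'\<in>F. length C' \<le> length C" "6 \<le> length C"
  shows False
proof -
  have C: "cyc C" using cycF assms(1) by blast
  define l where "l = length C"
  have cC: "card (set C) = l" using cyc_card[OF C] by (simp add: l_def)
  have dC: "distinct C" using C by (simp add: cyc_def)
  obtain f where f: "bij_betw f (set C) (set C)" "csteps C = {(x, f x) | x. x \<in> set C}"
    by (rule csteps_fun[OF dC])
  have trip: "6 * j + 5 \<le> deg c + deg (f (f c)) + deg (f (f (f (f c))))" if c: "c \<in> set C" for c
  proof -
    obtain R where R: "rot C (c # R)" using rot_at c by metis
    have lR: "length R = l - 1" using rot_props(2)[OF R] by (simp add: l_def)
    then have "5 \<le> length R" using assms(3) l_def by simp
    then obtain c1 R1 where R1: "R = c1 # R1" "4 \<le> length R1" by (cases R) auto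
    then obtain c2 R2 where R2: "R1 = c2 # R2" "3 \<le> length R2" by (cases R1) auto
    then obtain c3 R3 where R3: "R2 = c3 # R3" "2 \<le> length R3" by (cases R2) auto
    then obtain c4 R4 where R4: "R3 = c4 # R4" "1 \<le> length R4" by (cases R3) auto
    have R': "rot C (c # c1 # c2 # c3 # c4 # R4)" using R R1 R2 R3 R4 by simp
    have st: "(x, y) \<in> csteps C \<Longrightarrow> y = f x" for x y using f(2) by auto
    have sub: "steps (c # c1 # c2 # c3 # c4 # R4) \<subseteq> csteps C"
      using rot_props(4)[OF R'] csteps_eq[of "c # c1 # c2 # c3 # c4 # R4"] by blast
    have f1: "c1 = f c" "c2 = f c1" "c3 = f c2" "c4 = f c3" by (rule st, rule subsetD[OF sub], simp)+
    have R4n: "R4 \<noteq> []" using R4(2) by auto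
    have dis: "distinct (c # c1 # c2 # c3 # c4 # R4)" using rot_props(3)[OF R'] C by (simp add: cyc_def)
    have inC: "set (c # c1 # c2 # c3 # c4 # R4) = set C" using rot_props(1)[OF R'] .
    have a1: "\<not> adj c c2" using chordless[OF assms(1), of c "[c1]" c2 "c3 # c4 # R4"] R' by simp
    have a2: "\<not> adj c c4" using chordless[OF assms(1), of c "[c1, c2, c3]" c4 R4] R' R4n by simp
    have "rot C (c2 # c3 # c4 # R4 @ [c, c1])" using rot_append[of C "[c, c1]" "c2 # c3 # c4 # R4"] R' by simp
    then have a3: "\<not> adj c2 c4" using chordless[OF assms(1), of c2 "[c3]" c4 "R4 @ [c, c1]"] by simp
    have V: "c \<in> V" "c2 \<in> V" "c4 \<in> V" using cyc_V[OF C] inC by auto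
    have "6 * j + 5 \<le> deg c + deg c2 + deg c4" using triple[OF V _ _ _ a1 a2 a3] dis by simp
    moreover have "f (f c) = c2" "f (f (f (f c))) = c4" using f1 by simp_all
    ultimately show ?thesis by simp
  qed
  \<comment> \<open>Shifting along the successor map does not change a sum over the cycle.\<close>
  have re: "(\<Sum>c\<in>set C. g (f c)) = (\<Sum>c\<in>set C. g c)" for g :: "'a \<Rightarrow> nat"
    using sum.reindex_bij_betw[OF f(1)] .
  have "l * (6 * j + 5) = (\<Sum>c\<in>set C. 6 * j + 5)" using cC by simp
  also have "\<dots> \<le> (\<Sum>c\<in>set C. deg c + deg (f (f c)) + deg (f (f (f (f c)))))" using trip by (intro sum_mono) auto
  also have "\<dots> = 3 * (\<Sum>c\<in>set C. deg c)"
    using re[of deg] re[of "\<lambda>c. deg (f c)"] re[of "\<lambda>c. deg (f (f c))"] re[of "\<lambda>c. deg (f (f (f c)))"]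
    by (simp add: sum.distrib)
  finally have low: "l * (6 * j + 5) \<le> 3 * (\<Sum>c\<in>set C. deg c)" .
  have "(\<Sum>c\<in>set C. dg W c) = (\<Sum>w\<in>W. dg (set C) w)" using finW by (simp add: sum_dg_swap)
  also have "\<dots> \<le> (\<Sum>w\<in>W. 1)" using dgW_le1 assms(1,3) by (intro sum_mono) auto
  finally have sW: "(\<Sum>c\<in>set C. dg W c) \<le> 4" using cardW4 by simp
  \<comment> \<open>Otherwise the degrees on \<open>C\<close> sum to at most \<open>4 + 2lj\<close>,
    and \<open>l (6j + 5) <= 3 (4 + 2lj)\<close> reduces to \<open>5l <= 12\<close>.\<close>
  have "\<exists>C'\<in>F. C' \<noteq> C \<and> 2 * l < (\<Sum>v\<in>set C. dg (set C') v)"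
  proof (rule ccontr)
    assume no: "\<not> ?thesis"
    have "(\<Sum>v\<in>set C. dg (set C') v) \<le> 2 * l" if "C' \<in> F" for C'
    proof (cases "C' = C")
      case True
      have "(\<Sum>v\<in>set C. dg (set C) v) \<le> (\<Sum>v\<in>set C. 2)" using dg_cyc_le2[OF assms(1)] by (intro sum_mono) auto
      then show ?thesis using True cC by simp
    next
      case False then show ?thesis using no that by fastforce
    qed
    then have "(\<Sum>C'\<in>F. \<Sum>v\<in>set C. dg (set C') v) \<le> (\<Sum>C'\<in>F. 2 * l)" by (intro sum_mono) auto
    then have "(\<Sum>c\<in>set C. deg c) \<le> 4 + 2 * l * j" using sum_deg_C[of "set C"] sW cardF by (simp add: mult.commute)
    then have "l * (6 * j + 5) \<le> 3 * (4 + 2 * l * j)" using low by (meson le_trans mult_le_mono2)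
    then have "5 * l \<le> 12" by (simp add: algebra_simps)
    then show False using assms(3) by (simp add: l_def)
  qed
  then obtain C' where C': "C' \<in> F" "C' \<noteq> C" "2 * l < (\<Sum>v\<in>set C. dg (set C') v)" by blast
  have "\<exists>c\<in>set C. 3 \<le> dg (set C') c"
  proof (rule ccontr)
    assume "\<not> ?thesis"
    then have "(\<Sum>v\<in>set C. dg (set C') v) \<le> (\<Sum>v\<in>set C. 2)" by (intro sum_mono) auto
    then show False using C'(3) cC by simp
  qed
  then obtain c where c: "c \<in> set C" "3 \<le> dg (set C') c" by blast
  \<comment> \<open>As \<open>C\<close> is longest, \<open>c\<close> takes at most \<open>l\<close>
    of the \<open>2l + 1\<close> edges, which leaves at least \<open>l + 1 >= 7\<close> for
    \<open>three_arcs\<close>.\<close>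
  have "dg (set C') c \<le> l" using dg_le_card[of "set C'" c] cyc_card[OF cycF[OF C'(1)]] assms(2) C'(1) l_def by fastforce
  moreover have "(\<Sum>v\<in>set C. dg (set C') v) = dg (set C') c + (\<Sum>v\<in>set C - {c}. dg (set C') v)"
    using c(1) by (simp add: sum.remove)
  ultimately have "7 \<le> (\<Sum>v\<in>set C - {c}. dg (set C') v)" using C'(3) assms(3) l_def by linarith
  then have "7 \<le> (\<Sum>x\<in>set C'. dg (set C - {c}) x)" by (simp add: sum_dg_swap)
  then show False using three_arcs[OF assms(1) C'(1) _ c] C'(2) by blast
qed

text \<open>Eight edges to five vertices give \<open>b2\<close> and \<open>b3\<close> a common
  neighbour \<open>p\<close>. An edge of \<open>C'\<close> off \<open>p\<close> forms a triangle
  with \<open>b1\<close>, and \<open>p\<close> closes a cycle with the four other vertices of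
  \<open>C\<close>: together at most 8 vertices instead of 10.\<close>

lemma pentagon_pair:
  assumes "C \<in> F" "C' \<in> F" "C \<noteq> C'" "length C = 5" "length C' = 5" "b1 \<in> set C" "b2 \<in> set C" "b3 \<in> set C"
    "b1 \<noteq> b2" "b1 \<noteq> b3" "b2 \<noteq> b3" "dg (set C') b1 = 5" "8 \<le> dg (set C') b2 + dg (set C') b3"
  shows False
proof -
  have C: "cyc C" "cyc C'" using assms cycF by blast+
  have dis: "set C \<inter> set C' = {}" using F assms unfolding fam_def by blast
  have cC': "card (set C') = 5" using cyc_card[OF C(2)] assms(5) by simp
  then have "card (set C') < dg (set C') b2 + dg (set C') b3" using assms(13) by linarith
  then obtain p where p: "p \<in> set C'" "adj b2 p" "adj b3 p"
    using common_nbr[of "set C'" b2 b3] by auto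
  obtain R' where R': "rot C' (p # R')" using rot_at p(1) by metis
  have c': "cyc (p # R')" "set (p # R') = set C'" "length (p # R') = 5"
    using cyc_rot[OF R'] C rot_props[OF R'] assms by auto
  obtain q1 q2 Rs where q: "R' = q1 # q2 # Rs" using c'(3) by (cases R'; cases "tl R'") auto
  have all: "adj b1 x" if "x \<in> set C'" for x using dg_full[OF _ _ that, of b1] assms(12) cC' by simp
  have qq: "adj q1 q2" "q1 \<in> set C'" "q2 \<in> set C'" "p \<noteq> q1" "p \<noteq> q2"
    using c' q by (auto simp: cyc_iff)
  have 1: "cyc [b1, q1, q2]" using all qq adj_sym adj_neq by (auto simp: cyc_iff)
  obtain Q where Q: "rot C (b1 # Q)" using rot_at assms(6) by metis
  note cq = cyc_path[OF C(1) Q]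
  have pQ: "p \<notin> set Q" "b2 \<in> set Q" "b3 \<in> set Q" using cq(3) p(1) dis assms by auto
  then obtain t where t: "cyc t" "set t \<subseteq> set Q \<union> {p}"
    using two_links[OF cq(1), of "[p]" b2 b3 p p] p assms(11) by auto
  have "card (set t) \<le> card (set Q \<union> {p})" using t(2) by (intro card_mono) auto
  also have "\<dots> \<le> length Q + 1" using card_Un_le[of "set Q" "{p}"] card_length[of Q] by simp
  also have "length Q = 4" using rot_props(2)[OF Q] assms(4) by simp
  finally have lt: "length t \<le> 5" using cyc_card[OF t(1)] by simp
  have "set [b1, q1, q2] \<inter> set t = {}"
    using t(2) cq(3) qq dis assms(6) p(1) by auto
  moreover have "set [b1, q1, q2] \<union> set t \<subseteq> set C \<union> set C' \<union> W" using t(2) cq(3) qq assms(6) p(1) by auto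
  ultimately show False using replace_two_cycles[OF assms(1-3) 1 t(1)] lt assms(4,5) by simp
qed

lemma card_vsF: "card (vs F) = (\<Sum>c\<in>F. length c)"
  using card_vs[OF F] cyc_card[OF cycF] by simp

lemma degW_bound:
  assumes "\<forall>c\<in>F. length c \<le> 5" "w \<in> W"
  shows "deg w + card (vs F) \<le> dg W w + 6 * j"
proof -
  have "(\<Sum>c\<in>F. dg (set c) w + length c) \<le> (\<Sum>c\<in>F. 6)" using dgW_le assms by (intro sum_mono) auto
  then show ?thesis using deg_split[of w] card_vsF cardF by (simp add: sum.distrib)
qed

text \<open>As at least \<open>5j - 1\<close> vertices are covered, two nonadjacent leaves of
  \<open>W\<close> have degree at most \<open>j + 2\<close>. Three vertices of the pentagon are
  adjacent to neither leaf, so each has degree at least \<open>4j + 1\<close>. At most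
  \<open>2 + 2\<close> of this goes to \<open>W\<close> and the pentagon, so another cycle receives
  13 edges from the three, which forces a pentagon with one vertex complete to it.\<close>

lemma no_pentagon:
  assumes short: "\<forall>c\<in>F. length c \<le> 5" and C: "C \<in> F" "length C = 5"
  shows False
proof -
  have nV: "card W + card (vs F) = card V"
    using fam_V[OF F] finV fam_finite_vs[OF F] by (metis card_Diff_subset card_mono le_add_diff_inverse2)
  have "card (vs F) \<le> (\<Sum>c\<in>F. 5)" unfolding card_vsF using short by (intro sum_mono) auto
  then have v: "5 * j \<le> card (vs F) + 1" "3 \<le> card W" using nV cardV cardW4 cardF by simp_all
  obtain w w' where w: "w \<in> W" "w' \<in> W" "w \<noteq> w'" "\<not> adj w w'" "dg W w \<le> 1" "dg W w' \<le> 1"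
    using leaf_pair[OF v(2)] by metis
  have dw: "deg w + card (vs F) \<le> 6 * j + 1" "deg w' + card (vs F) \<le> 6 * j + 1"
    using degW_bound[OF short w(1)] degW_bound[OF short w(2)] w(5,6) by linarith+
  define B where "B = set C - (nb (set C) w \<union> nb (set C) w')"
  have "card (nb (set C) w \<union> nb (set C) w') \<le> 2"
    using card_Un_le[of "nb (set C) w" "nb (set C) w'"] dgW_le1[OF w(1) C(1)] dgW_le1[OF w(2) C(1)] C(2)
    by (simp add: dg_def)
  moreover have "card (set C) = 5" using cyc_card[OF cycF[OF C(1)]] C(2) by simp
  ultimately have "3 \<le> card B"
    using diff_card_le_card_Diff[of "nb (set C) w \<union> nb (set C) w'" "set C"] unfolding B_def by simp
  then obtain B3 where B3: "B3 \<subseteq> B" "card B3 = 3" "finite B3" using obtain_subset_with_card_n by metis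
  have big: "4 * (j - 1) + 1 \<le> (\<Sum>c\<in>F - {C}. dg (set c) b)" if b: "b \<in> B" for b
  proof -
    have bC: "b \<in> set C" "\<not> adj w b" "\<not> adj w' b" using b by (auto simp: B_def nb_def)
    have bV: "b \<in> V" "b \<noteq> w" "b \<noteq> w'" using bC(1) cyc_V[OF cycF[OF C(1)]] W_not_c[OF w(1) C(1)] W_not_c[OF w(2) C(1)] by auto
    have t: "6 * j + 5 \<le> deg w + deg w' + deg b"
      using triple[of w w' b] w bV bC by blast
    have "nb W b \<subseteq> W - {w, w'}" using bC adj_sym by (auto simp: nb_def)
    then have "dg W b \<le> card (W - {w, w'})" unfolding dg_def using finW by (intro card_mono) auto
    also have "\<dots> = card W - 2" using w finW by (simp add: card_Diff_subset)
    finally have dW: "dg W b \<le> 2" using cardW4 by linarith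
    have "(\<Sum>c\<in>F. dg (set c) b) = dg (set C) b + (\<Sum>c\<in>F - {C}. dg (set c) b)" using C(1) finF by (simp add: sum.remove)
    then have "deg b \<le> 4 + (\<Sum>c\<in>F - {C}. dg (set c) b)" using deg_split[of b] dW dg_cyc_le2[OF C(1) bC(1)] by linarith
    then show ?thesis using t dw v(1) j1 by linarith
  qed
  have "3 * (4 * (j - 1) + 1) = (\<Sum>b\<in>B3. 4 * (j - 1) + 1)" using B3(2) by simp
  also have "\<dots> \<le> (\<Sum>b\<in>B3. \<Sum>c\<in>F - {C}. dg (set c) b)" using big B3(1) by (intro sum_mono) auto
  also have "\<dots> = (\<Sum>c\<in>F - {C}. \<Sum>b\<in>B3. dg (set c) b)" by (rule sum.swap)
  finally have tot: "3 * (4 * (j - 1) + 1) \<le> (\<Sum>c\<in>F - {C}. \<Sum>b\<in>B3. dg (set c) b)" .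
  have "\<exists>C'\<in>F - {C}. 13 \<le> (\<Sum>b\<in>B3. dg (set C') b)"
  proof (rule ccontr)
    assume no: "\<not> ?thesis"
    have "(\<Sum>b\<in>B3. dg (set c) b) \<le> 12" if "c \<in> F - {C}" for c
    proof -
      have "\<not> 13 \<le> (\<Sum>b\<in>B3. dg (set c) b)" using no that by blast
      then show ?thesis by linarith
    qed
    then have "(\<Sum>c\<in>F - {C}. \<Sum>b\<in>B3. dg (set c) b) \<le> (\<Sum>c\<in>F - {C}. 12)" by (rule sum_mono)
    also have "\<dots> = 12 * (j - 1)" using C(1) cardF finF by simp
    finally have ub: "(\<Sum>c\<in>F - {C}. \<Sum>b\<in>B3. dg (set c) b) \<le> 12 * (j - 1)" .
    from le_trans[OF tot ub] show False by simp
  qed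
  then obtain C' where C': "C' \<in> F" "C' \<noteq> C" "13 \<le> (\<Sum>b\<in>B3. dg (set C') b)" by blast
  obtain x y z where B3x: "B3 = {x, y, z}" "x \<noteq> y" "x \<noteq> z" "y \<noteq> z" using B3(2) by (auto simp: card_3_iff)
  then have sum: "13 \<le> dg (set C') x + dg (set C') y + dg (set C') z" using C'(3) by simp
  have cC': "card (set C') = length C'" "length C' \<le> 5" using cyc_card[OF cycF[OF C'(1)]] short C'(1) by auto
  have le: "dg (set C') b \<le> length C'" for b using dg_le_card[of "set C'" b] cC'(1) by simp
  have l5: "length C' = 5" using sum le[of x] le[of y] le[of z] cC'(2) by linarith
  have xyz: "x \<in> set C" "y \<in> set C" "z \<in> set C" using B3(1) B3x by (auto simp: B_def)
  note pp = pentagon_pair[OF C(1) C'(1) C'(2)[symmetric] C(2) l5]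
  consider "dg (set C') x = 5" | "dg (set C') y = 5" | "dg (set C') z = 5"
    using sum le[of x] le[of y] le[of z] l5 by linarith
  then show False
  proof cases
    case 1
    then have "8 \<le> dg (set C') y + dg (set C') z" using sum by linarith
    then show False using pp[of x y z] xyz B3x 1 by blast
  next
    case 2
    then have "8 \<le> dg (set C') x + dg (set C') z" using sum by linarith
    then show False using pp[of y x z] xyz B3x 2 by blast
  next
    case 3
    then have "8 \<le> dg (set C') x + dg (set C') y" using sum by linarith
    then show False using pp[of z x y] xyz B3x 3 by blast
  qed
qed

text \<open>Eight vertices are left. On \<open>W\<close>, acyclic with minimum degree one, there are
  two disjoint edges; the star is excluded by its three leaves. Each of the two edges is closed to a
  quadrilateral by one of two disjoint edges of the 4-cycle.\<close>

lemma small_case: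
  assumes F1: "F = {C}" "length C = 4" and W4: "card W = 4" "j = 1"
  shows False
proof -
  have CF: "C \<in> F" using F1 by simp
  have dsp: "deg v = dg W v + dg (set C) v" for v using deg_split[of v] F1 by simp
  have C2: "dg (set C) w \<le> 2" if "w \<in> W" for w using dgW_le2[OF that CF] F1 by simp
  have d3: "3 \<le> deg w" if "w \<in> W" for w using mindeg[of w] that W4(2) by simp
  have d1: "1 \<le> dg W w" if "w \<in> W" for w using d3[OF that] C2[OF that] dsp[of w] by linarith
  have tri: "\<not> (adj x q \<and> adj y q)" if "x \<in> W" "y \<in> W" "adj x y" "q \<in> set C" for x y q
  proof
    assume h: "adj x q \<and> adj y q"
    have "cyc [x, y, q]" using that h adj_sym adj_neq by (auto simp: cyc_iff)
    moreover have "set [x, y, q] \<subseteq> set C \<union> W" using that by auto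
    ultimately show False using replace_cycle(5)[OF CF] F1(2) by fastforce
  qed
  have "\<exists>w v w' v'. W = {w, v, w', v'} \<and> distinct [w, v, w', v'] \<and> adj w v \<and> adj w' v' \<and> dg W w = 1 \<and> dg W w' = 1 \<and>
      (adj v v' \<or> dg W v' = 1)"
  proof -
    have "W \<noteq> {}" using W4(1) by (metis card.empty zero_neq_numeral)
    obtain p where p: "pth p" "set p \<subseteq> W" "p \<noteq> []" "\<forall>q. pth q \<and> set q \<subseteq> W \<longrightarrow> length q \<le> length p"
      "length p = 1 \<longrightarrow> nb W (hd p) = {}"
      "2 \<le> length p \<longrightarrow> nb W (hd p) = {p ! 1}"
      "2 \<le> length p \<longrightarrow> nb W (last p) = {p ! (length p - 2)}"
      by (rule acyc_longest_path[OF finW \<open>W \<noteq> {}\<close> acycW])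
    have lp: "length p = card (set p)" using p(1) by (simp add: pth_def distinct_card)
    then have l4: "length p \<le> 4" using card_mono[OF finW p(2)] W4(1) by simp
    have hW: "hd p \<in> W" using p(2) hd_in_set[OF p(3)] by blast
    have n1: "length p \<noteq> 1"
    proof
      assume "length p = 1"
      then have "dg W (hd p) = 0" using p(5) by (simp add: dg_def)
      then show False using d1[OF hW] by simp
    qed
    moreover have "length p \<noteq> 0" using p(3) by simp
    ultimately consider "length p = 2" | "length p = 3" | "length p = 4" using l4 by linarith
    then show ?thesis
    proof cases
      case 1
      then obtain w v where pw: "p = [w, v]" by (cases p; cases "tl p") auto
      have nn: "nb W w = {v}" "nb W v = {w}" using p(6,7) pw by simp_all
      have wv: "w \<noteq> v" "adj w v" using p(1) pw by auto
      have "card (W - {w, v}) = 2" using p(2) pw W4(1) wv finW by (simp add: card_Diff_subset)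
      then obtain w' v' where wv': "W - {w, v} = {w', v'}" "w' \<noteq> v'" by (auto simp: card_2_iff)
      have WW: "W = {w, v, w', v'}" using wv' p(2) pw by auto
      have notin: "x \<in> {w', v'} \<Longrightarrow> \<not> adj x w \<and> \<not> adj x v" for x
        using nbI[of x W w] nbI[of x W v] nn wv' adj_sym WW by blast
      have nb': "nb W w' \<subseteq> {v'}" "nb W v' \<subseteq> {w'}"
        using notin[of w'] notin[of v'] adj_irrefl by (auto dest!: nbD simp: WW)
      have w'W: "w' \<in> W" "v' \<in> W" using WW by auto
      have le1: "dg W w' \<le> 1" "dg W v' \<le> 1" using card_mono[OF _ nb'(1)] card_mono[OF _ nb'(2)] by (simp_all add: dg_def)
      then have e1: "dg W w' = 1" "dg W v' = 1" using d1 w'W by (simp_all add: le_antisym)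
      then have "nb W w' \<noteq> {}" by (auto simp: dg_def)
      then have "adj w' v'" using nb'(1) by (auto dest: nbD)
      moreover have "dg W w = 1" using nn by (simp add: dg_def)
      moreover have "distinct [w, v, w', v']" using wv wv' by auto
      ultimately show ?thesis using WW wv(2) e1 by blast
    next
      case 2
      then obtain a b d where pa: "p = [a, b, d]" by (cases p; cases "tl p"; cases "tl (tl p)") auto
      have nn: "nb W a = {b}" "nb W d = {b}" using p(6,7) pa by simp_all
      have ab: "a \<noteq> b" "b \<noteq> d" "a \<noteq> d" using p(1) pa by auto
      have W3: "a \<in> W" "b \<in> W" "d \<in> W" using p(2) pa by auto
      have "card (W - {a, b, d}) = 1" using W3 W4(1) ab finW by (simp add: card_Diff_subset)
      then obtain z where z: "W - {a, b, d} = {z}" by (auto simp: card_1_singleton_iff)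
      then have zW: "z \<in> W" "z \<noteq> a" "z \<noteq> b" "z \<noteq> d" by auto
      have na: "\<not> adj a z" "\<not> adj d z" using nbI[OF zW(1), of a] nbI[OF zW(1), of d] nn zW by auto
      have "W = {a, b, d, z}" using z W3 by auto
      then have "nb W z \<subseteq> {b}" using na adj_sym adj_irrefl by (auto dest!: nbD)
      then have "dg W z \<le> 1" using card_mono[of "{b}" "nb W z"] by (simp add: dg_def)
      moreover have "\<not> adj a d" using nbI[OF W3(3), of a] nn ab by auto
      ultimately show ?thesis
        using no_triple[OF W3(1,3) zW(1)] na nn ab zW by (auto simp: dg_def)
    next
      case 3
      then obtain w v v' w' where pa: "p = [w, v, v', w']"
        by (cases p; cases "tl p"; cases "tl (tl p)"; cases "tl (tl (tl p))") auto
      have "set p = W" using card_subset_eq[OF finW p(2)] lp 3 W4(1) by simp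
      then have "W = {w, v, w', v'}" using pa by auto
      moreover have "dg W w = 1" "dg W w' = 1" using p(6,7) pa by (simp_all add: dg_def)
      moreover have "distinct [w, v, w', v']" "adj w v" "adj w' v'" "adj v v'" using p(1) pa adj_sym by auto
      ultimately show ?thesis by blast
    qed
  qed
  then obtain w v w' v' where W: "W = {w, v, w', v'}" "distinct [w, v, w', v']" "adj w v" "adj w' v'"
    "dg W w = 1" "dg W w' = 1" "adj v v' \<or> dg W v' = 1" by blast
  have inW: "w \<in> W" "v \<in> W" "w' \<in> W" "v' \<in> W" using W(1) by auto
  have full: "dg (set C) x = 2" if "x \<in> W" "dg W x = 1" for x using d3[OF that(1)] C2[OF that(1)] dsp[of x] that(2) by linarith
  have one: "\<exists>q\<in>set C. adj x q" if "x \<in> W" "y \<in> W" "x \<noteq> y" "\<not> adj x y" for x y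
  proof -
    have "nb W x \<subseteq> W - {x, y}" using that(4) adj_irrefl by (auto simp: nb_def)
    then have "dg W x \<le> card (W - {x, y})" unfolding dg_def using finW by (intro card_mono) auto
    also have "\<dots> = 2" using that finW W4(1) by (simp add: card_Diff_subset)
    finally have "0 < dg (set C) x" using d3[OF that(1)] dsp[of x] by linarith
    then show ?thesis using dg_pos by blast
  qed
  have "\<not> adj v w'"
  proof
    assume "adj v w'"
    then have "{v, v'} \<subseteq> nb W w'" using W(4) inW adj_sym by (auto simp: nb_def)
    then have "card {v, v'} \<le> dg W w'" unfolding dg_def by (intro card_mono) auto
    then show False using W(2,6) by simp
  qed
  then obtain qv where qv: "qv \<in> set C" "adj v qv" using one[OF inW(2,3)] W(2) by auto
  have "\<not> adj v' w"
  proof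
    assume "adj v' w"
    then have "{v, v'} \<subseteq> nb W w" using W(3) inW adj_sym by (auto simp: nb_def)
    then have "card {v, v'} \<le> dg W w" unfolding dg_def by (intro card_mono) auto
    then show False using W(2,5) by simp
  qed
  \<comment> \<open>If \<open>v\<close> and \<open>v'\<close> are adjacent, a common neighbour on
    \<open>C\<close> would form a triangle with them; otherwise \<open>v'\<close> has two neighbours
    on \<open>C\<close> to choose from.\<close>
  have "\<exists>q\<in>set C. adj v' q \<and> q \<noteq> qv"
  proof (cases "adj v v'")
    case True
    obtain q where "q \<in> set C" "adj v' q" using one[OF inW(4,1)] W(2) \<open>\<not> adj v' w\<close> by auto
    then show ?thesis using tri[OF inW(2,4) True] qv by blast
  next
    case False
    then have "dg (set C) v' = 2" using full inW W(7) by blast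
    then have "card (nb (set C) v') = 2" by (simp add: dg_def)
    then obtain a b where "nb (set C) v' = {a, b}" "a \<noteq> b" by (auto simp: card_2_iff)
    then have "a \<in> set C \<and> adj v' a" "b \<in> set C \<and> adj v' b" "a \<noteq> b" using nbD by auto
    then show ?thesis by metis
  qed
  then obtain ql where ql: "ql \<in> set C" "adj v' ql" "ql \<noteq> qv" by blast
  have cw: "dg (set C) w = 2" "dg (set C) w' = 2" using full inW W(5,6) by blast+
  then obtain q1 where "q1 \<in> set C" "adj w q1" using dg_pos[of "set C" w] by auto
  then obtain q2 q3 q4 where q: "set C = {q1, q2, q3, q4}" "adj q1 q2" "adj q2 q3" "adj q3 q4" "adj q4 q1"
    "distinct [q1, q2, q3, q4]"
    and diag: "\<And>w. w \<in> W \<Longrightarrow> \<not> (adj w q1 \<and> adj w q2) \<and> \<not> (adj w q2 \<and> adj w q3) \<and> \<not> (adj w q3 \<and> adj w q4) \<and> \<not> (adj w q4 \<and> adj w q1)"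
    using four_cycle[OF CF F1(2), of q1] by metis
  \<comment> \<open>Consecutive neighbours are excluded, so two neighbours on the 4-cycle are
    opposite.\<close>
  have two: "(adj x q1 \<and> adj x q3) \<or> (adj x q2 \<and> adj x q4)" if "x \<in> W" "dg (set C) x = 2" for x
  proof (rule ccontr)
    assume "\<not> ?thesis"
    then have "nb (set C) x \<subseteq> {q1} \<or> nb (set C) x \<subseteq> {q2} \<or> nb (set C) x \<subseteq> {q3} \<or> nb (set C) x \<subseteq> {q4}"
      using diag[OF that(1)] unfolding q(1) nb_def by auto
    then obtain y where "nb (set C) x \<subseteq> {y}" by blast
    then have "dg (set C) x \<le> 1" unfolding dg_def using card_mono[of "{y}"] by fastforce
    then show False using that(2) by simp
  qed
  have w13: "adj w q1" "adj w q3" using two[OF inW(1) cw(1)] diag[OF inW(1)] \<open>adj w q1\<close> by blast+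
  have "\<not> adj v q1" "\<not> adj v q3" using tri[OF inW(1,2) W(3)] w13 q(1) by auto
  then have qv': "qv = q2 \<or> qv = q4" using qv q(1) by auto
  have cycs: False if "cyc [w, v, a, b]" "cyc [w', v', c, d]" "distinct [a, b, c, d]" "{a, b, c, d} \<subseteq> set C" for a b c d
  proof -
    have o: "x \<notin> set C" if "x \<in> W" for x using W_not_c[OF that CF] .
    have "set [w, v, a, b] \<inter> set [w', v', c, d] = {}" using that(3,4) W(2) o[OF inW(1)] o[OF inW(2)] o[OF inW(3)] o[OF inW(4)] by auto
    moreover have "set [w, v, a, b] \<union> set [w', v', c, d] \<subseteq> set C \<union> W" using that(4) inW by auto
    ultimately show False using no_two_cycles[OF CF that(1,2)] by blast
  qed
  have qu: "cyc [x, y, a, b]" if "adj x y" "adj y a" "adj a b" "adj x b" "x \<in> W" "y \<in> W" "a \<in> set C" "b \<in> set C" for x y a b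
    using four_cycleI[of x y a b] that adj_sym W_not_c[OF that(5) CF] W_not_c[OF that(6) CF] by auto
  have sC: "q1 \<in> set C" "q2 \<in> set C" "q3 \<in> set C" "q4 \<in> set C" using q(1) by auto
  have sy: "adj q2 q1" "adj q3 q2" "adj q4 q3" "adj q1 q4" using q adj_sym by auto
  from two[OF inW(3) cw(2)] show False
  proof
    assume w': "adj w' q1 \<and> adj w' q3"
    then have "\<not> adj v' q1" "\<not> adj v' q3" using tri[OF inW(3,4) W(4)] q(1) by auto
    then have "ql = q2 \<or> ql = q4" using ql q(1) by auto
    then consider "qv = q2" "ql = q4" | "qv = q4" "ql = q2" using qv' ql(3) by blast
    then show False
    proof cases
      case 1
      then show False using cycs[OF qu[of w v q2 q1] qu[of w' v' q4 q3]] W inW qv ql w13 w' q sy sC by auto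
    next
      case 2
      then show False using cycs[OF qu[of w v q4 q1] qu[of w' v' q2 q3]] W inW qv ql w13 w' q sy sC by auto
    qed
  next
    assume w': "adj w' q2 \<and> adj w' q4"
    then have "\<not> adj v' q2" "\<not> adj v' q4" using tri[OF inW(3,4) W(4)] q(1) by auto
    then have "ql = q1 \<or> ql = q3" using ql q(1) by auto
    then consider "qv = q2" "ql = q1" | "qv = q2" "ql = q3" | "qv = q4" "ql = q1" | "qv = q4" "ql = q3" using qv' by blast
    then show False
    proof cases
      case 1
      then show False using cycs[OF qu[of w v q2 q3] qu[of w' v' q1 q4]] W inW qv ql w13 w' q sy sC by auto
    next
      case 2
      then show False using cycs[OF qu[of w v q2 q1] qu[of w' v' q3 q4]] W inW qv ql w13 w' q sy sC by auto
    next
      case 3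
      then show False using cycs[OF qu[of w v q4 q3] qu[of w' v' q1 q2]] W inW qv ql w13 w' q sy sC by auto
    next
      case 4
      then show False using cycs[OF qu[of w v q4 q1] qu[of w' v' q3 q2]] W inW qv ql w13 w' q sy sC by auto
    qed
  qed
qed

text \<open>With all lengths at most 4, the count \<open>5j + 3 <= 4j + 4\<close> leaves only
  \<open>j = 1\<close>, where both bounds are attained.\<close>

lemma mincyc_False: False
proof -
  have Fne: "F \<noteq> {}" using cardF j1 by auto
  define M where "M = Max (length ` F)"
  have "M \<in> length ` F" unfolding M_def using Fne finF by simp
  then obtain C where C: "C \<in> F" "length C = M" by blast
  have mx: "\<forall>C'\<in>F. length C' \<le> length C" using C(2) finF by (simp add: M_def)
  then have "length C \<le> 5" using no_long_cycle[OF C(1)] by force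
  then have short: "\<forall>c\<in>F. length c \<le> 5" using mx by auto
  then have "\<forall>c\<in>F. length c \<noteq> 5" using no_pentagon by blast
  then have l4: "\<forall>c\<in>F. length c \<le> 4" using short by fastforce
  have nV: "card W + card (vs F) = card V"
    using fam_V[OF F] finV fam_finite_vs[OF F] by (metis card_Diff_subset card_mono le_add_diff_inverse2)
  have "card (vs F) \<le> (\<Sum>c\<in>F. 4)" unfolding card_vsF using l4 by (intro sum_mono) auto
  then have "card (vs F) \<le> 4 * j" using cardF by simp
  then have j: "j = 1" "card W = 4" "card (vs F) = 4" using nV cardV cardW4 j1 by linarith+
  then have F1: "F = {C}" using cardF C(1) by (metis card_1_singletonE singletonD)
  then have "length C = 4" using j(3) card_vsF by simp
  then show False using small_case[OF F1 _ j(2,1)] by blast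
qed

end

section \<open>The induction on the number of cycles\<close>

context sgraph
begin

text \<open>All bounds become weaker for smaller \<open>k\<close>, so the induction hypothesis gives
  \<open>j\<close> cycles in the same graph, and no vertices are deleted. Among such families the
  two extremal choices are made one after the other.\<close>

theorem disjoint_cycles_exist:
  assumes "1 \<le> k" "5 * k \<le> card V + 2" "\<forall>v\<in>V. k + 1 \<le> deg v"
    and "\<forall>x\<in>V. \<forall>y\<in>V. \<forall>z\<in>V. x \<noteq> y \<longrightarrow> x \<noteq> z \<longrightarrow> y \<noteq> z \<longrightarrow> \<not> adj x y \<longrightarrow> \<not> adj x z \<longrightarrow> \<not> adj y z \<longrightarrow>
      6 * k \<le> deg x + deg y + deg z + 1"
  shows "\<exists>S. pk k S"
  using assms
proof (induction k)
  case (Suc j)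
  show ?case
  proof (cases "j = 0")
    case True
    have "V \<noteq> {}" using Suc.prems(2) by auto
    obtain c where "cyc c" "set c \<subseteq> V"
    proof (rule min_deg2_cycle[OF finV \<open>V \<noteq> {}\<close>])
      show "2 \<le> deg v" if "v \<in> V" for v using Suc.prems(3) that True by fastforce
    qed
    moreover have "pk 0 {}" using pkI[of "{}"] by simp
    ultimately show ?thesis using pk_insert[of 0 "{}" c] True by auto
  next
    case False
    have "\<exists>S. pk j S"
    proof (rule Suc.IH)
      show "\<forall>x\<in>V. \<forall>y\<in>V. \<forall>z\<in>V. x \<noteq> y \<longrightarrow> x \<noteq> z \<longrightarrow> y \<noteq> z \<longrightarrow> \<not> adj x y \<longrightarrow> \<not> adj x z \<longrightarrow> \<not> adj y z \<longrightarrow>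
        6 * j \<le> deg x + deg y + deg z + 1" using Suc.prems(4) by fastforce
      show "\<forall>v\<in>V. j + 1 \<le> deg v" using Suc.prems(3) by fastforce
    qed (use Suc.prems False in auto)
    then obtain S0 where "pk j S0" by blast
    then obtain S1 where S1: "pk j S1" "\<And>S. pk j S \<Longrightarrow> card S1 \<le> card S"
      using ex_has_least_nat[of "pk j" S0 card] by blast
    define P where "P S \<longleftrightarrow> pk j S \<and> card S = card S1" for S
    have "ne (V - S) < Suc (card V * card V)" for S
    proof -
      have "ne (V - S) \<le> (\<Sum>a\<in>V - S. card V)" unfolding ne_def
        using dg_le_card[of "V - S"] finV card_mono[OF finV, of "V - S"] by (intro sum_mono) (meson Diff_subset finite_Diff le_trans)
      also have "\<dots> \<le> card V * card V" using card_mono[OF finV, of "V - S"] by simp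
      finally show ?thesis by simp
    qed
    then obtain S2 where S2: "P S2" "\<And>S. P S \<Longrightarrow> ne (V - S) \<le> ne (V - S2)"
      using ex_has_greatest_nat[of P S1 "\<lambda>S. ne (V - S)" "Suc (card V * card V)"] S1(1) by (auto simp: P_def)
    then obtain F where F: "fam F" "card F = j" "vs F = S2" by (auto simp: P_def pk_def)
    show ?thesis
    proof (rule ccontr)
      assume no: "\<nexists>S. pk (Suc j) S"
      interpret mincyc V adj F j
      proof (unfold_locales)
        show "5 * j + 3 \<le> card V" using Suc.prems(2) by simp
        show "j + 2 \<le> deg v" if "v \<in> V" for v using Suc.prems(3) that by fastforce
        show "6 * j + 5 \<le> deg x + deg y + deg z" if "x \<in> V" "y \<in> V" "z \<in> V" "x \<noteq> y" "x \<noteq> z" "y \<noteq> z"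
          "\<not> adj x y" "\<not> adj x z" "\<not> adj y z" for x y z
          using Suc.prems(4)[rule_format, OF that] by simp
        show "1 \<le> j" using False by simp
        show "\<not> pk (Suc j) S" for S using no by blast
        show "fam F" "card F = j" by fact+
        show "card (vs F) \<le> card S" if "pk j S" for S using S1(2)[OF that] S2(1) F(3) by (simp add: P_def)
        show "ne (V - S) \<le> ne (V - vs F)" if "pk j S" "card S = card (vs F)" for S
          using S2(2)[of S] S2(1) that F(3) by (simp add: P_def)
      qed
      show False by (rule mincyc_False)
    qed
  qed
qed simp

end

section \<open>Vertices of low degree\<close>

context sgraph
begin

definition high :: "'a \<Rightarrow> bool" where "high v \<longleftrightarrow> card V \<le> 2 * deg v"

lemma rot_pth:
  assumes "cyc c" "rot c (xs @ ys @ zs)"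
  shows "pth ys"
proof -
  have "pth (xs @ ys @ zs)" using cyc_rot[OF assms(2)] assms(1) by (simp add: cyc_iff)
  then have "pth (ys @ zs)" using pth_appendD by blast
  then show ?thesis using pth_appendD by blast
qed

lemma link_three:
  assumes "pth s" "pth t" "pth p" "s \<noteq> []" "t \<noteq> []" "p \<noteq> []" "set s \<inter> set t = {}" "set s \<inter> set p = {}" "set t \<inter> set p = {}"
    "adj (last s) (hd t)" "adj (last t) (hd p)" "adj (last p) (hd s)"
  shows "cyc (s @ t @ p)"
proof -
  have "pth (s @ t)" using assms by (simp add: pth_append)
  moreover have "1 \<le> length s" "1 \<le> length t" "1 \<le> length p" using assms(4-6) by (simp_all add: Suc_le_eq)
  ultimately have "cyc ((s @ t) @ p)" using assms by (intro link_paths) auto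
  then show ?thesis by simp
qed

text \<open>The set \<open>Y\<close> consists of the first low vertex after each vertex of \<open>N\<close> on \<open>c\<close>.\<close>

lemma first_low_set:
  assumes c: "cyc c" and N: "N \<subseteq> set c" "2 \<le> card N"
    and P1: "\<forall>u v A B. rot c (u # A @ v # B) \<longrightarrow> u \<in> N \<longrightarrow> v \<in> N \<longrightarrow> set A \<inter> N = {} \<longrightarrow> (\<exists>y\<in>set A. \<not> high y)"
    and P2: "\<forall>u v x y I A J B. rot c (u # I @ y # A @ v # J @ x # B) \<longrightarrow> u \<in> N \<longrightarrow> v \<in> N \<longrightarrow>
      (\<forall>z\<in>set I \<union> set J. high z \<and> z \<notin> N) \<longrightarrow> y \<notin> N \<longrightarrow> x \<notin> N \<longrightarrow> \<not> adj y x"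
  shows "\<exists>Y. Y \<subseteq> set c - N \<and> card Y = card N \<and> (\<forall>y\<in>Y. \<not> high y) \<and> (\<forall>y\<in>Y. \<forall>x\<in>Y. \<not> adj y x) \<and>
    (\<forall>y\<in>Y. \<exists>u\<in>N. \<exists>I R. rot c (u # I @ y # R) \<and> (\<forall>z\<in>set I. high z \<and> z \<notin> N))"
proof -
  have dc: "distinct c" using c by (simp add: cyc_def)
  define good where "good u I y R \<longleftrightarrow> rot c (u # I @ y # R) \<and> (\<forall>z\<in>set I. high z \<and> z \<notin> N) \<and> \<not> high y \<and> y \<notin> N" for u I y R
  have ex: "\<exists>I y R. good u I y R" if u: "u \<in> N" for u
  proof -
    obtain v where v: "v \<in> N" "v \<noteq> u" using finite_sets_two[OF N(2)] u by metis
    have "u \<in> set c" using u N(1) by blast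
    then obtain T where T: "rot c (u # T)" by (rule rot_at)
    have "v \<in> set T" using rot_props(1)[OF T] v N(1) by auto
    then have "\<exists>x\<in>set T. x \<in> N" using v by blast
    then obtain A v' B where s: "T = A @ v' # B" "v' \<in> N" "\<forall>x\<in>set A. x \<notin> N"
      using split_list_first_prop[of T "\<lambda>x. x \<in> N"] by blast
    have "rot c (u # A @ v' # B)" using T s(1) by simp
    then have "\<exists>y\<in>set A. \<not> high y" using P1 u s(2,3) by blast
    then obtain I y A' where t: "A = I @ y # A'" "\<not> high y" "\<forall>x\<in>set I. \<not> \<not> high x"
      using split_list_first_prop[of A "\<lambda>x. \<not> high x"] by blast
    have "good u I y (A' @ v' # B)" unfolding good_def using T s t by auto
    then show ?thesis by blast
  qed
  then have "\<forall>u\<in>N. \<exists>I y R. good u I y R" by blast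
  then obtain fI fy fR where g: "\<And>u. u \<in> N \<Longrightarrow> good u (fI u) (fy u) (fR u)" by metis
  have pair: "fy u \<noteq> fy v \<and> \<not> adj (fy u) (fy v)" if uv: "u \<in> N" "v \<in> N" "u \<noteq> v" for u v
  proof -
    have gu: "rot c (u # fI u @ fy u # fR u)" "\<forall>z\<in>set (fI u). high z \<and> z \<notin> N" "fy u \<notin> N"
      using g[OF uv(1)] by (simp_all add: good_def)
    have gv: "rot c (v # fI v @ fy v # fR v)" "\<forall>z\<in>set (fI v). high z \<and> z \<notin> N" "fy v \<notin> N"
      using g[OF uv(2)] by (simp_all add: good_def)
    have "v \<in> set (u # fI u @ fy u # fR u)" using rot_props(1)[OF gu(1)] N(1) uv(2) by auto
    then have "v \<in> set (fR u)" using uv gu by auto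
    then obtain R1 R2 where R: "fR u = R1 @ v # R2" using split_list by metis
    have "rot c ((u # fI u @ fy u # R1) @ (v # R2))" using gu(1) R by simp
    then have "rot c ((v # R2) @ (u # fI u @ fy u # R1))" by (rule rot_append)
    then have "rot c (v # (R2 @ u # fI u @ fy u # R1))" by simp
    then have eq: "fI v @ fy v # fR v = R2 @ u # fI u @ fy u # R1"
      using rot_unique[OF dc gv(1)] by blast
    have notu: "u \<notin> set (fI v)" "u \<noteq> fy v" using gv uv(1) by auto
    \<comment> \<open>The stretch from \<open>v\<close> to its first low vertex contains no vertex
      of \<open>N\<close>, so it ends before the rotation comes to \<open>u\<close>.\<close>
    obtain B where B: "R2 = fI v @ fy v # B"
    proof -
      from eq consider us where "fI v = R2 @ us" "us @ fy v # fR v = u # fI u @ fy u # R1"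
        | us where "fI v @ us = R2" "fy v # fR v = us @ u # fI u @ fy u # R1"
        unfolding append_eq_append_conv2 by blast
      then show thesis
      proof cases
        case 1 then show thesis using notu by (cases us) auto
      next
        case 2 then show thesis using notu that by (cases us) auto
      qed
    qed
    have r: "rot c (u # fI u @ fy u # R1 @ v # fI v @ fy v # B)" using gu(1) R B by simp
    have "\<not> adj (fy u) (fy v)" using P2[rule_format, OF r uv(1,2)] gu gv by blast
    moreover have "distinct (u # fI u @ fy u # R1 @ v # fI v @ fy v # B)" using rot_props(3)[OF r] dc by simp
    ultimately show ?thesis by auto
  qed
  have "inj_on fy N" using pair by (auto simp: inj_on_def)
  then have "card (fy ` N) = card N" by (rule card_image)
  moreover have "fy ` N \<subseteq> set c - N"
  proof
    fix y assume "y \<in> fy ` N"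
    then obtain u where u: "u \<in> N" "y = fy u" by blast
    then have "rot c (u # fI u @ fy u # fR u)" "fy u \<notin> N" using g[OF u(1)] by (simp_all add: good_def)
    then show "y \<in> set c - N" using rot_props(1) u(2) by fastforce
  qed
  moreover have "\<forall>y\<in>fy ` N. \<not> high y" using g by (auto simp: good_def)
  moreover have "\<forall>y\<in>fy ` N. \<forall>x\<in>fy ` N. \<not> adj y x" using pair adj_irrefl by (metis imageE)
  moreover have "\<forall>y\<in>fy ` N. \<exists>u\<in>N. \<exists>I R. rot c (u # I @ y # R) \<and> (\<forall>z\<in>set I. high z \<and> z \<notin> N)"
    using g unfolding good_def by blast
  ultimately show ?thesis by blast
qed

text \<open>The vertex \<open>y\<close> and the successors of the members of \<open>M\<close> other
  than \<open>u\<close> are \<open>|M|\<close> vertices of \<open>c\<close> that are not adjacent to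
  \<open>y\<close>.\<close>

lemma succ_count:
  assumes "bij_betw f (set c) (set c)" "M \<subseteq> set c" "u \<in> M" "y \<in> set c"
    "\<forall>z\<in>M. z \<noteq> u \<longrightarrow> f z \<noteq> y \<and> \<not> adj y (f z)"
  shows "dg (set c) y + card M \<le> card (set c)"
proof -
  have finM: "finite M" using assms(2) finite_subset by blast
  define Z where "Z = insert y (f ` (M - {u}))"
  have "inj_on f (M - {u})"
    by (rule inj_on_subset[OF bij_betw_imp_inj_on[OF assms(1)]]) (use assms(2) in blast)
  then have "card (f ` (M - {u})) = card M - 1" using assms(3) finM by (simp add: card_image)
  moreover have "y \<notin> f ` (M - {u})" using assms(5) by auto
  moreover have "0 < card M" using assms(3) finM card_gt_0_iff by blast
  ultimately have cZ: "card Z = card M" using finM by (simp add: Z_def)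
  have Zc: "Z \<subseteq> set c" using assms(2,4) bij_betwE[OF assms(1)] by (auto simp: Z_def)
  have "nb (set c) y \<subseteq> set c - Z" using assms(5) adj_irrefl by (auto simp: nb_def Z_def)
  then have "dg (set c) y \<le> card (set c - Z)" unfolding dg_def by (intro card_mono) auto
  moreover have "card (set c - Z) + card Z = card (set c)"
    using Zc by (metis card_Diff_subset card_mono finite_set finite_subset le_add_diff_inverse2)
  ultimately show ?thesis using cZ by linarith
qed

lemma pigeonhole_fam:
  assumes "fam F" "N \<subseteq> vs F" "card F * s < card N"
  obtains c where "c \<in> F" "s < card (N \<inter> set c)"
proof -
  have "\<not> (\<forall>c\<in>F. card (N \<inter> set c) \<le> s)"
  proof
    assume "\<forall>c\<in>F. card (N \<inter> set c) \<le> s"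
    then have "(\<Sum>c\<in>F. card (N \<inter> set c)) \<le> (\<Sum>c\<in>F. s)" by (intro sum_mono) auto
    then show False using card_Int_vs[OF assms(1,2)] assms(3) by simp
  qed
  then obtain c where "c \<in> F" "\<not> card (N \<inter> set c) \<le> s" by blast
  then show thesis using that by simp
qed

lemma pth_through:
  assumes "pth (x # a)" "pth (x # b)" "set a \<inter> set b = {}"
  shows "pth (rev a @ x # b)"
proof (cases "a = []")
  case False
  have "x \<notin> set a" "x \<notin> set b" using assms(1,2) by (auto simp: pth_Cons)
  then show ?thesis using False assms adj_sym by (auto simp: pth_append pth_Cons last_rev)
qed (use assms in simp)

text \<open>Every rerouting stays within one cycle and the uncovered vertices, picks up
  \<open>x\<close> and gives up only high vertices. These are simply left uncovered: the quantity
  minimised is the number of uncovered low vertices.\<close>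

lemma cover_low:
  assumes conn: "conn m" and r: "2 \<le> r" and k: "1 \<le> k" "k * (r - 1) < m"
    and low: "\<And>X. X \<subseteq> V \<Longrightarrow> \<forall>x\<in>X. \<not> high x \<Longrightarrow> \<forall>x\<in>X. \<forall>y\<in>X. \<not> adj x y \<Longrightarrow> card X \<le> r"
    and pk: "pk k S0"
  shows "\<exists>S. pk k S \<and> (\<forall>v\<in>V - S. high v)"
proof -
  define lo where "lo S = {v \<in> V - S. \<not> high v}" for S
  obtain S where S: "pk k S" "\<And>S'. pk k S' \<Longrightarrow> card (lo S) \<le> card (lo S')"
    using ex_has_least_nat[of "pk k" S0 "\<lambda>S. card (lo S)"] pk by blast
  obtain F where F: "fam F" "card F = k" "vs F = S" using S(1) by (auto simp: pk_def)
  show ?thesis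
  proof (rule ccontr)
    assume "\<not> ?thesis"
    then obtain x where x: "x \<in> V - vs F" "\<not> high x" using S(1) F(3) by blast
    have TV: "vs F \<subseteq> V" using fam_V F(1) by blast
    \<comment> \<open>The cycles may have fewer than \<open>m\<close> vertices altogether. Then the
      fan reaches all of them, and \<open>Y\<close>, being disjoint from \<open>N = set c\<close>,
      would be empty.\<close>
    define t where "t = min m (card (vs F))"
    have tt: "t \<le> m" "t \<le> card (vs F)" by (simp_all add: t_def)
    obtain U q where U: "U \<subseteq> vs F" "card U = t"
      and q: "\<And>u. u \<in> U \<Longrightarrow> pth (x # q u) \<and> set (q u) \<subseteq> V - vs F \<and> adj (last (x # q u)) u"
      and qd: "\<And>u v. u \<in> U \<Longrightarrow> v \<in> U \<Longrightarrow> u \<noteq> v \<Longrightarrow> set (q u) \<inter> set (q v) = {}"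
      using fan[OF conn TV x(1) tt] by blast
    have rep: False if "c \<in> F" "cyc c'" "set c' \<subseteq> set c \<union> (V - vs F)" "x \<in> set c'" "\<forall>v\<in>set c - set c'. high v" for c c'
    proof -
      have dis: "set c' \<inter> (vs F - set c) = {}" using that(3) by blast
      note rp = fam_replace[OF F(1) that(1,2) dis]
      define S' where "S' = set c' \<union> (vs F - set c)"
      have "pk k S'" using pkI[OF rp(1)] rp(2,3) F(2) by (simp add: S'_def)
      then have le: "card (lo S) \<le> card (lo S')" by (rule S(2))
      have "lo S' \<subset> lo S"
      proof (rule psubsetI)
        show "lo S' \<subseteq> lo S" using that(5) F(3) by (auto simp: lo_def S'_def)
        have "x \<in> lo S" "x \<notin> lo S'" using x that(4) F(3) by (auto simp: lo_def S'_def)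
        then show "lo S' \<noteq> lo S" by blast
      qed
      have "finite (lo S)" using finV by (simp add: lo_def)
      from psubset_card_mono[OF this \<open>lo S' \<subset> lo S\<close>] show False using le by simp
    qed
    define P where "P u v = rev (q u) @ x # q v" for u v
    have P: "pth (P u v)" "set (P u v) \<subseteq> V - vs F" "x \<in> set (P u v)" "adj u (hd (P u v))" "adj (last (P u v)) v"
      if "u \<in> U" "v \<in> U" "u \<noteq> v" for u v
    proof -
      show "pth (P u v)" unfolding P_def using q[OF that(1)] q[OF that(2)] qd[OF that] by (intro pth_through) auto
      show "set (P u v) \<subseteq> V - vs F" unfolding P_def using q[OF that(1)] q[OF that(2)] x(1) by auto
      show "x \<in> set (P u v)" by (simp add: P_def)
      have "hd (P u v) = last (x # q u)" by (cases "q u = []") (simp_all add: P_def hd_append hd_rev)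
      then show "adj u (hd (P u v))" using q[OF that(1)] adj_sym by simp
      show "adj (last (P u v)) v" using q[OF that(2)] by (simp add: P_def)
    qed
    have Pne: "P u v \<noteq> []" for u v by (simp add: P_def)
    obtain c where c: "c \<in> F" "2 \<le> card (U \<inter> set c)" "r \<le> card (U \<inter> set c) \<or> set c \<subseteq> U"
    proof (cases "m \<le> card (vs F)")
      case True
      then have "card F * (r - 1) < card U" using U(2) k F(2) by (simp add: t_def)
      then obtain c where "c \<in> F" "r - 1 < card (U \<inter> set c)" using pigeonhole_fam[OF F(1) U(1)] by metis
      then show thesis using that[of c] r by linarith
    next
      case False
      then have "U = vs F" using U fam_finite_vs[OF F(1)] by (simp add: t_def card_subset_eq)
      moreover obtain c where cF: "c \<in> F" using F(2) k(1) by (metis card.empty ex_in_conv not_one_le_zero)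
      ultimately have "set c \<subseteq> U" using set_sub_vs by blast
      then have "U \<inter> set c = set c" by blast
      then show thesis using that[OF cF] \<open>set c \<subseteq> U\<close> cyc_card[OF fam_cyc[OF F(1) cF]] by simp
    qed
    define N where "N = U \<inter> set c"
    have cc: "cyc c" using fam_cyc[OF F(1) c(1)] .
    have N: "N \<subseteq> set c" "2 \<le> card N" using c(2) by (simp_all add: N_def)
    have out: "set c \<inter> (V - vs F) = {}" using set_sub_vs[OF c(1)] by blast
    \<comment> \<open>An arc of high vertices between two ends of the fan is bypassed through
      \<open>x\<close>.\<close>
    have P1: "\<forall>u v A B. rot c (u # A @ v # B) \<longrightarrow> u \<in> N \<longrightarrow> v \<in> N \<longrightarrow> set A \<inter> N = {} \<longrightarrow> (\<exists>y\<in>set A. \<not> high y)"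
    proof (intro allI impI, rule ccontr)
      fix u v A B assume a: "rot c (u # A @ v # B)" "u \<in> N" "v \<in> N" "\<not> (\<exists>y\<in>set A. \<not> high y)"
      have sc: "set (u # A @ v # B) = set c" using rot_props(1)[OF a(1)] .
      have "rot c ((v # B) @ (u # A))" using rot_append[of c "u # A" "v # B"] a(1) by simp
      then have s: "pth (v # B @ [u])" using rot_pth[OF cc, of "[]" "v # B @ [u]" A] by simp
      have uv: "u \<in> U" "v \<in> U" "u \<noteq> v" using a N_def s by (auto simp: pth_Cons)
      note p = P[OF uv]
      have "1 \<le> length (P u v)" using Pne by (simp add: Suc_le_eq)
      then have "cyc ((v # B @ [u]) @ P u v)"
        using s p out sc Pne by (intro link_paths) auto
      then show False using rep[OF c(1), of "(v # B @ [u]) @ P u v"] sc p a(4) by auto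
    qed
    \<comment> \<open>An edge \<open>yz\<close> between two first low vertices gives a cycle that
      follows the arc from \<open>y\<close> to \<open>v\<close>, passes through \<open>x\<close> to
      \<open>u\<close> and runs backwards to \<open>z\<close>. Only \<open>I\<close> and
      \<open>J\<close> are given up.\<close>
    have P2: "\<forall>u v x y I A J B. rot c (u # I @ y # A @ v # J @ x # B) \<longrightarrow> u \<in> N \<longrightarrow> v \<in> N \<longrightarrow>
      (\<forall>z\<in>set I \<union> set J. high z \<and> z \<notin> N) \<longrightarrow> y \<notin> N \<longrightarrow> x \<notin> N \<longrightarrow> \<not> adj y x"
    proof (intro allI impI notI)
      fix u v z y I A J B
      assume a: "rot c (u # I @ y # A @ v # J @ z # B)" "u \<in> N" "v \<in> N" "\<forall>w\<in>set I \<union> set J. high w \<and> w \<notin> N" "adj y z"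
      have sc: "set (u # I @ y # A @ v # J @ z # B) = set c" using rot_props(1)[OF a(1)] .
      have d: "distinct (u # I @ y # A @ v # J @ z # B)" using rot_props(3)[OF a(1)] cc by (simp add: cyc_def)
      have s1: "pth (y # A @ [v])" using rot_pth[OF cc, of "u # I" "y # A @ [v]" "J @ z # B"] a(1) by simp
      have "rot c ((z # B) @ (u # I @ y # A @ v # J))" using rot_append[of c "u # I @ y # A @ v # J" "z # B"] a(1) by simp
      then have s2: "pth (z # B @ [u])" using rot_pth[OF cc, of "[]" "z # B @ [u]" "I @ y # A @ v # J"] by simp
      have uv: "v \<in> U" "u \<in> U" "v \<noteq> u" using a d N_def by auto
      note p = P[OF uv]
      have s2': "pth (rev (z # B @ [u]))" using s2 by (simp only: pth_rev)
      have "cyc ((y # A @ [v]) @ P v u @ rev (z # B @ [u]))"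
      proof (rule link_three[OF s1 p(1) s2'])
        show "set (y # A @ [v]) \<inter> set (P v u) = {}" using out sc p(2) by auto
        show "set (y # A @ [v]) \<inter> set (rev (z # B @ [u])) = {}" using d by auto
        show "set (P v u) \<inter> set (rev (z # B @ [u])) = {}" using out sc p(2) by auto
      qed (use p Pne a(5) adj_sym in auto)
      then show False using rep[OF c(1), of "(y # A @ [v]) @ P v u @ rev (z # B @ [u])"] sc p a(4) by auto
    qed
    obtain Y where Y: "Y \<subseteq> set c - N" "card Y = card N" "\<forall>y\<in>Y. \<not> high y" "\<forall>y\<in>Y. \<forall>x\<in>Y. \<not> adj y x"
      "\<forall>y\<in>Y. \<exists>u\<in>N. \<exists>I R. rot c (u # I @ y # R) \<and> (\<forall>z\<in>set I. high z \<and> z \<notin> N)"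
      using first_low_set[OF cc N P1 P2] by blast
    have "r \<le> card N"
    proof (rule ccontr)
      assume "\<not> r \<le> card N"
      then have "N = set c" using c(3) by (auto simp: N_def)
      then have "Y = {}" using Y(1) by blast
      then show False using Y(2) N(2) by simp
    qed
    \<comment> \<open>A single fan path suffices here: from \<open>u\<close> to \<open>x\<close> and
      on to \<open>y\<close>, bypassing the high stretch \<open>I\<close>.\<close>
    have xy: "\<not> adj x y" if y: "y \<in> Y" for y
    proof
      assume xy: "adj x y"
      obtain u I R where a: "u \<in> N" "rot c (u # I @ y # R)" "\<forall>z\<in>set I. high z \<and> z \<notin> N" using Y(5) y by blast
      have sc: "set (u # I @ y # R) = set c" using rot_props(1)[OF a(2)] .
      have "rot c ((y # R) @ (u # I))" using rot_append[of c "u # I" "y # R"] a(2) by simp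
      then have s: "pth (y # R @ [u])" using rot_pth[OF cc, of "[]" "y # R @ [u]" I] by simp
      have uU: "u \<in> U" using a(1) by (simp add: N_def)
      have s2: "pth (rev (x # q u))" using q[OF uU] by (simp only: pth_rev)
      have "cyc ((y # R @ [u]) @ rev (x # q u))"
      proof (rule link_paths[OF s s2])
        show "set (y # R @ [u]) \<inter> set (rev (x # q u)) = {}" using out sc q[OF uU] x(1) by auto
        show "adj (last (y # R @ [u])) (hd (rev (x # q u)))"
          using q[OF uU] adj_sym by (simp add: hd_append hd_rev split: if_splits)
        show "adj (last (rev (x # q u))) (hd (y # R @ [u]))" using xy by simp
      qed auto
      then show False using rep[OF c(1), of "(y # R @ [u]) @ rev (x # q u)"] sc q[OF uU] x(1) a(3) by auto
    qed
    have "x \<notin> Y" using Y(1) out x(1) by blast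
    moreover have "finite Y" using Y(1) finite_subset by blast
    ultimately have "r + 1 \<le> card (insert x Y)" using \<open>r \<le> card N\<close> Y(2) by simp
    moreover have "card (insert x Y) \<le> r"
    proof (rule low)
      show "insert x Y \<subseteq> V" using Y(1) x(1) cyc_V[OF cc] by blast
      show "\<forall>z\<in>insert x Y. \<not> high z" using Y(3) x(2) by blast
      show "\<forall>z\<in>insert x Y. \<forall>y\<in>insert x Y. \<not> adj z y" using Y(4) xy adj_sym adj_irrefl by blast
    qed
    ultimately show False by simp
  qed
qed

end

section \<open>Extending a family that covers all vertices of low degree\<close>

text \<open>Competing families must cover all low vertices too, so an exchange may give up high
  vertices only, and it must gain more than it gives up.\<close>

locale max_cover = sgraph +
  fixes F :: "'a list set" and k :: nat
  assumes famF: "fam F" and cardF: "card F = k"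
    and hiW: "v \<in> V - vs F \<Longrightarrow> high v"
    and maxF: "pk k S \<Longrightarrow> \<forall>v\<in>V - S. high v \<Longrightarrow> card S \<le> card (vs F)"
    and Wne: "V - vs F \<noteq> {}"
begin

abbreviation W :: "'a set" where "W \<equiv> V - vs F"

text \<open>
  The maximality of \<open>F\<close> forbids two consecutive vertices in \<open>N\<close>; hence the predecessors \<open>preN\<close> are
  disjoint from \<open>N\<close> and equinumerous with it, and the subtraction in \<open>E\<close> is not truncated.
\<close>

definition N :: "'a set" where "N = {u \<in> vs F. \<exists>w\<in>W. adj u w}"
definition E :: nat where "E = card (vs F) - 2 * card N"
definition preN :: "'a set" where "preN = {x. \<exists>y\<in>N. (x, y) \<in> astep F}"

lemma finW: "finite W" using finV by simp
lemma finvs: "finite (vs F)" using fam_finite_vs[OF famF] .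
lemma vsV: "vs F \<subseteq> V" using fam_V[OF famF] .
lemma cardV: "card V = card W + card (vs F)"
  using vsV finV by (metis card_Diff_subset card_mono finvs le_add_diff_inverse2)
lemma Nsub: "N \<subseteq> vs F" by (auto simp: N_def)
lemma finN: "finite N" using Nsub finvs finite_subset by blast
lemma cycF: "c \<in> F \<Longrightarrow> cyc c" using famF fam_cyc by blast
lemma outW: "c \<in> F \<Longrightarrow> set c \<inter> W = {}" using set_sub_vs by blast

lemma no_larger_family:
  assumes "pk k S" "vs F \<subseteq> S" "vs F \<noteq> S" shows False
proof -
  have "finite S" using pk_V[OF assms(1)] finV finite_subset by blast
  then have "card (vs F) < card S" using assms(2,3) psubset_card_mono by blast
  moreover have "card S \<le> card (vs F)" using maxF[OF assms(1)] hiW assms(2) by blast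
  ultimately show False by simp
qed

lemma noins: "w \<in> W \<Longrightarrow> \<not> ins F w"
proof
  assume w: "w \<in> W" "ins F w"
  obtain F' where F': "fam F'" "card F' = card F" "vs F' = vs F \<union> set [w]"
  proof (rule path_insertion[OF famF])
    show "pth [w]" "set [w] \<inter> vs F = {}" using w by auto
    show "ins F v" if "v \<in> set [w]" for v using that w by simp
  qed
  have "pk k (vs F \<union> set [w])" using pkI[OF F'(1)] F'(2,3) cardF by simp
  moreover have "vs F \<noteq> vs F \<union> set [w]" using w(1) by auto
  ultimately show False using no_larger_family[of "vs F \<union> set [w]"] by blast
qed

text \<open>Not being insertable, \<open>w\<close> sees at most half of the cycles; being high, it
  makes up for this inside \<open>W\<close>.\<close>

lemma dgW_half: "w \<in> W \<Longrightarrow> card W \<le> 2 * dg W w"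
proof -
  assume w: "w \<in> W"
  have "card V \<le> 2 * deg w" using hiW[OF w] by (simp add: high_def)
  moreover have "deg w = dg (vs F) w + dg W w" using dg_split[OF vsV] .
  moreover have "2 * dg (vs F) w \<le> card (vs F)" using not_ins_dg[OF famF noins[OF w]] .
  ultimately show ?thesis using cardV by linarith
qed

lemma W_common:
  assumes "w \<in> W" "w' \<in> W" "w \<noteq> w'" "\<not> adj w w'"
  obtains x where "x \<in> W" "adj w x" "adj w' x"
proof -
  have sub: "nb W w \<union> nb W w' \<subseteq> W - {w, w'}" using assms(4) adj_sym adj_irrefl by (auto simp: nb_def)
  have "card (W - {w, w'}) + 2 = card W"
  proof -
    have "card W \<ge> 2" using assms finW card_mono[of W "{w, w'}"] by auto
    then show ?thesis using assms finW by (simp add: card_Diff_subset)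
  qed
  moreover have "card (nb W w \<union> nb W w') \<le> card (W - {w, w'})" using sub finW by (intro card_mono) auto
  moreover have "card W \<le> dg W w + dg W w'" using dgW_half[OF assms(1)] dgW_half[OF assms(2)] by linarith
  ultimately have "nb W w \<inter> nb W w' \<noteq> {}"
    using card_Un_disjoint[OF finite_nb finite_nb, of W w W w'] by (auto simp: dg_def)
  then show thesis using that by (auto simp: nb_def)
qed

lemma W_path:
  assumes "w \<in> W" "w' \<in> W"
  obtains p where "pth p" "set p \<subseteq> W" "p \<noteq> []" "hd p = w" "last p = w'"
proof (cases "w = w'")
  case True then show thesis using that[of "[w]"] assms by simp
next
  case neq: False
  show thesis
  proof (cases "adj w w'")
    case True then show thesis using that[of "[w, w']"] assms neq by simp
  next
    case False
    then obtain x where x: "x \<in> W" "adj w x" "adj w' x" using W_common assms neq by metis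
    then show thesis using that[of "[w, x, w']"] assms neq adj_sym adj_neq by auto
  qed
qed

text \<open>A path in \<open>W\<close> between neighbours of \<open>x\<close> and \<open>y\<close>
  could be inserted between them.\<close>

lemma N_no_step: "(x, y) \<in> astep F \<Longrightarrow> \<not> (x \<in> N \<and> y \<in> N)"
proof
  assume xy: "(x, y) \<in> astep F" "x \<in> N \<and> y \<in> N"
  then obtain w w' where w: "w \<in> W" "adj x w" "w' \<in> W" "adj y w'" by (auto simp: N_def)
  obtain p where p: "pth p" "set p \<subseteq> W" "p \<noteq> []" "hd p = w" "last p = w'" using W_path w by metis
  have d: "set p \<inter> vs F = {}" using p(2) by blast
  obtain F' where F': "fam F'" "card F' = card F" "vs F' = vs F \<union> set p" "astep F - {(x, y)} \<subseteq> astep F'"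
    using insert_path[OF famF xy(1) p(1,3) d] p w adj_sym by metis
  have "pk k (vs F \<union> set p)" using pkI[OF F'(1)] F'(2,3) cardF by simp
  moreover have "hd p \<in> set p" using p(3) by simp
  then have "vs F \<noteq> vs F \<union> set p" using d by blast
  ultimately show False using no_larger_family[of "vs F \<union> set p"] by blast
qed

lemma card_preN: "card preN = card N" "preN \<subseteq> vs F" "preN \<inter> N = {}"
proof -
  obtain f where f: "bij_betw f (vs F) (vs F)" "astep F = {(x, f x) | x. x \<in> vs F}"
    "\<forall>c\<in>F. bij_betw f (set c) (set c)" "\<forall>c\<in>F. csteps c = {(x, f x) | x. x \<in> set c}"
    by (rule fam_succ[OF famF])
  show "preN \<subseteq> vs F" using astep_in_vs by (auto simp: preN_def)
  show "preN \<inter> N = {}" using N_no_step by (auto simp: preN_def)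
  have "preN = {x \<in> vs F. f x \<in> N}" using f(2) by (auto simp: preN_def)
  moreover have "f ` {x \<in> vs F. f x \<in> N} = N"
  proof
    show "N \<subseteq> f ` {x \<in> vs F. f x \<in> N}"
    proof
      fix y assume y: "y \<in> N"
      then have "y \<in> f ` vs F" using Nsub bij_betw_imp_surj_on[OF f(1)] by blast
      then show "y \<in> f ` {x \<in> vs F. f x \<in> N}" using y by blast
    qed
  qed auto
  moreover have "inj_on f {x \<in> vs F. f x \<in> N}"
    by (rule inj_on_subset[OF bij_betw_imp_inj_on[OF f(1)]]) auto
  ultimately show "card preN = card N" using card_image by metis
qed

text \<open>\<open>N\<close> and \<open>preN\<close> are disjoint and equinumerous, so
  \<open>E\<close> is the number of vertices on the cycles outside both.\<close>

lemma card_free: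
  assumes "I \<subseteq> vs F" shows "card (I - N - preN) + 2 * card N \<le> card (vs F)"
proof -
  have fin: "finite I" "finite preN" using assms card_preN(2) finvs finite_subset by blast+
  have "card (I - N - preN) + card N + card preN = card ((I - N - preN) \<union> N \<union> preN)"
    using fin finN card_preN(3) by (subst card_Un_disjoint; (subst card_Un_disjoint)?) auto
  also have "\<dots> \<le> card (vs F)" using assms Nsub card_preN(2) finvs by (intro card_mono) auto
  finally show ?thesis using card_preN(1) by simp
qed

lemma cardvs: "card (vs F) = 2 * card N + E"
  using card_free[of "{}"] by (simp add: E_def)

lemma card_free': "I \<subseteq> vs F \<Longrightarrow> card (I - N - preN) \<le> E"
  using card_free cardvs by fastforce

lemma dgF_N: "w \<in> W \<Longrightarrow> dg (vs F) w = card N - card {u \<in> N. \<not> adj w u} \<and> card {u \<in> N. \<not> adj w u} \<le> card N"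
proof -
  assume w: "w \<in> W"
  have "nb (vs F) w = N - {u \<in> N. \<not> adj w u}" using w adj_sym by (auto simp: nb_def N_def)
  then show ?thesis using finN by (auto simp: dg_def card_Diff_subset intro: card_mono)
qed

lemma dgW_big: "w \<in> W \<Longrightarrow> card W + E \<le> 2 * dg W w"
proof -
  assume w: "w \<in> W"
  have "card V \<le> 2 * deg w" using hiW[OF w] by (simp add: high_def)
  moreover have "deg w = dg (vs F) w + dg W w" using dg_split[OF vsV] .
  moreover have "dg (vs F) w \<le> card N" using dgF_N[OF w] by simp
  ultimately show ?thesis using cardV cardvs by linarith
qed

text \<open>A high vertex has at least \<open>n/2\<close> neighbours. Each vertex of
  \<open>N\<close> that it misses must be compensated inside \<open>W\<close>, where at most
  \<open>|W| - 1\<close> are available.\<close>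

lemma misses: "w \<in> W \<Longrightarrow> 2 * card {u \<in> N. \<not> adj w u} + E + 2 \<le> card W"
proof -
  assume w: "w \<in> W"
  have "card V \<le> 2 * deg w" using hiW[OF w] by (simp add: high_def)
  moreover have "deg w = dg (vs F) w + dg W w" using dg_split[OF vsV] .
  moreover have "dg W w + 1 \<le> card W" using dg_less_card[OF finW w] by simp
  moreover have "dg (vs F) w + card {u \<in> N. \<not> adj w u} = card N" using dgF_N[OF w] by simp
  ultimately show ?thesis using cardV cardvs by linarith
qed

lemma E_le: "E + 2 \<le> card W"
  using misses Wne by (meson add_leD2 ex_in_conv le_trans add_le_mono le_add2 add.assoc order_refl)

text \<open>
  The bound on the length leaves room for reinserting two segments of a cycle that are replaced by
  the detour \<open>p\<close> through \<open>W\<close>.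
\<close>

definition link_path :: "'a \<Rightarrow> 'a \<Rightarrow> 'a list \<Rightarrow> bool" where
  "link_path u z p \<longleftrightarrow> pth p \<and> set p \<subseteq> W \<and> p \<noteq> [] \<and> adj u (hd p) \<and> adj (last p) z \<and> E + 2 * length p \<le> card W"

text \<open>Take a shortest detour; it has at most three vertices. If it has two, its first vertex
  misses \<open>z\<close>; if it has three, the middle one misses \<open>u\<close> and
  \<open>z\<close>. Each miss raises the lower bound on \<open>|W|\<close> by 2 and so pays for the
  additional vertex.\<close>

lemma link_ex:
  assumes "u \<in> N" "z \<in> N"
  obtains p where "link_path u z p"
proof -
  have one: "2 + E + 2 \<le> card W" if w: "w \<in> W" and x: "x \<in> N" "\<not> adj w x" for w x
  proof -
    have "1 \<le> card {u \<in> N. \<not> adj w u}" using x finN by (simp add: Suc_le_eq card_gt_0_iff) blast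
    then show ?thesis using misses[OF w] by linarith
  qed
  show thesis
  proof (cases "\<exists>w\<in>W. adj u w \<and> adj w z")
    case True
    then obtain w where "w \<in> W" "adj u w" "adj w z" by blast
    then show thesis using that[of "[w]"] E_le by (simp add: link_path_def)
  next
    case no1: False
    show thesis
    proof (cases "\<exists>w\<in>W. \<exists>w'\<in>W. adj u w \<and> adj w w' \<and> adj w' z")
      case True
      then obtain w w' where w: "w \<in> W" "w' \<in> W" "adj u w" "adj w w'" "adj w' z" by blast
      then have "\<not> adj w z" using no1 by blast
      then have "2 + E + 2 \<le> card W" using one w(1) assms(2) by blast
      then show thesis using that[of "[w, w']"] w adj_neq by (simp add: link_path_def)
    next
      case no2: False
      obtain w w' where w: "w \<in> W" "adj u w" "w' \<in> W" "adj z w'" using assms by (auto simp: N_def)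
      have ne: "w \<noteq> w'" "\<not> adj w w'" using no1 no2 w adj_sym by blast+
      then obtain x where x: "x \<in> W" "adj w x" "adj w' x" using W_common w by metis
      have nx: "\<not> adj x u" "\<not> adj x z" using no2 x w adj_sym by blast+
      have "u \<noteq> z" using no1 w adj_sym by blast
      have "card {u, z} \<le> card {y \<in> N. \<not> adj x y}" using nx assms finN by (intro card_mono) auto
      then have "4 + E + 2 \<le> card W" using misses[OF x(1)] \<open>u \<noteq> z\<close> by simp
      then show thesis using that[of "[w, x, w']"] w x ne adj_sym adj_neq by (auto simp: link_path_def)
    qed
  qed
qed

text \<open>Insert greedily. A vertex of \<open>I\<close> left over has no neighbour in
  \<open>W\<close>, sees at most half of the covered vertices, and otherwise only vertices left over
  or given up. By the last hypothesis its degree would be less than \<open>n/2\<close>.\<close>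

lemma absorb:
  assumes "fam G0" "I \<subseteq> vs F" "I \<inter> vs G0 = {}" "\<forall>v\<in>I. high v \<and> v \<notin> N"
    "card I + card (vs G0 \<inter> W) + card (vs F - vs G0 - I) \<le> card W + 1"
  shows "pk (card G0) (vs G0 \<union> I)"
proof -
  have IV: "I \<subseteq> V" using assms(2) vsV by blast
  obtain F1 where F1: "fam F1" "card F1 = card G0" "vs G0 \<subseteq> vs F1" "vs F1 \<subseteq> vs G0 \<union> I"
    "\<And>v. v \<in> I - vs F1 \<Longrightarrow> \<not> ins F1 v" by (rule absorb_greedy[OF assms(1) IV assms(3)]) blast
  \<comment> \<open>\<open>R\<close> is what could not be inserted; \<open>Ot\<close> is the part of
    the old cycles that nobody tries to reinsert.\<close>
  define R where "R = I - vs F1"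
  define Ot where "Ot = vs F - vs G0 - I"
  have fin: "finite R" "finite I" "finite Ot" "finite (vs F1)" "finite (vs G0)"
    using IV finV finvs fam_finite_vs[OF F1(1)] fam_finite_vs[OF assms(1)] finite_subset by (auto simp: R_def Ot_def)
  have "R = {}"
  proof (rule ccontr)
    assume "R \<noteq> {}"
    then obtain v where v: "v \<in> R" by blast
    have vI: "v \<in> I" "v \<notin> vs F1" using v by (auto simp: R_def)
    have nW: "\<not> adj v w" if "w \<in> W" for w using that assms(2,4) vI(1) by (auto simp: N_def)
    have "V = vs F1 \<union> (W - vs F1) \<union> R \<union> (Ot - vs F1)"
      using F1(3,4) IV vsV fam_V[OF F1(1)] by (auto simp: R_def Ot_def)
    then have "nb V v \<subseteq> nb (vs F1) v \<union> (R - {v}) \<union> Ot" using nW adj_irrefl by (auto simp: nb_def)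
    then have "deg v \<le> card (nb (vs F1) v \<union> (R - {v}) \<union> Ot)" unfolding dg_def using fin by (intro card_mono) auto
    also have "\<dots> \<le> card (nb (vs F1) v \<union> (R - {v})) + card Ot" by (rule card_Un_le)
    also have "\<dots> \<le> dg (vs F1) v + (card R - 1) + card Ot"
      using card_Un_le[of "nb (vs F1) v" "R - {v}"] v fin(1) by (simp add: dg_def)
    finally have d: "deg v \<le> dg (vs F1) v + (card R - 1) + card Ot" .
    have R1: "1 \<le> card R" using v fin(1) by (simp add: Suc_le_eq card_gt_0_iff) blast
    have half: "2 * dg (vs F1) v \<le> card (vs F1)" using not_ins_dg[OF F1(1) F1(5)] v by (simp add: R_def)
    have h: "card V \<le> 2 * deg v" using assms(4) vI by (simp add: high_def)
    have a: "card (vs F1) + card R = card (vs G0) + card I"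
    proof -
      have "vs F1 \<union> R = vs G0 \<union> I" "vs F1 \<inter> R = {}" using F1(3,4) by (auto simp: R_def)
      then show ?thesis
        using card_Un_disjoint[of "vs F1" R] card_Un_disjoint[of "vs G0" I] fin assms(3) by (simp add: Int_commute)
    qed
    have b: "card (vs G0) + card I + card Ot + card (W - vs G0) = card V"
    proof -
      have eq: "V = vs G0 \<union> I \<union> Ot \<union> (W - vs G0)" using IV vsV fam_V[OF assms(1)] by (auto simp: Ot_def)
      have "card (vs G0 \<union> I \<union> Ot \<union> (W - vs G0)) = card (vs G0 \<union> I \<union> Ot) + card (W - vs G0)"
        using fin finW assms(2) by (intro card_Un_disjoint) (auto simp: Ot_def)
      also have "card (vs G0 \<union> I \<union> Ot) = card (vs G0 \<union> I) + card Ot"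
        using fin by (intro card_Un_disjoint) (auto simp: Ot_def)
      also have "card (vs G0 \<union> I) = card (vs G0) + card I" using fin assms(3) by (intro card_Un_disjoint) auto
      finally show ?thesis using eq by simp
    qed
    have c: "card (W - vs G0) + card (vs G0 \<inter> W) = card W"
      using finW card_Diff_subset_Int[of W "vs G0"] card_mono[OF finW, of "W \<inter> vs G0"] by (simp add: Int_commute)
    have RI: "card R \<le> card I" using fin by (intro card_mono) (auto simp: R_def)
    show False using d R1 half h a b c RI assms(5) unfolding Ot_def[symmetric] by linarith
  qed
  then have "vs F1 = vs G0 \<union> I" using F1(3,4) by (auto simp: R_def)
  then show ?thesis using pkI[OF F1(1)] F1(2) by simp
qed

text \<open>Every vertex of the segment except its last is followed by a vertex of the segment,
  hence by one outside \<open>N\<close>.\<close>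

lemma seg_preN:
  assumes "c \<in> F" "rot c (I @ Q)" "set I \<inter> N = {}"
  shows "card (set I \<inter> preN) \<le> 1"
proof (cases I rule: rev_cases)
  case (snoc I' l)
  obtain f where f: "bij_betw f (vs F) (vs F)" "astep F = {(x, f x) | x. x \<in> vs F}"
    "\<forall>c\<in>F. bij_betw f (set c) (set c)" "\<forall>c\<in>F. csteps c = {(x, f x) | x. x \<in> set c}"
    by (rule fam_succ[OF famF])
  have "x = l" if x: "x \<in> set I" "x \<in> preN" for x
  proof (rule ccontr)
    assume "x \<noteq> l"
    then have "x \<in> set I'" using x snoc by auto
    then obtain b where b: "(x, b) \<in> steps I" using steps_snoc_cover[of x I' l] snoc by auto
    have "steps I \<subseteq> csteps c"
      using steps_append_subset(1)[of I Q] rot_props(4)[OF assms(2)] csteps_eq[of "I @ Q"] snoc by auto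
    then have "(x, b) \<in> astep F" using b assms(1) by (auto simp: astep_def)
    then have "b = f x" using f(2) by auto
    moreover obtain y where "y \<in> N" "(x, y) \<in> astep F" using x(2) by (auto simp: preN_def)
    moreover from this have "y = f x" using f(2) by auto
    ultimately show False using b steps_in_set assms(3) by (metis disjoint_iff)
  qed
  then have "set I \<inter> preN \<subseteq> {l}" by blast
  then show ?thesis using card_mono[of "{l}" "set I \<inter> preN"] by simp
qed simp

definition seg :: "'a list \<Rightarrow> bool" where
  "seg I \<longleftrightarrow> (\<exists>c\<in>F. \<exists>Q. rot c (I @ Q)) \<and> (\<forall>z\<in>set I. high z \<and> z \<notin> N)"

lemma seg_sub: "seg I \<Longrightarrow> set I \<subseteq> vs F"
  unfolding seg_def using rot_props(1) set_sub_vs by fastforce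

text \<open>Each segment has at most one vertex in \<open>preN\<close>, and all others are among the
  \<open>E\<close> vertices outside \<open>N\<close> and \<open>preN\<close>.\<close>

lemma two_segs: "seg I \<Longrightarrow> seg J \<Longrightarrow> card (set I \<union> set J) \<le> E + 2"
proof -
  assume s: "seg I" "seg J"
  then have p: "card (set I \<inter> preN) \<le> 1" "card (set J \<inter> preN) \<le> 1"
    using seg_preN unfolding seg_def by (metis disjoint_iff)+
  have n: "(set I \<union> set J) \<inter> N = {}" using s by (auto simp: seg_def)
  have "set I \<union> set J = ((set I \<union> set J) - N - preN) \<union> ((set I \<inter> preN) \<union> (set J \<inter> preN))" using n by auto
  then have "card (set I \<union> set J) \<le> card ((set I \<union> set J) - N - preN) + card ((set I \<inter> preN) \<union> (set J \<inter> preN))"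
    by (metis card_Un_le)
  moreover have "card ((set I \<inter> preN) \<union> (set J \<inter> preN)) \<le> 2"
    using card_Un_le[of "set I \<inter> preN" "set J \<inter> preN"] p by linarith
  moreover have "card ((set I \<union> set J) - N - preN) \<le> E" using card_free' seg_sub[OF s(1)] seg_sub[OF s(2)] by blast
  ultimately show ?thesis by linarith
qed

text \<open>The count required by \<open>absorb\<close> is \<open>E + 2 + |p| <= |W| + 1\<close>. It
  follows from \<open>E + 2|p| <= |W|\<close> because \<open>p\<close> is nonempty.\<close>

lemma absorb_segs:
  assumes "fam G0" "seg I" "seg J" "link_path u z p" "vs G0 = (vs F - (set I \<union> set J)) \<union> set p"
  shows "pk (card G0) (vs F \<union> set p)"
proof -
  have p: "pth p" "set p \<subseteq> W" "p \<noteq> []" "E + 2 * length p \<le> card W" using assms(4) by (auto simp: link_path_def)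
  have sub: "set I \<union> set J \<subseteq> vs F" using seg_sub assms(2,3) by blast
  have e1: "vs G0 \<inter> W = set p" and e2: "vs F - vs G0 - (set I \<union> set J) = {}" using assms(5) p(2) by auto
  have "card (set p) = length p" using p(1) by (simp add: pth_def distinct_card)
  moreover have "1 \<le> length p" using p(3) by (simp add: Suc_le_eq)
  ultimately have "card (set I \<union> set J) + card (vs G0 \<inter> W) + card (vs F - vs G0 - (set I \<union> set J)) \<le> card W + 1"
    unfolding e1 e2 using two_segs[OF assms(2,3)] p(4) by simp
  moreover have "(set I \<union> set J) \<inter> vs G0 = {}" using assms(5) sub p(2) by auto
  moreover have "\<forall>v\<in>set I \<union> set J. high v \<and> v \<notin> N" using assms(2,3) by (auto simp: seg_def)
  ultimately have "pk (card G0) (vs G0 \<union> (set I \<union> set J))" using absorb[OF assms(1) sub] by blast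
  moreover have "vs G0 \<union> (set I \<union> set J) = vs F \<union> set p" using assms(5) sub by auto
  ultimately show ?thesis by simp
qed

lemma lnk_grow: "link_path u z p \<Longrightarrow> vs F \<noteq> vs F \<union> set p"
  unfolding link_path_def by (metis Diff_iff Un_iff hd_in_set subsetD)

text \<open>The common end of all exchanges inside one cycle: the skipped segments are reinserted,
  and the detour \<open>p\<close> remains as pure gain.\<close>

lemma close_up:
  assumes "c \<in> F" "cyc c'" "seg I" "seg J" "link_path u z p" "set I \<union> set J \<subseteq> set c"
    "set c' = (set c - (set I \<union> set J)) \<union> set p"
  shows False
proof -
  have pW: "set p \<subseteq> W" using assms(5) by (simp add: link_path_def)
  have dis: "set c' \<inter> (vs F - set c) = {}" using assms(7) pW by auto
  note rp = fam_replace[OF famF assms(1,2) dis]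
  have "vs (insert c' (F - {c})) = (vs F - (set I \<union> set J)) \<union> set p"
    unfolding rp(3) using assms(6,7) set_sub_vs[OF assms(1)] pW famF assms(1) by auto
  then have "pk k (vs F \<union> set p)" using absorb_segs[OF rp(1) assms(3-5)] rp(2) cardF by simp
  from no_larger_family[OF this _ lnk_grow[OF assms(5)]] show False by blast
qed

lemma segI: "c \<in> F \<Longrightarrow> rot c (xs @ I @ ys) \<Longrightarrow> \<forall>z\<in>set I. high z \<and> z \<notin> N \<Longrightarrow> seg I"
  unfolding seg_def using rot_append[of c xs "I @ ys"] by auto

lemma seg_Nil: "c \<in> F \<Longrightarrow> seg []"
  unfolding seg_def using rot_refl by auto

lemma low_between:
  assumes "c \<in> F" "rot c (u # A @ v # B)" "u \<in> N" "v \<in> N" "set A \<inter> N = {}"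
  shows "\<exists>y\<in>set A. \<not> high y"
proof (rule ccontr)
  assume a: "\<not> ?thesis"
  have cc: "cyc c" using cycF assms(1) by blast
  have sc: "set (u # A @ v # B) = set c" using rot_props(1)[OF assms(2)] .
  have d: "distinct (u # A @ v # B)" using rot_props(3)[OF assms(2)] cc by (simp add: cyc_def)
  obtain p where p: "link_path u v p" using link_ex[OF assms(3,4)] by blast
  have p': "pth p" "set p \<subseteq> W" "p \<noteq> []" "adj u (hd p)" "adj (last p) v" using p by (auto simp: link_path_def)
  have "rot c ((v # B) @ (u # A))" using rot_append[of c "u # A" "v # B"] assms(2) by simp
  then have s: "pth (v # B @ [u])" using rot_pth[OF cc, of "[]" "v # B @ [u]" A] by simp
  have "1 \<le> length p" using p'(3) by (simp add: Suc_le_eq)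
  then have cy: "cyc ((v # B @ [u]) @ p)" using s p' outW[OF assms(1)] sc by (intro link_paths) auto
  have sA: "seg A" using segI[OF assms(1), of "[u]" A "v # B"] assms(2,5) a by auto
  have "set ((v # B @ [u]) @ p) = (set c - (set A \<union> set [])) \<union> set p" using sc d by auto
  moreover have "set A \<union> set [] \<subseteq> set c" using sc by auto
  ultimately show False using close_up[OF assms(1) cy sA seg_Nil[OF assms(1)] p] by blast
qed

text \<open>The crossing exchange: along the arc from \<open>y\<close> to \<open>v\<close>, through
  \<open>W\<close> to \<open>u\<close>, backwards to \<open>x\<close>, and home along the edge. The
  skipped stretches \<open>I\<close> and \<open>J\<close> are high.\<close>

lemma first_lows_nonadj:
  assumes "c \<in> F" "rot c (u # I @ y # A @ v # J @ x # B)" "u \<in> N" "v \<in> N"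
    "\<forall>z\<in>set I \<union> set J. high z \<and> z \<notin> N" "y \<notin> N" "x \<notin> N"
  shows "\<not> adj y x"
proof
  assume yx: "adj y x"
  have cc: "cyc c" using cycF assms(1) by blast
  have sc: "set (u # I @ y # A @ v # J @ x # B) = set c" using rot_props(1)[OF assms(2)] .
  have d: "distinct (u # I @ y # A @ v # J @ x # B)" using rot_props(3)[OF assms(2)] cc by (simp add: cyc_def)
  obtain p where p: "link_path v u p" using link_ex[OF assms(4,3)] by blast
  have p': "pth p" "set p \<subseteq> W" "p \<noteq> []" "adj v (hd p)" "adj (last p) u" using p by (auto simp: link_path_def)
  have s1: "pth (y # A @ [v])" using rot_pth[OF cc, of "u # I" "y # A @ [v]" "J @ x # B"] assms(2) by simp
  have "rot c ((x # B) @ (u # I @ y # A @ v # J))" using rot_append[of c "u # I @ y # A @ v # J" "x # B"] assms(2) by simp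
  then have s2: "pth (x # B @ [u])" using rot_pth[OF cc, of "[]" "x # B @ [u]" "I @ y # A @ v # J"] by simp
  have s2': "pth (rev (x # B @ [u]))" using s2 by (simp only: pth_rev)
  have cy: "cyc ((y # A @ [v]) @ p @ rev (x # B @ [u]))"
  proof (rule link_three[OF s1 p'(1) s2'])
    show "set (y # A @ [v]) \<inter> set p = {}" using outW[OF assms(1)] sc p'(2) by auto
    show "set (y # A @ [v]) \<inter> set (rev (x # B @ [u])) = {}" using d by auto
    show "set p \<inter> set (rev (x # B @ [u])) = {}" using outW[OF assms(1)] sc p'(2) by auto
  qed (use p' yx adj_sym in auto)
  have sI: "seg I" using segI[OF assms(1), of "[u]" I "y # A @ v # J @ x # B"] assms(2,5) by auto
  have sJ: "seg J" using segI[OF assms(1), of "u # I @ y # A @ [v]" J "x # B"] assms(2,5) by auto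
  have "set ((y # A @ [v]) @ p @ rev (x # B @ [u])) = (set c - (set I \<union> set J)) \<union> set p" using sc d by auto
  moreover have "set I \<union> set J \<subseteq> set c" using sc by auto
  ultimately show False using close_up[OF assms(1) cy sI sJ p] by blast
qed

text \<open>A crossing exchange with the successor \<open>z'\<close> of \<open>z\<close>: from
  \<open>z'\<close> on to \<open>u\<close>, through \<open>W\<close> to \<open>z\<close>, backwards
  to \<open>y\<close>. Only \<open>I\<close> is skipped. This feeds the count of neighbours of
  \<open>y\<close> on \<open>c\<close>.\<close>

lemma succ_nonadj:
  assumes "c \<in> F" "rot c (u # I @ y # A @ z # z' # B)" "u \<in> N" "z \<in> N"
    "\<forall>x\<in>set I. high x \<and> x \<notin> N"
  shows "\<not> adj y z'"
proof
  assume yz: "adj y z'"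
  have cc: "cyc c" using cycF assms(1) by blast
  have sc: "set (u # I @ y # A @ z # z' # B) = set c" using rot_props(1)[OF assms(2)] .
  have d: "distinct (u # I @ y # A @ z # z' # B)" using rot_props(3)[OF assms(2)] cc by (simp add: cyc_def)
  obtain p where p: "link_path u z p" using link_ex[OF assms(3,4)] by blast
  have p': "pth p" "set p \<subseteq> W" "p \<noteq> []" "adj u (hd p)" "adj (last p) z" using p by (auto simp: link_path_def)
  have s2: "pth (y # A @ [z])" using rot_pth[OF cc, of "u # I" "y # A @ [z]" "z' # B"] assms(2) by simp
  have "rot c ((z' # B) @ (u # I @ y # A @ [z]))" using rot_append[of c "u # I @ y # A @ [z]" "z' # B"] assms(2) by simp
  then have s1: "pth (z' # B @ [u])" using rot_pth[OF cc, of "[]" "z' # B @ [u]" "I @ y # A @ [z]"] by simp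
  have s2': "pth (rev (y # A @ [z]))" using s2 by (simp only: pth_rev)
  have cy: "cyc ((z' # B @ [u]) @ p @ rev (y # A @ [z]))"
  proof (rule link_three[OF s1 p'(1) s2'])
    show "set (z' # B @ [u]) \<inter> set p = {}" using outW[OF assms(1)] sc p'(2) by auto
    show "set (z' # B @ [u]) \<inter> set (rev (y # A @ [z])) = {}" using d by auto
    show "set p \<inter> set (rev (y # A @ [z])) = {}" using outW[OF assms(1)] sc p'(2) by auto
  qed (use p' yz adj_sym in auto)
  have sI: "seg I" using segI[OF assms(1), of "[u]" I "y # A @ z # z' # B"] assms(2,5) by auto
  have "set ((z' # B @ [u]) @ p @ rev (y # A @ [z])) = (set c - (set I \<union> set [])) \<union> set p" using sc d by auto
  moreover have "set I \<union> set [] \<subseteq> set c" using sc by auto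
  ultimately show False using close_up[OF assms(1) cy sI seg_Nil[OF assms(1)] p] by blast
qed

end

section \<open>Insertable low vertices, and the contradiction for a maximal cover\<close>

context max_cover
begin

lemma deg_split_cycle: "c \<in> F \<Longrightarrow> deg x = dg W x + dg (set c) x + dg (vs (F - {c})) x"
  using dg_split[OF vsV, of x] dg_split[OF set_sub_vs, of c F x] vs_Diff[OF famF] by simp

lemma card_vs_split: "c \<in> F \<Longrightarrow> card (vs F) = card (set c) + card (vs (F - {c}))"
  using vs_Diff[OF famF] set_sub_vs finvs
  by (metis card_Diff_subset card_mono finite_set le_add_diff_inverse)

text \<open>On \<open>c\<close>, the neighbours of \<open>w\<close> lie in \<open>N\<close>, and
  \<open>y\<close> misses as many vertices as \<open>N\<close> has there, so both together account
  for at most \<open>|c|\<close>. On the other cycles neither is insertable and each sees at most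
  half. In \<open>W\<close>, only \<open>w\<close> has neighbours, fewer than
  \<open>|W|\<close>.\<close>

lemma deg_sum_small:
  assumes "c \<in> F" "rot c (u # I @ y # R)" "u \<in> N" "\<forall>x\<in>set I. high x \<and> x \<notin> N" "y \<notin> N"
    "\<not> ins (F - {c}) y" "w \<in> W"
  shows "deg w + deg y < card V"
proof -
  have cc: "cyc c" using cycF assms(1) by blast
  have sc: "set (u # I @ y # R) = set c" using rot_props(1)[OF assms(2)] .
  have d: "distinct (u # I @ y # R)" using rot_props(3)[OF assms(2)] cc by (simp add: cyc_def)
  obtain f where f: "bij_betw f (vs F) (vs F)" "astep F = {(x, f x) | x. x \<in> vs F}"
    "\<forall>c\<in>F. bij_betw f (set c) (set c)" "\<forall>c\<in>F. csteps c = {(x, f x) | x. x \<in> set c}"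
    by (rule fam_succ[OF famF])
  define M where "M = N \<inter> set c"
  have finM: "finite M" by (simp add: M_def)
  have yc: "y \<in> set c" using sc by auto
  have uM: "u \<in> M" using assms(3) sc by (auto simp: M_def)
  have cs: "csteps c = csteps (u # I @ y # R)" using rot_props(4)[OF assms(2)] by simp
  have key: "f z \<noteq> y \<and> \<not> adj y (f z)" if z: "z \<in> M" "z \<noteq> u" for z
  proof -
    have "z \<in> set (u # I @ y # R)" "z \<in> N" using z(1) sc by (auto simp: M_def)
    then have "z \<in> set R" using z(2) assms(4,5) by auto
    then obtain A B' where R: "R = A @ z # B'" using split_list by metis
    show ?thesis
    proof (cases B')
      case Nil
      have "(z, u) \<in> csteps c" unfolding cs R Nil by (simp add: csteps_eq)
      then have "(z, u) \<in> astep F" using assms(1) by (auto simp: astep_def)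
      then show ?thesis using N_no_step \<open>z \<in> N\<close> assms(3) by blast
    next
      case (Cons z' B)
      have "(z, z') \<in> steps (z # z' # B)" by simp
      then have "(z, z') \<in> steps ((u # I @ y # A) @ z # z' # B)" using steps_append_subset(2) by blast
      then have "(z, z') \<in> csteps c" unfolding cs R Cons by (simp add: csteps_eq)
      then have "z' = f z" using f(4) assms(1) by auto
      moreover have "\<not> adj y z'"
        using succ_nonadj[OF assms(1) _ assms(3) \<open>z \<in> N\<close> assms(4), of y A z' B] assms(2) R Cons by simp
      moreover have "z' \<noteq> y" using d R Cons by auto
      ultimately show ?thesis by simp
    qed
  qed
  have "\<forall>z\<in>M. z \<noteq> u \<longrightarrow> f z \<noteq> y \<and> \<not> adj y (f z)" using key by blast
  moreover have "bij_betw f (set c) (set c)" using f(3) assms(1) by blast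
  moreover have "M \<subseteq> set c" by (simp add: M_def)
  ultimately have y1: "dg (set c) y + card M \<le> card (set c)" using succ_count uM yc by blast
  have "nb (set c) w \<subseteq> M"
  proof
    fix x assume "x \<in> nb (set c) w"
    then have x: "x \<in> set c" "adj x w" using adj_sym by (auto simp: nb_def)
    then have "x \<in> vs F" using set_sub_vs[OF assms(1)] by blast
    then show "x \<in> M" using x assms(7) unfolding M_def N_def by blast
  qed
  then have w1: "dg (set c) w \<le> card M" unfolding dg_def using finM by (intro card_mono)
  have fd: "fam (F - {c})" using fam_Diff famF by blast
  have nw: "\<not> ins (F - {c}) w" using noins[OF assms(7)] ins_mono[of "F - {c}" w F] by blast
  have "2 * dg (vs (F - {c})) w \<le> card (vs (F - {c}))" "2 * dg (vs (F - {c})) y \<le> card (vs (F - {c}))"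
    using not_ins_dg[OF fd nw] not_ins_dg[OF fd assms(6)] .
  moreover have "dg W y = 0" using assms(1,5) yc set_sub_vs by (intro dg_0) (auto simp: N_def)
  moreover have "dg W w < card W" using dg_less_card[OF finW assms(7)] .
  ultimately show ?thesis
    using y1 w1 deg_split_cycle[OF assms(1), of w] deg_split_cycle[OF assms(1), of y] card_vs_split[OF assms(1)] cardV by linarith
qed

lemma independent_first_lows:
  assumes "c \<in> F" "2 \<le> card (N \<inter> set c)"
  obtains Y where "Y \<subseteq> set c - N" "card Y = card (N \<inter> set c)" "\<forall>y\<in>Y. \<not> high y" "\<forall>y\<in>Y. \<forall>x\<in>Y. \<not> adj y x"
    "\<forall>y\<in>Y. \<exists>u\<in>N. \<exists>I R. rot c (u # I @ y # R) \<and> (\<forall>z\<in>set I. high z \<and> z \<notin> N)"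
proof -
  have cc: "cyc c" using cycF assms(1) by blast
  have sub: "N \<inter> set c \<subseteq> set c" by blast
  have P1: "\<forall>u v A B. rot c (u # A @ v # B) \<longrightarrow> u \<in> N \<inter> set c \<longrightarrow> v \<in> N \<inter> set c \<longrightarrow> set A \<inter> (N \<inter> set c) = {} \<longrightarrow> (\<exists>y\<in>set A. \<not> high y)"
  proof (intro allI impI)
    fix u v A B assume a: "rot c (u # A @ v # B)" "u \<in> N \<inter> set c" "v \<in> N \<inter> set c" "set A \<inter> (N \<inter> set c) = {}"
    have "set A \<subseteq> set c" using rot_props(1)[OF a(1)] by auto
    then have "set A \<inter> N = {}" using a(4) by blast
    then show "\<exists>y\<in>set A. \<not> high y" using low_between[OF assms(1) a(1)] a(2,3) by blast
  qed
  have P2: "\<forall>u v x y I A J B. rot c (u # I @ y # A @ v # J @ x # B) \<longrightarrow> u \<in> N \<inter> set c \<longrightarrow> v \<in> N \<inter> set c \<longrightarrow>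
      (\<forall>z\<in>set I \<union> set J. high z \<and> z \<notin> N \<inter> set c) \<longrightarrow> y \<notin> N \<inter> set c \<longrightarrow> x \<notin> N \<inter> set c \<longrightarrow> \<not> adj y x"
  proof (intro allI impI)
    fix u v x y I A J B
    assume a: "rot c (u # I @ y # A @ v # J @ x # B)" "u \<in> N \<inter> set c" "v \<in> N \<inter> set c"
      "\<forall>z\<in>set I \<union> set J. high z \<and> z \<notin> N \<inter> set c" "y \<notin> N \<inter> set c" "x \<notin> N \<inter> set c"
    have sc: "set (u # I @ y # A @ v # J @ x # B) = set c" using rot_props(1)[OF a(1)] .
    have "\<forall>z\<in>set I \<union> set J. high z \<and> z \<notin> N" using a(4) sc by auto
    moreover have "y \<notin> N" "x \<notin> N" using a(5,6) sc by auto
    ultimately show "\<not> adj y x" using first_lows_nonadj[OF assms(1) a(1)] a(2,3) by blast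
  qed
  obtain Y where Y: "Y \<subseteq> set c - N \<inter> set c" "card Y = card (N \<inter> set c)" "\<forall>y\<in>Y. \<not> high y" "\<forall>y\<in>Y. \<forall>x\<in>Y. \<not> adj y x"
    "\<forall>y\<in>Y. \<exists>u\<in>N \<inter> set c. \<exists>I R. rot c (u # I @ y # R) \<and> (\<forall>z\<in>set I. high z \<and> z \<notin> N \<inter> set c)"
    using first_low_set[OF cc sub assms(2) P1 P2] by blast
  have "\<exists>u\<in>N. \<exists>I R. rot c (u # I @ y # R) \<and> (\<forall>z\<in>set I. high z \<and> z \<notin> N)" if yY: "y \<in> Y" for y
  proof -
    obtain u I R where u: "u \<in> N \<inter> set c" "rot c (u # I @ y # R)" "\<forall>z\<in>set I. high z \<and> z \<notin> N \<inter> set c"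
      using Y(5) yY by blast
    have "set I \<subseteq> set c" using rot_props(1)[OF u(2)] by auto
    then have "\<forall>z\<in>set I. high z \<and> z \<notin> N" using u(3) by blast
    then show ?thesis using u(1,2) by blast
  qed
  then show thesis using that[of Y] Y by blast
qed

text \<open>The first low vertices and a vertex \<open>w\<close> of \<open>W\<close> form an
  independent set of size \<open>r + 1\<close>. A pair with degree sum at least \<open>n\<close>
  must contain \<open>w\<close>, since two low vertices fall short, and then
  \<open>deg_sum_small\<close> makes the other one insertable.\<close>

lemma ins_low:
  assumes low: "\<forall>X. X \<subseteq> V \<longrightarrow> (\<forall>x\<in>X. \<not> high x) \<longrightarrow> (\<forall>x\<in>X. \<forall>y\<in>X. \<not> adj x y) \<longrightarrow> card X \<le> r"
    and pair: "\<forall>X. X \<subseteq> V \<longrightarrow> (\<forall>x\<in>X. \<forall>y\<in>X. \<not> adj x y) \<longrightarrow> card X = r + 1 \<longrightarrow>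
      (\<exists>x\<in>X. \<exists>y\<in>X. x \<noteq> y \<and> card V \<le> deg x + deg y)"
    and c: "c \<in> F" "2 \<le> card (N \<inter> set c)" "r \<le> card (N \<inter> set c)"
  shows "\<exists>u y I R. rot c (u # I @ y # R) \<and> u \<in> N \<and> (\<forall>z\<in>set I. high z \<and> z \<notin> N) \<and> \<not> high y \<and> y \<notin> N \<and> ins (F - {c}) y"
proof -
  obtain Y where Y: "Y \<subseteq> set c - N" "card Y = card (N \<inter> set c)" "\<forall>y\<in>Y. \<not> high y" "\<forall>y\<in>Y. \<forall>x\<in>Y. \<not> adj y x"
    "\<forall>y\<in>Y. \<exists>u\<in>N. \<exists>I R. rot c (u # I @ y # R) \<and> (\<forall>z\<in>set I. high z \<and> z \<notin> N)" by (rule independent_first_lows[OF c(1,2)])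
  have cV: "set c \<subseteq> V" using cyc_V[OF cycF[OF c(1)]] .
  then have "Y \<subseteq> V" using Y(1) by blast
  from low[THEN spec, THEN mp, THEN mp, THEN mp, OF this Y(3,4)] have "card Y \<le> r" .
  then have cY: "card Y = r" using c(3) Y(2) by simp
  obtain w where w: "w \<in> W" using Wne by blast
  have wY: "w \<notin> Y" using w Y(1) outW[OF c(1)] by blast
  have nw: "\<not> adj w y" if "y \<in> Y" for y
  proof
    assume "adj w y"
    then have "adj y w" by (rule adj_sym)
    moreover have "y \<in> vs F" "y \<notin> N" using that Y(1) set_sub_vs[OF c(1)] by blast+
    ultimately show False using w unfolding N_def by blast
  qed
  have finY: "finite Y" using Y(1) finite_subset by blast
  have X: "insert w Y \<subseteq> V" "card (insert w Y) = r + 1" using w Y(1) cV wY finY cY by auto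
  have X3: "\<forall>x\<in>insert w Y. \<forall>y\<in>insert w Y. \<not> adj x y" using Y(4) nw adj_sym adj_irrefl by blast
  from pair[THEN spec, THEN mp, THEN mp, THEN mp, OF X(1) X3 X(2)]
  obtain x y where xy: "x \<in> insert w Y" "y \<in> insert w Y" "x \<noteq> y" "card V \<le> deg x + deg y" by blast
  have "\<not> (x \<in> Y \<and> y \<in> Y)"
  proof
    assume "x \<in> Y \<and> y \<in> Y"
    then have "\<not> high x" "\<not> high y" using Y(3) by blast+
    then show False using xy(4) by (simp add: high_def)
  qed
  then obtain y where y: "y \<in> Y" "card V \<le> deg w + deg y" using xy by (auto simp: add.commute)
  obtain u I R where u: "u \<in> N" "rot c (u # I @ y # R)" "\<forall>z\<in>set I. high z \<and> z \<notin> N" using Y(5) y(1) by blast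
  have yN: "y \<notin> N" using Y(1) y(1) by blast
  have "ins (F - {c}) y"
  proof (rule ccontr)
    assume "\<not> ins (F - {c}) y"
    from deg_sum_small[OF c(1) u(2,1,3) yN this w] show False using y(2) by simp
  qed
  then show ?thesis using u yN Y(3) y(1) by blast
qed

text \<open>Part of the arc \<open>A\<close> has already moved to the other cycles, giving
  \<open>F1\<close>. What remains of \<open>c\<close> is closed by a detour, and the segments
  \<open>I\<close> and \<open>J\<close> are reinserted.\<close>

lemma replace_close:
  assumes "c \<in> F" "rot c (u # A @ v # B)" "u \<in> N" "v \<in> N" "seg I" "seg J" "set I \<union> set J \<subseteq> set A"
    "fam F1" "card F1 = card (F - {c})" "vs F1 = vs (F - {c}) \<union> (set A - (set I \<union> set J))"
  shows False
proof -
  have cc: "cyc c" using cycF assms(1) by blast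
  have sc: "set (u # A @ v # B) = set c" using rot_props(1)[OF assms(2)] .
  have d: "distinct (u # A @ v # B)" using rot_props(3)[OF assms(2)] cc by (simp add: cyc_def)
  obtain p where p: "link_path u v p" using link_ex[OF assms(3,4)] by blast
  have p': "pth p" "set p \<subseteq> W" "p \<noteq> []" "adj u (hd p)" "adj (last p) v" using p by (auto simp: link_path_def)
  have "rot c ((v # B) @ (u # A))" using rot_append[of c "u # A" "v # B"] assms(2) by simp
  then have s: "pth (v # B @ [u])" using rot_pth[OF cc, of "[]" "v # B @ [u]" A] by simp
  have "1 \<le> length p" using p'(3) by (simp add: Suc_le_eq)
  then have cy: "cyc ((v # B @ [u]) @ p)" using s p' outW[OF assms(1)] sc by (intro link_paths) auto
  have v1: "vs F1 = (vs F - set c) \<union> (set A - (set I \<union> set J))" using assms(10) vs_Diff[OF famF assms(1)] by simp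
  have cv: "set c \<subseteq> vs F" using set_sub_vs assms(1) by blast
  have "set ((v # B @ [u]) @ p) \<inter> vs F1 = {}" using v1 sc d p'(2) cv by auto
  note i = fam_insert[OF assms(8) cy this]
  have "vs (insert ((v # B @ [u]) @ p) F1) = (vs F - (set I \<union> set J)) \<union> set p"
  proof -
    have "set ((v # B @ [u]) @ p) = (set c - set A) \<union> set p" using sc d by auto
    then show ?thesis unfolding i(3) v1 using cv assms(7) sc by auto
  qed
  from absorb_segs[OF i(1) assms(5,6) p this]
  have "pk k (vs F \<union> set p)" using i(2) assms(9) fam_card_Diff[OF famF assms(1)] cardF by simp
  from no_larger_family[OF this _ lnk_grow[OF p]] show False by blast
qed

text \<open>An arc free of \<open>N\<close> has at most one vertex in \<open>preN\<close> and at
  most \<open>E\<close> others, hence at most two vertices. It contains the insertable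
  \<open>y\<close> and, after it, a further low vertex.\<close>

lemma two_segment:
  assumes low: "\<forall>X. X \<subseteq> V \<longrightarrow> (\<forall>x\<in>X. \<not> high x) \<longrightarrow> (\<forall>x\<in>X. \<forall>y\<in>X. \<not> adj x y) \<longrightarrow> card X \<le> r"
    and pair: "\<forall>X. X \<subseteq> V \<longrightarrow> (\<forall>x\<in>X. \<forall>y\<in>X. \<not> adj x y) \<longrightarrow> card X = r + 1 \<longrightarrow>
      (\<exists>x\<in>X. \<exists>y\<in>X. x \<noteq> y \<and> card V \<le> deg x + deg y)"
    and c: "c \<in> F" "2 \<le> card (N \<inter> set c)" "r \<le> card (N \<inter> set c)" and E1: "E \<le> 1"
  shows "\<exists>u y q v B. rot c (u # y # q # v # B) \<and> u \<in> N \<and> v \<in> N \<and> y \<notin> N \<and> q \<notin> N \<and> ins (F - {c}) y"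
proof -
  obtain u y I R where u: "rot c (u # I @ y # R)" "u \<in> N" "\<forall>z\<in>set I. high z \<and> z \<notin> N" "\<not> high y" "y \<notin> N" "ins (F - {c}) y"
    using ins_low[OF low pair c] by blast
  have cc: "cyc c" using cycF c(1) by blast
  have sc: "set (u # I @ y # R) = set c" using rot_props(1)[OF u(1)] .
  have d: "distinct (u # I @ y # R)" using rot_props(3)[OF u(1)] cc by (simp add: cyc_def)
  obtain v0 where v0: "v0 \<in> N \<inter> set c" "v0 \<noteq> u" using finite_sets_two[OF c(2)] by metis
  then have "v0 \<in> set R" using sc u(3,5) by auto
  then have "\<exists>x\<in>set R. x \<in> N" using v0(1) by blast
  then obtain A v B where R: "R = A @ v # B" "v \<in> N" "\<forall>x\<in>set A. x \<notin> N"
    using split_list_first_prop[of R "\<lambda>x. x \<in> N"] by blast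
  have r1: "rot c (u # (I @ y # A) @ v # B)" using u(1) R(1) by simp
  have sI: "seg I" using segI[OF c(1), of "[u]" I "y # R"] u(1,3) by simp
  \<comment> \<open>Otherwise \<open>y\<close> moves to another cycle, while the high stretches on
    both sides of it are skipped and reinserted.\<close>
  have "\<exists>q\<in>set A. \<not> high q"
  proof (rule ccontr)
    assume "\<not> ?thesis"
    then have sA: "seg A" using segI[OF c(1), of "u # I @ [y]" A "v # B"] r1 R(3) by simp
    have yc: "y \<notin> vs (F - {c})" using vs_Diff[OF famF c(1)] sc by auto
    have fd: "fam (F - {c})" using fam_Diff famF by blast
    obtain F1 where F1: "fam F1" "card F1 = card (F - {c})" "vs F1 = vs (F - {c}) \<union> set [y]"
    proof (rule path_insertion[OF fd])
      show "pth [y]" "set [y] \<inter> vs (F - {c}) = {}" using yc by auto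
      show "ins (F - {c}) z" if "z \<in> set [y]" for z using that u(6) by simp
    qed
    have "set (I @ y # A) - (set I \<union> set A) = set [y]" using d R(1) by auto
    then have "vs F1 = vs (F - {c}) \<union> (set (I @ y # A) - (set I \<union> set A))" using F1(3) by simp
    moreover have "set I \<union> set A \<subseteq> set (I @ y # A)" by auto
    ultimately show False using replace_close[OF c(1) r1 u(2) R(2) sI sA _ F1(1,2)] by blast
  qed
  then obtain q where q: "q \<in> set A" by blast
  have "length (I @ y # A) \<le> 2"
  proof -
    have "rot c ((I @ y # A) @ (v # B @ [u]))" using rot_append[of c "[u]" "(I @ y # A) @ v # B"] r1 by simp
    moreover have n: "set (I @ y # A) \<inter> N = {}" using u(3,5) R(3) by auto
    ultimately have "card (set (I @ y # A) \<inter> preN) \<le> 1" using seg_preN[OF c(1)] by blast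
    moreover have "card (set (I @ y # A) - N - preN) \<le> E"
      using sc R(1) set_sub_vs[OF c(1)] by (intro card_free') auto
    moreover have "card (set (I @ y # A)) \<le> card (set (I @ y # A) - N - preN) + card (set (I @ y # A) \<inter> preN)"
    proof -
      have "set (I @ y # A) = (set (I @ y # A) - N - preN) \<union> (set (I @ y # A) \<inter> preN)" using n by auto
      then show ?thesis by (metis card_Un_le)
    qed
    moreover have "card (set (I @ y # A)) = length (I @ y # A)" using d R(1) by (intro distinct_card) auto
    ultimately show ?thesis using E1 by linarith
  qed
  then have "length I + length A \<le> 1" by simp
  moreover have "1 \<le> length A" using q by (cases A) auto
  ultimately have "length I = 0" "length A = 1" by linarith+
  then have "I = []" "A = [q]" using q by (auto simp: length_Suc_conv)
  then show ?thesis using r1 u R by (intro exI[of _ u] exI[of _ y] exI[of _ q] exI[of _ v] exI[of _ B]) auto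
qed

text \<open>The hypotheses do not depend on the orientation of \<open>c\<close>, so statements about
  first low vertices also hold for last ones.\<close>

lemma max_cover_rev:
  assumes "c \<in> F"
  shows "max_cover V adj (insert (rev c) (F - {c})) k" "vs (insert (rev c) (F - {c})) = vs F"
proof -
  have cc: "cyc (rev c)" using cycF[OF assms] cyc_rev by blast
  have "set (rev c) \<inter> (vs F - set c) = {}" by auto
  note rp = fam_replace[OF famF assms cc this]
  show v: "vs (insert (rev c) (F - {c})) = vs F" unfolding rp(3) using set_sub_vs[OF assms] by auto
  show "max_cover V adj (insert (rev c) (F - {c})) k"
  proof (unfold_locales)
    show "fam (insert (rev c) (F - {c}))" "card (insert (rev c) (F - {c})) = k" using rp cardF by simp_all
    show "high w" if "w \<in> V - vs (insert (rev c) (F - {c}))" for w using that hiW v by simp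
    show "card S \<le> card (vs (insert (rev c) (F - {c})))" if "pk k S" "\<forall>v\<in>V - S. high v" for S using maxF that v by simp
    show "V - vs (insert (rev c) (F - {c})) \<noteq> {}" using Wne v by simp
  qed
qed

text \<open>Reading \<open>c\<close> in both directions gives an arc of two vertices with an
  insertable first vertex and one with an insertable last vertex. If they are the same arc, it can
  be moved away as a whole and replaced by a detour.\<close>

lemma small_E:
  assumes low: "\<forall>X. X \<subseteq> V \<longrightarrow> (\<forall>x\<in>X. \<not> high x) \<longrightarrow> (\<forall>x\<in>X. \<forall>y\<in>X. \<not> adj x y) \<longrightarrow> card X \<le> r"
    and pair: "\<forall>X. X \<subseteq> V \<longrightarrow> (\<forall>x\<in>X. \<forall>y\<in>X. \<not> adj x y) \<longrightarrow> card X = r + 1 \<longrightarrow>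
      (\<exists>x\<in>X. \<exists>y\<in>X. x \<noteq> y \<and> card V \<le> deg x + deg y)"
    and c: "c \<in> F" "2 \<le> card (N \<inter> set c)" "r \<le> card (N \<inter> set c)" and E1: "E \<le> 1"
  shows False
proof -
  obtain u y q v B where 1: "rot c (u # y # q # v # B)" "u \<in> N" "v \<in> N" "y \<notin> N" "q \<notin> N" "ins (F - {c}) y"
    using two_segment[OF low pair c E1] by blast
  let ?F = "insert (rev c) (F - {c})"
  interpret F': max_cover V adj ?F k by (rule max_cover_rev(1)[OF c(1)])
  have v: "vs ?F = vs F" by (rule max_cover_rev(2)[OF c(1)])
  have N': "F'.N = N" unfolding F'.N_def N_def v ..
  have E': "F'.E = E" unfolding F'.E_def E_def v N' ..
  obtain u' y' q' v' B' where 2: "rot (rev c) (u' # y' # q' # v' # B')" "y' \<notin> N" "q' \<notin> N" "ins (?F - {rev c}) y'"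
    using F'.two_segment[OF low pair, of "rev c"] c E1 unfolding N' E' by auto
  have ins': "ins (F - {c}) y'" using ins_mono[OF 2(4)] by blast
  obtain f where f: "bij_betw f (vs F) (vs F)" "astep F = {(x, f x) | x. x \<in> vs F}"
    "\<forall>c\<in>F. bij_betw f (set c) (set c)" "\<forall>c\<in>F. csteps c = {(x, f x) | x. x \<in> set c}"
    by (rule fam_succ[OF famF])
  have s1: "(y, q) \<in> csteps c" "y \<in> vs F"
  proof -
    show "(y, q) \<in> csteps c" unfolding rot_props(4)[OF 1(1), symmetric] by (simp add: csteps_eq)
    then show "y \<in> vs F" using csteps_in_set[of y q c] set_sub_vs[OF c(1)] by blast
  qed
  have s2: "(q', y') \<in> csteps c" "q' \<in> vs F"
  proof -
    have "(y', q') \<in> csteps (rev c)" unfolding rot_props(4)[OF 2(1), symmetric] by (simp add: csteps_eq)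
    then show "(q', y') \<in> csteps c" by (simp add: csteps_rev)
    then show "q' \<in> vs F" using csteps_in_set[of q' y' c] set_sub_vs[OF c(1)] by blast
  qed
  have fy: "q = f y" "y' = f q'" using s1(1) s2(1) f(4) c(1) by auto
  have pre: "x \<notin> preN" if "x \<in> vs F" "f x \<notin> N" for x using that f(2) by (auto simp: preN_def)
  \<comment> \<open>Along \<open>c\<close>, both \<open>y\<close> and \<open>q'\<close> are followed
    by a vertex outside \<open>N\<close>, so they avoid \<open>preN\<close> as well as
    \<open>N\<close>. Only \<open>E <= 1\<close> such vertices exist, hence the arcs
    coincide.\<close>
  have "card {y, q'} \<le> 1"
  proof -
    have "y \<notin> preN" "q' \<notin> preN" using pre[OF s1(2)] pre[OF s2(2)] fy 1(5) 2(2) by auto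
    then have "{y, q'} \<subseteq> vs F - N - preN" using s1(2) s2(2) 1(4) 2(3) by auto
    then have "card {y, q'} \<le> card (vs F - N - preN)" using finvs by (intro card_mono) auto
    then show ?thesis using card_free'[of "vs F"] E1 by simp
  qed
  then have "y = q'" by (cases "y = q'") auto
  then have "y' = q" using fy by simp
  have cc: "cyc c" using cycF c(1) by blast
  have sc: "set (u # y # q # v # B) = set c" using rot_props(1)[OF 1(1)] .
  have fd: "fam (F - {c})" using fam_Diff famF by blast
  have pp: "pth [y, q]" using rot_pth[OF cc, of "[u]" "[y, q]" "v # B"] 1(1) by simp
  obtain F1 where F1: "fam F1" "card F1 = card (F - {c})" "vs F1 = vs (F - {c}) \<union> set [y, q]"
  proof (rule path_insertion[OF fd pp])
    show "set [y, q] \<inter> vs (F - {c}) = {}" using vs_Diff[OF famF c(1)] sc by auto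
    show "ins (F - {c}) z" if "z \<in> set [y, q]" for z using that 1(6) ins' \<open>y' = q\<close> by auto
  qed
  have "rot c (u # [y, q] @ v # B)" using 1(1) by simp
  from replace_close[OF c(1) this 1(2,3) seg_Nil[OF c(1)] seg_Nil[OF c(1)] _ F1(1,2)] F1(3) show False by simp
qed

text \<open>Outside \<open>p\<close> a vertex of \<open>W\<close> keeps at least
  \<open>(|W| + E)/2 - |p| >= E >= 2\<close> neighbours in \<open>W\<close>.\<close>

lemma W_deg2_cycle:
  assumes "2 \<le> E" "E + 2 * length p \<le> card W" "set p \<subseteq> W" "distinct p"
  obtains t where "cyc t" "set t \<subseteq> W - set p"
proof -
  have ne: "W - set p \<noteq> {}"
  proof
    assume "W - set p = {}"
    then have "card W \<le> length p" using card_mono[of "set p" W] card_length[of p] by auto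
    then show False using assms(1,2) by linarith
  qed
  have fin: "finite (W - set p)" using finW by simp
  have "2 \<le> dg (W - set p) w" if "w \<in> W - set p" for w
  proof -
    have "card W + E \<le> 2 * dg W w" using dgW_big that by blast
    moreover have "dg W w = dg (set p) w + dg (W - set p) w" using dg_split[OF assms(3)] .
    moreover have "dg (set p) w \<le> length p" using dg_le_card[of "set p" w] card_length[of p] by simp
    ultimately show ?thesis using assms(1,2) by linarith
  qed
  from min_deg2_cycle[OF fin ne this] show thesis using that by metis
qed

text \<open>If \<open>z\<close> is the only vertex of \<open>N\<close> on \<open>d\<close>, the
  search goes once around and may end at \<open>z\<close> itself. If no vertex of \<open>d\<close>
  is low, the other cycles can absorb \<open>d\<close> without \<open>z\<close>, and
  \<open>W\<close> supplies a new cycle: three or more vertices for the loss of one.\<close>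

lemma first_low_from:
  assumes "d \<in> F" "N \<inter> set d \<noteq> {}" "2 \<le> E"
  obtains J Q where "rot d (J @ Q)" "Q \<noteq> []" "last Q \<in> N" "\<forall>z\<in>set J. high z \<and> z \<notin> N" "\<not> high (hd Q)"
proof (cases "2 \<le> card (N \<inter> set d)")
  case True
  obtain Y where Y: "Y \<subseteq> set d - N" "card Y = card (N \<inter> set d)" "\<forall>y\<in>Y. \<not> high y" "\<forall>y\<in>Y. \<forall>x\<in>Y. \<not> adj y x"
    "\<forall>y\<in>Y. \<exists>u\<in>N. \<exists>I R. rot d (u # I @ y # R) \<and> (\<forall>z\<in>set I. high z \<and> z \<notin> N)" by (rule independent_first_lows[OF assms(1) True])
  have "Y \<noteq> {}" using Y(2) True by (metis card.empty not_numeral_le_zero)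
  then obtain y where y: "y \<in> Y" by blast
  then obtain u I R where u: "u \<in> N" "rot d (u # I @ y # R)" "\<forall>z\<in>set I. high z \<and> z \<notin> N" using Y(5) by blast
  have "rot d (I @ (y # R @ [u]))" using rot_append[of d "[u]" "I @ y # R"] u(2) by simp
  then show thesis using that[of I "y # R @ [u]"] u Y(3) y by simp
next
  case False
  obtain z where z: "z \<in> N" "z \<in> set d" using assms(2) by blast
  have "N \<inter> set d = {z}"
  proof -
    have "card (N \<inter> set d) \<le> Suc 0" using False by simp
    then have "\<forall>x\<in>N \<inter> set d. \<forall>y\<in>N \<inter> set d. x = y" using card_le_Suc0_iff_eq[of "N \<inter> set d"] by simp
    then show ?thesis using z by blast
  qed
  obtain T where T: "rot d (z # T)" using rot_at z(2) by metis
  have cd: "cyc d" using cycF assms(1) by blast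
  have st: "set T = set d - {z}" using cyc_path(3)[OF cd T] .
  then have TN: "\<forall>x\<in>set T. x \<notin> N" using \<open>N \<inter> set d = {z}\<close> by blast
  have rT: "rot d (T @ [z])" using rot_append[of d "[z]" T] T by simp
  show thesis
  proof (cases "\<exists>y\<in>set T. \<not> high y")
    case True
    then obtain J y R where s: "T = J @ y # R" "\<not> high y" "\<forall>x\<in>set J. \<not> \<not> high x"
      using split_list_first_prop[of T "\<lambda>x. \<not> high x"] by blast
    then show thesis using that[of J "y # R @ [z]"] rT z TN by simp
  next
    case allhi: False
    show thesis
    proof (cases "high z")
      case False
      then show thesis using that[of T "[z]"] rT z TN allhi by simp
    next
      case True
      have fd: "fam (F - {d})" using fam_Diff famF by blast
      have vd: "vs (F - {d}) = vs F - set d" using vs_Diff[OF famF assms(1)] .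
      have dv: "set d \<subseteq> vs F" using set_sub_vs assms(1) by blast
      have "card (set T \<inter> preN) \<le> 1" using seg_preN[OF assms(1) rT] TN by blast
      moreover have "card (set T - N - preN) \<le> E" using st dv by (intro card_free') auto
      moreover have "card (set T) \<le> card (set T - N - preN) + card (set T \<inter> preN)"
      proof -
        have "set T = (set T - N - preN) \<union> (set T \<inter> preN)" using TN by auto
        then show ?thesis by (metis card_Un_le)
      qed
      moreover have "vs (F - {d}) \<inter> W = {}" "vs F - vs (F - {d}) - set T = {z}" using vd st z dv by auto
      ultimately have le: "card (set T) + card (vs (F - {d}) \<inter> W) + card (vs F - vs (F - {d}) - set T) \<le> card W + 1"
        using E_le by simp
      have sT: "set T \<subseteq> vs F" "set T \<inter> vs (F - {d}) = {}" "\<forall>v\<in>set T. high v \<and> v \<notin> N"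
        using st dv vd TN allhi by auto
      have p: "pk (card (F - {d})) (vs (F - {d}) \<union> set T)" by (rule absorb[OF fd sT(1,2,3) le])
      obtain t where t: "cyc t" "set t \<subseteq> W - set []" using W_deg2_cycle[OF assms(3), of "[]"] E_le by auto
      have "set t \<inter> (vs (F - {d}) \<union> set T) = {}" using t(2) vd sT(1) by auto
      then have "pk k (vs (F - {d}) \<union> set T \<union> set t)"
        using pk_insert[OF p t(1)] fam_card_Diff[OF famF assms(1)] cardF by simp
      moreover have e: "vs (F - {d}) \<union> set T = vs F - {z}" using vd st dv z by auto
      ultimately have p2: "pk k ((vs F - {z}) \<union> set t)" by simp
      have "\<forall>v\<in>V - ((vs F - {z}) \<union> set t). high v" using hiW True by auto
      then have "card ((vs F - {z}) \<union> set t) \<le> card (vs F)" using maxF[OF p2] by blast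
      moreover have "card ((vs F - {z}) \<union> set t) = card (vs F - {z}) + card (set t)"
        using t(2) finvs by (intro card_Un_disjoint) auto
      moreover have "card (vs F - {z}) + 1 = card (vs F)"
        using z(2) dv finvs by (metis Suc_eq_plus1 card_Suc_Diff1 subsetD)
      ultimately show thesis using cyc_card[OF t(1)] by linarith
    qed
  qed
qed

text \<open>The edge together with a detour merges \<open>c\<close> and \<open>d\<close> into one
  cycle. The missing cycle is found in \<open>W\<close> off the detour, which is where
  \<open>E >= 2\<close> enters.\<close>

lemma first_lows_nonadj_two_cycles:
  assumes cd: "c \<in> F" "d \<in> F" "c \<noteq> d" and "rot c (I @ Q)" "rot d (J @ Q')" "Q \<noteq> []" "Q' \<noteq> []"
    "last Q \<in> N" "last Q' \<in> N" "\<forall>z\<in>set I. high z \<and> z \<notin> N" "\<forall>z\<in>set J. high z \<and> z \<notin> N" "2 \<le> E"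
  shows "\<not> adj (hd Q) (hd Q')"
proof
  assume a: "adj (hd Q) (hd Q')"
  have cc: "cyc c" "cyc d" using cycF cd by blast+
  have sc: "set (I @ Q) = set c" "set (J @ Q') = set d" using rot_props(1) assms(4,5) by blast+
  have dd: "distinct (I @ Q)" "distinct (J @ Q')" using rot_props(3) assms(4,5) cc unfolding cyc_def by blast+
  have dis: "set c \<inter> set d = {}" using famF cd unfolding fam_def by blast
  obtain p where p: "link_path (last Q) (last Q') p" using link_ex[OF assms(8,9)] by blast
  have p': "pth p" "set p \<subseteq> W" "p \<noteq> []" "adj (last Q) (hd p)" "adj (last p) (last Q')" "E + 2 * length p \<le> card W"
    using p by (auto simp: link_path_def)
  have s: "pth Q" "pth (rev Q')"
    using rot_pth[OF cc(1), of I Q "[]"] rot_pth[OF cc(2), of J Q' "[]"] assms(4,5) by simp_all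
  have cy: "cyc (Q @ p @ rev Q')"
  proof (rule link_three[OF s(1) p'(1) s(2)])
    show "set Q \<inter> set p = {}" using outW[OF cd(1)] sc(1) p'(2) by auto
    show "set Q \<inter> set (rev Q') = {}" using dis sc by auto
    show "set p \<inter> set (rev Q') = {}" using outW[OF cd(2)] sc(2) p'(2) by auto
    show "adj (last p) (hd (rev Q'))" using p'(5) by (simp add: hd_rev)
    show "adj (last (rev Q')) (hd Q)" using a adj_sym assms(7) by (simp add: last_rev)
  qed (use p' assms in auto)
  let ?G = "F - {c} - {d}"
  have Fc: "fam (F - {c})" "d \<in> F - {c}" using fam_Diff famF cd by blast+
  have G: "fam ?G" "vs ?G = vs F - set c - set d" using fam_Diff[OF Fc(1)] vs_Diff[OF Fc] vs_Diff[OF famF cd(1)] by auto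
  have cG: "Suc (Suc (card ?G)) = k" using fam_card_Diff[OF Fc] fam_card_Diff[OF famF cd(1)] cardF by simp
  have cv: "set c \<subseteq> vs F" "set d \<subseteq> vs F" using set_sub_vs cd by blast+
  have "set (Q @ p @ rev Q') \<inter> vs ?G = {}" using G(2) sc p'(2) cv by auto
  note i = fam_insert[OF G(1) cy this]
  have sI: "seg I" using segI[OF cd(1), of "[]" I Q] assms(4,10) by simp
  have sJ: "seg J" using segI[OF cd(2), of "[]" J Q'] assms(5,11) by simp
  have "vs (insert (Q @ p @ rev Q') ?G) = (vs F - (set I \<union> set J)) \<union> set p"
  proof -
    have "set Q = set c - set I" "set Q' = set d - set J" using sc dd by auto
    then have "set (Q @ p @ rev Q') = (set c - set I) \<union> set p \<union> (set d - set J)" by auto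
    moreover have "set I \<subseteq> set c" "set J \<subseteq> set d" using sc by auto
    ultimately show ?thesis unfolding i(3) G(2) using cv dis by auto
  qed
  from absorb_segs[OF i(1) sI sJ p this] have pp: "pk (Suc (card ?G)) (vs F \<union> set p)" using i(2) by simp
  have dp: "distinct p" using p'(1) by (simp add: pth_def)
  obtain t where t: "cyc t" "set t \<subseteq> W - set p" using W_deg2_cycle[OF assms(12) p'(6,2) dp] by blast
  have "set t \<inter> (vs F \<union> set p) = {}" using t(2) by auto
  then have "pk k (vs F \<union> set p \<union> set t)" using pk_insert[OF pp t(1)] cG by simp
  moreover have "vs F \<noteq> vs F \<union> set p \<union> set t" using lnk_grow[OF p] by blast
  ultimately show False using no_larger_family[of "vs F \<union> set p \<union> set t"] by blast
qed

lemma max_cover_False: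
  assumes low: "\<forall>X. X \<subseteq> V \<longrightarrow> (\<forall>x\<in>X. \<not> high x) \<longrightarrow> (\<forall>x\<in>X. \<forall>y\<in>X. \<not> adj x y) \<longrightarrow> card X \<le> r"
    and pair: "\<forall>X. X \<subseteq> V \<longrightarrow> (\<forall>x\<in>X. \<forall>y\<in>X. \<not> adj x y) \<longrightarrow> card X = r + 1 \<longrightarrow>
      (\<exists>x\<in>X. \<exists>y\<in>X. x \<noteq> y \<and> card V \<le> deg x + deg y)"
    and r: "2 \<le> r \<and> k * (r - 1) < card N \<or> r = 1 \<and> 2 \<le> card N"
  shows False
proof -
  have sr: "card (N \<inter> set c) \<le> r" if h: "c \<in> F" "2 \<le> card (N \<inter> set c)" for c
  proof -
    obtain Y where Y: "Y \<subseteq> set c - N" "card Y = card (N \<inter> set c)" "\<forall>y\<in>Y. \<not> high y" "\<forall>y\<in>Y. \<forall>x\<in>Y. \<not> adj y x"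
      "\<forall>y\<in>Y. \<exists>u\<in>N. \<exists>I R. rot c (u # I @ y # R) \<and> (\<forall>z\<in>set I. high z \<and> z \<notin> N)" by (rule independent_first_lows[OF h])
    have "Y \<subseteq> V" using Y(1) cyc_V[OF cycF[OF h(1)]] by blast
    from low[THEN spec, THEN mp, THEN mp, THEN mp, OF this Y(3,4)] show ?thesis using Y(2) by simp
  qed
  have nsum: "card N = (\<Sum>c\<in>F. card (N \<inter> set c))" using card_Int_vs[OF famF Nsub] .
  have finF: "finite F" using famF by (simp add: fam_def)
  have low2: "card X \<le> r" if "X \<subseteq> V" "\<forall>x\<in>X. \<not> high x" "\<forall>x\<in>X. \<forall>y\<in>X. \<not> adj x y" for X by (rule low[THEN spec, THEN mp, THEN mp, THEN mp, OF that])
  from r show False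
  proof
    assume r2: "2 \<le> r \<and> k * (r - 1) < card N"
    then have "card F * (r - 1) < card N" using cardF by simp
    then obtain c where c: "c \<in> F" "r - 1 < card (N \<inter> set c)" by (rule pigeonhole_fam[OF famF Nsub])
    have c2: "2 \<le> card (N \<inter> set c)" "r \<le> card (N \<inter> set c)" using c(2) r2 by linarith+
    have cr: "card (N \<inter> set c) = r" using sr[OF c(1) c2(1)] c2(2) by simp
    obtain u y I R where "ins (F - {c}) y" using ins_low[OF low pair c(1) c2] by blast
    then have "F - {c} \<noteq> {}" by (auto simp: ins_def astep_def)
    then have "0 < card (F - {c})" using finF by (simp add: card_gt_0_iff)
    \<comment> \<open>A vertex of \<open>c\<close> can be insertable elsewhere only if there is
      another cycle.\<close>
    then have k2: "2 \<le> k" using fam_card_Diff[OF famF c(1)] cardF by linarith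
    show False
    proof (cases "E \<le> 1")
      case True then show False using small_E[OF low pair c(1) c2] by blast
    next
      case False
      then have E2: "2 \<le> E" by simp
      \<comment> \<open>Otherwise \<open>|N| = r\<close>, while
        \<open>|N| > k (r - 1) >= 2 (r - 1) >= r\<close>.\<close>
      have "\<exists>d\<in>F - {c}. N \<inter> set d \<noteq> {}"
      proof (rule ccontr)
        assume "\<not> ?thesis"
        then have "(\<Sum>d\<in>F - {c}. card (N \<inter> set d)) = 0" by simp
        then have "card N = r" using nsum c(1) cr finF by (simp add: sum.remove)
        moreover have "2 * (r - 1) \<le> k * (r - 1)" using k2 by (rule mult_le_mono1)
        ultimately show False using r2 by linarith
      qed
      then obtain d where d: "d \<in> F" "d \<noteq> c" "N \<inter> set d \<noteq> {}" by blast
      obtain J Q where Q: "rot d (J @ Q)" "Q \<noteq> []" "last Q \<in> N" "\<forall>z\<in>set J. high z \<and> z \<notin> N" "\<not> high (hd Q)"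
        by (rule first_low_from[OF d(1,3) E2])
      obtain Y where Y: "Y \<subseteq> set c - N" "card Y = card (N \<inter> set c)" "\<forall>y\<in>Y. \<not> high y" "\<forall>y\<in>Y. \<forall>x\<in>Y. \<not> adj y x"
        "\<forall>y\<in>Y. \<exists>u\<in>N. \<exists>I R. rot c (u # I @ y # R) \<and> (\<forall>z\<in>set I. high z \<and> z \<notin> N)" by (rule independent_first_lows[OF c(1) c2(1)])
      have hQ: "hd Q \<in> set d" unfolding rot_props(1)[OF Q(1), symmetric] using Q(2) by simp
      have "set c \<inter> set d = {}" using famF c(1) d(1,2) unfolding fam_def by blast
      then have hn: "hd Q \<notin> Y" using hQ Y(1) by blast
      have na: "\<not> adj y (hd Q)" if y: "y \<in> Y" for y
      proof -
        obtain u I R where u: "u \<in> N" "rot c (u # I @ y # R)" "\<forall>z\<in>set I. high z \<and> z \<notin> N" using Y(5) y by blast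
        have "rot c (I @ (y # R @ [u]))" using rot_append[of c "[u]" "I @ y # R"] u(2) by simp
        from first_lows_nonadj_two_cycles[OF c(1) d(1) d(2)[symmetric] this Q(1) _ Q(2) _ Q(3) u(3) Q(4) E2] u(1) show ?thesis by simp
      qed
      have "finite Y" using Y(1) finite_subset by blast
      then have "card (insert (hd Q) Y) = r + 1" using hn Y(2) cr by simp
      moreover have "card (insert (hd Q) Y) \<le> r"
      proof (rule low2)
        show "insert (hd Q) Y \<subseteq> V" using hQ Y(1) cyc_V[OF cycF[OF c(1)]] cyc_V[OF cycF[OF d(1)]] by blast
        show "\<forall>x\<in>insert (hd Q) Y. \<not> high x" using Y(3) Q(5) by blast
        show "\<forall>x\<in>insert (hd Q) Y. \<forall>y\<in>insert (hd Q) Y. \<not> adj x y" using Y(4) na adj_sym adj_irrefl by blast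
      qed
      ultimately show False by simp
    qed
  next
    assume r1: "r = 1 \<and> 2 \<le> card N"
    have le1: "card (N \<inter> set c) \<le> 1" if "c \<in> F" for c
    proof (rule ccontr)
      assume "\<not> ?thesis"
      then have "2 \<le> card (N \<inter> set c)" by simp
      from sr[OF that this] this r1 show False by simp
    qed
    have Nk: "card N \<le> k"
    proof -
      have "(\<Sum>c\<in>F. card (N \<inter> set c)) \<le> (\<Sum>c\<in>F. 1)" using le1 by (intro sum_mono) auto
      then show ?thesis using nsum cardF by simp
    qed
    have "3 \<le> card (set c)" if "c \<in> F" for c using cyc_card[OF cycF[OF that]] by blast
    then have "(\<Sum>c\<in>F. 3) \<le> (\<Sum>c\<in>F. card (set c))" by (rule sum_mono)
    then have "3 * k \<le> card (vs F)" using card_vs[OF famF] cardF by simp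
    \<comment> \<open>\<open>N\<close> has at most one vertex on each cycle, so
      \<open>E >= 3k - 2|N| >= |N| >= 2\<close>.\<close>
    then have E2: "2 \<le> E" using Nk r1 cardvs by linarith
    have n2: "2 \<le> card N" using r1 by blast
    obtain a b where ab: "a \<in> N" "b \<in> N" "a \<noteq> b" by (rule finite_sets_two[OF n2])
    then have "a \<in> vs F" "b \<in> vs F" using Nsub by blast+
    then obtain c d where cd: "c \<in> F" "a \<in> set c" "d \<in> F" "b \<in> set d" unfolding vs_def by blast
    have ne: "c \<noteq> d"
    proof
      assume "c = d"
      then have "card {a, b} \<le> card (N \<inter> set c)" using ab cd by (intro card_mono) auto
      then show False using le1[OF cd(1)] ab(3) by simp
    qed
    have nc: "N \<inter> set c \<noteq> {}" "N \<inter> set d \<noteq> {}" using ab cd by blast+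
    obtain I Q where Q: "rot c (I @ Q)" "Q \<noteq> []" "last Q \<in> N" "\<forall>z\<in>set I. high z \<and> z \<notin> N" "\<not> high (hd Q)"
      by (rule first_low_from[OF cd(1) nc(1) E2])
    obtain J Q' where Q': "rot d (J @ Q')" "Q' \<noteq> []" "last Q' \<in> N" "\<forall>z\<in>set J. high z \<and> z \<notin> N" "\<not> high (hd Q')"
      by (rule first_low_from[OF cd(3) nc(2) E2])
    have h: "hd Q \<in> set c" "hd Q' \<in> set d"
      unfolding rot_props(1)[OF Q(1), symmetric] rot_props(1)[OF Q'(1), symmetric] using Q(2) Q'(2) by simp_all
    have "set c \<inter> set d = {}" using famF cd(1,3) ne unfolding fam_def by blast
    then have hne: "hd Q \<noteq> hd Q'" using h by auto
    have na: "\<not> adj (hd Q) (hd Q')" by (rule first_lows_nonadj_two_cycles[OF cd(1,3) ne Q(1) Q'(1) Q(2) Q'(2) Q(3) Q'(3) Q(4) Q'(4) E2])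
    have "card {hd Q, hd Q'} \<le> r"
    proof (rule low2)
      show "{hd Q, hd Q'} \<subseteq> V" using h cyc_V[OF cycF[OF cd(1)]] cyc_V[OF cycF[OF cd(3)]] by blast
      show "\<forall>x\<in>{hd Q, hd Q'}. \<not> high x" using Q(5) Q'(5) by blast
      show "\<forall>x\<in>{hd Q, hd Q'}. \<forall>y\<in>{hd Q, hd Q'}. \<not> adj x y" using na adj_sym adj_irrefl by blast
    qed
    then show False using hne r1 by simp
  qed
qed

end

section \<open>The case of Ore's condition\<close>

context sgraph
begin

text \<open>A vertex of the cycle has only its two cyclic neighbours, since a chord shortens the
  cycle. For a vertex off it, four neighbours leave at least two vertices beyond the arc between two
  successive ones, and closing that arc gives a shorter cycle.\<close>

lemma short_cycle_nbrs:
  assumes "cyc c" "set c \<subseteq> S" "\<forall>c'. cyc c' \<and> set c' \<subseteq> S \<longrightarrow> length c \<le> length c'" "v \<in> S"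
  shows "dg (set c) v \<le> 3"
proof (rule ccontr)
  assume "\<not> ?thesis"
  then have four: "4 \<le> card (nb (set c) v)" by (simp add: dg_def)
  show False
  proof (cases "v \<in> set c")
    case True
    obtain R where R: "rot c (v # R)" using rot_at True by metis
    note cp = cyc_path[OF assms(1) R]
    have "card {hd R, last R} \<le> 2" by (simp add: card_insert_if)
    then have "\<not> nb (set c) v \<subseteq> {hd R, last R}" using four card_mono[of "{hd R, last R}" "nb (set c) v"] by auto
    then obtain u where u: "u \<in> set c" "adj v u" "u \<noteq> hd R" "u \<noteq> last R" by (auto simp: nb_def)
    have uR: "u \<in> set R" using cp(3) u adj_neq[of v u] by auto
    obtain A B where AB: "R = A @ u # B" "cyc (v # A @ [u])" by (rule path_chord_cycle[OF cp(2) uR u(2,3)])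
    have "B \<noteq> []" using AB(1) u(4) by auto
    moreover have "length c = length A + length B + 2" using rot_props(2)[OF R] AB(1) by simp
    moreover have "set (v # A @ [u]) \<subseteq> S" using AB(1) cp(3) assms(2,4) u(1) by auto
    then have "length c \<le> length (v # A @ [u])" using assms(3) AB(2) by blast
    ultimately show False by (cases B) auto
  next
    case False
    have "2 \<le> card (nb (set c) v)" using four by simp
    then obtain u where "u \<in> nb (set c) v" by (metis finite_sets_two)
    then have u: "u \<in> set c" "adj v u" by (auto simp: nb_def)
    obtain T where T: "rot c (u # T)" using rot_at u(1) by metis
    have sT: "set c = insert u (set T)" using rot_props(1)[OF T] by simp
    have "nb (set c) v \<subseteq> insert u (nb (set T) v)" using sT by (auto simp: nb_def)
    then have "card (nb (set c) v) \<le> card (insert u (nb (set T) v))" by (intro card_mono) auto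
    then have three: "3 \<le> card (nb (set T) v)" using four card_insert_le_m1[of "Suc (card (nb (set T) v))"]
      by (simp add: card_insert_if split: if_splits)
    then have "nb (set T) v \<noteq> {}" by (metis card.empty not_numeral_le_zero)
    then have "\<exists>x\<in>set T. adj v x" by (auto simp: nb_def)
    then obtain A w B where s: "T = A @ w # B" "adj v w" "\<forall>x\<in>set A. \<not> adj v x"
      using split_list_first_prop[of T "adj v"] by blast
    have "nb (set T) v \<subseteq> insert w (set B)" using s by (auto simp: nb_def)
    then have "card (nb (set T) v) \<le> card (insert w (set B))" by (intro card_mono) auto
    then have "3 \<le> card (insert w (set B))" using three by linarith
    then have lB: "2 \<le> length B" using card_length[of "w # B"] by simp
    have r: "rot c (u # A @ w # B)" using T s(1) by simp
    have cy: "cyc (v # u # A @ [w])" by (rule two_nbrs_cycles(1)[OF assms(1) False r u(2) s(2)])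
    have "set (v # u # A @ [w]) \<subseteq> S" using rot_props(1)[OF r] assms(2,4) by auto
    then have "length c \<le> length (v # u # A @ [w])" using assms(3) cy by blast
    then show False using rot_props(2)[OF r] lB by simp
  qed
qed

text \<open>Removing a shortest cycle costs every remaining vertex at most three neighbours, which
  is the slope of the degree bound in \<open>j\<close>.\<close>

lemma greedy_cycles:
  assumes "S \<subseteq> V" "S \<noteq> {}" "\<forall>v\<in>S. 3 * j \<le> dg S v + 1"
  shows "\<exists>T. T \<subseteq> S \<and> pk j T"
  using assms
proof (induction j arbitrary: S)
  case 0
  have "pk 0 {}" using pkI[of "{}"] by simp
  then show ?case by blast
next
  case (Suc j)
  have finS: "finite S" using Suc.prems(1) finV finite_subset by blast
  have "2 \<le> dg S v" if "v \<in> S" for v using Suc.prems(3) that by fastforce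
  from min_deg2_cycle[OF finS Suc.prems(2) this]
  obtain c0 where "cyc c0 \<and> set c0 \<subseteq> S" by metis
  then obtain c where c: "cyc c \<and> set c \<subseteq> S" "\<forall>c'. cyc c' \<and> set c' \<subseteq> S \<longrightarrow> length c \<le> length c'"
    using ex_has_least_nat[of "\<lambda>c. cyc c \<and> set c \<subseteq> S" c0 length] by blast
  have le3: "dg (set c) v \<le> 3" if "v \<in> S" for v using short_cycle_nbrs[OF _ _ c(2) that] c(1) by blast
  have big: "3 * j \<le> dg (S - set c) v + 1" if "v \<in> S" for v
  proof -
    have "3 * Suc j \<le> dg S v + 1" using Suc.prems(3) that by blast
    moreover have "dg S v = dg (set c) v + dg (S - set c) v" using dg_split c(1) by blast
    ultimately show ?thesis using le3[OF that] by simp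
  qed
  have "\<exists>T. T \<subseteq> S - set c \<and> pk j T"
  proof (cases "S - set c = {}")
    case True
    obtain v where "v \<in> S" using Suc.prems(2) by blast
    then have "3 * j \<le> 1" using big[of v] unfolding True by (simp add: dg_def nb_def)
    then have "j = 0" by simp
    moreover have "pk 0 {}" using pkI[of "{}"] by simp
    ultimately show ?thesis by blast
  next
    case False
    show ?thesis by (rule Suc.IH[OF _ False]) (use Suc.prems(1) big in auto)
  qed
  then obtain T where T: "T \<subseteq> S - set c" "pk j T" by blast
  have "set c \<inter> T = {}" using T(1) by blast
  then have "pk (Suc j) (T \<union> set c)" using pk_insert T(2) c(1) by blast
  then show ?case using T(1) c(1) by blast
qed

lemma clique_pth:
  assumes "distinct xs" "\<forall>x\<in>set xs. \<forall>y\<in>set xs. x \<noteq> y \<longrightarrow> adj x y"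
  shows "pth xs"
  using assms by (induction xs rule: induct_list012) auto

text \<open>Vertices not adjacent to \<open>h\<close> miss at most \<open>d - 1\<close> others,
  apart from themselves, in the degree count; the set \<open>B\<close> of them is therefore so dense
  that all cycles but one can be found there. It remains to cover the low vertices, all in
  \<open>h\<close> and its neighbourhood, by one cycle taking at most one vertex of
  \<open>B\<close>.\<close>

lemma cover_low_ore:
  assumes ore: "\<forall>x\<in>V. \<forall>y\<in>V. x \<noteq> y \<longrightarrow> \<not> adj x y \<longrightarrow> card V \<le> deg x + deg y"
    and n: "1 \<le> k" "5 * k \<le> card V + 2" and h: "h \<in> V" "deg h \<le> k"
  shows "\<exists>S. pk k S \<and> (\<forall>v\<in>V - S. high v)"
proof -
  define d where "d = deg h"
  define A where "A = nb V h"
  define B where "B = V - A - {h}"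
  have AV: "A \<subseteq> V" "finite A" "card A = d" "h \<notin> A" by (auto simp: A_def nb_def d_def dg_def adj_irrefl finV)
  have finB: "finite B" using finV by (simp add: B_def)
  have cB: "card B + d + 1 = card V"
  proof -
    have "V = insert h (A \<union> B)" using h AV by (auto simp: B_def)
    moreover have "card (insert h (A \<union> B)) = Suc (card A + card B)"
    proof -
      have "A \<inter> B = {}" "h \<notin> A \<union> B" using AV(4) by (auto simp: B_def)
      then show ?thesis using card_Un_disjoint[OF AV(2) finB] AV(2) finB by simp
    qed
    ultimately show ?thesis using AV(3) by simp
  qed
  have degB: "card V \<le> deg b + d" if "b \<in> B" for b
  proof -
    have "b \<in> V" "b \<noteq> h" "\<not> adj b h" using that adj_sym by (auto simp: B_def A_def nb_def)
    then show ?thesis using ore h(1) by (auto simp: d_def)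
  qed
  \<comment> \<open>If \<open>d <= 1\<close>, a vertex of \<open>B\<close> would have degree at
    least \<open>n - 1\<close>, although it misses \<open>h\<close>.\<close>
  have d2: "2 \<le> d"
  proof (rule ccontr)
    assume "\<not> 2 \<le> d"
    then have "card B \<noteq> 0" using cB n by linarith
    then obtain b where b: "b \<in> B" by (metis card.empty ex_in_conv)
    have "nb V b \<subseteq> V - {b, h}" using b adj_sym adj_irrefl by (auto simp: B_def A_def nb_def)
    then have "deg b \<le> card (V - {b, h})" unfolding dg_def using finV by (intro card_mono) auto
    also have "\<dots> = card V - 2" using b h(1) finV by (simp add: card_Diff_subset B_def)
    finally show False using degB[OF b] \<open>\<not> 2 \<le> d\<close> n cB by linarith
  qed
  have dk: "d \<le> k" using h(2) by (simp add: d_def)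
  have hiB: "high b" if "b \<in> B" for b using degB[OF that] dk n by (simp add: high_def)
  define L where "L = {v \<in> V. \<not> high v}"
  have LA: "L \<subseteq> insert h A" using hiB by (auto simp: L_def B_def)
  have finL: "finite L" using finV by (simp add: L_def)
  have clique: "\<forall>x\<in>L. \<forall>y\<in>L. x \<noteq> y \<longrightarrow> adj x y"
  proof (intro ballI impI, rule ccontr)
    fix x y assume "x \<in> L" "y \<in> L" "x \<noteq> y" "\<not> adj x y"
    then have "card V \<le> deg x + deg y" "2 * deg x < card V" "2 * deg y < card V" using ore by (auto simp: L_def high_def)
    then show False by linarith
  qed
  \<comment> \<open>Three or more low vertices form a cycle as they are pairwise adjacent. Otherwise
    they lie in \<open>{h, a}\<close> for some neighbour \<open>a\<close> of \<open>h\<close>. This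
    pair lies in a triangle, or, if \<open>a\<close> has no neighbour in \<open>A\<close>, in a
    4-cycle through a common neighbour of \<open>a\<close> and \<open>a'\<close> in
    \<open>B\<close>.\<close>
  have "\<exists>Z. cyc Z \<and> L \<subseteq> set Z \<and> card (set Z \<inter> B) \<le> 1"
  proof (cases "3 \<le> card L")
    case True
    obtain xs where xs: "set xs = L" "distinct xs" using finite_distinct_list[OF finL] by blast
    then have l: "3 \<le> length xs" using True distinct_card by metis
    have "pth xs" using clique_pth[OF xs(2)] clique xs(1) by blast
    moreover have "adj (last xs) (hd xs)"
    proof -
      obtain a ys where a1: "xs = a # ys" using l by (cases xs) auto
      moreover from this have "ys \<noteq> []" using l by auto
      ultimately have a: "xs = a # ys" "ys \<noteq> []" by blast+
      then have "last xs \<noteq> a" using xs(2) by auto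
      moreover have "last xs \<in> L" "a \<in> L" using a xs(1) by auto
      ultimately show ?thesis using clique a by simp
    qed
    ultimately have "cyc xs" using l by (simp add: cyc_iff)
    moreover have "set xs \<inter> B = {}" using xs(1) LA h by (auto simp: B_def)
    ultimately show ?thesis using xs(1) by auto
  next
    case False
    have cl: "card (L - {h}) \<le> 1"
    proof (cases "h \<in> L")
      case True then show ?thesis using False finL by simp
    next
      case hn: False
      have "2 * deg h < card V" using h(2) n d2 dk by linarith
      then show ?thesis using hn h(1) by (simp add: L_def high_def)
    qed
    obtain a where a: "a \<in> A" "L \<subseteq> {h, a}"
    proof (cases "L - {h} = {}")
      case True
      have "A \<noteq> {}" using d2 AV(3) by auto
      then show thesis using that True by blast
    next
      case ne: False
      then obtain a where aL: "a \<in> L - {h}" by blast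
      have "\<forall>x\<in>L - {h}. \<forall>y\<in>L - {h}. x = y" using cl card_le_Suc0_iff_eq[of "L - {h}"] finL by simp
      then have "L \<subseteq> {h, a}" using aL by blast
      moreover have "a \<in> A" using aL LA by blast
      ultimately show thesis using that by blast
    qed
    have ha: "adj h a" "a \<in> V" "a \<noteq> h" using a(1) adj_irrefl by (auto simp: A_def nb_def)
    show ?thesis
    proof (cases "\<exists>a'\<in>A. adj a a'")
      case True
      then obtain a' where a': "a' \<in> A" "adj a a'" by blast
      then have "adj h a'" by (simp add: A_def nb_def)
      then have "cyc [h, a, a']" using ha a' adj_sym adj_neq by (auto simp: cyc_iff)
      moreover have "set [h, a, a'] \<inter> B = {}" using a(1) a'(1) by (auto simp: B_def)
      ultimately show ?thesis using a(2) by (intro exI[of _ "[h, a, a']"]) auto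
    next
      case noadj: False
      obtain a' where a': "a' \<in> A" "a' \<noteq> a" using finite_sets_two[of A] d2 AV(3) by metis
      have ha': "adj h a'" "a' \<in> V" using a'(1) by (auto simp: A_def nb_def)
      have "card V \<le> deg a + deg a'" using ore[rule_format, of a a'] ha(2) a' ha'(2) noadj by auto
      moreover have "deg a \<le> dg B a + 1"
      proof -
        have "nb V a \<subseteq> insert h (nb B a)" using noadj by (auto simp: nb_def B_def)
        then have "deg a \<le> card (insert h (nb B a))" unfolding dg_def by (intro card_mono) auto
        then show ?thesis using card_insert_le_m1[of "Suc (dg B a)" "nb B a" h] by (simp add: dg_def card_insert_if split: if_splits)
      qed
      moreover have "deg a' \<le> dg B a' + (d - 1)"
      proof -
        have "nb V a' \<subseteq> nb B a' \<union> insert h (A - {a, a'})" using noadj adj_sym adj_irrefl a' by (auto simp: nb_def B_def)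
        then have "deg a' \<le> card (nb B a' \<union> insert h (A - {a, a'}))" unfolding dg_def using AV(2) by (intro card_mono) auto
        also have "\<dots> \<le> dg B a' + card (insert h (A - {a, a'}))" by (metis card_Un_le dg_def)
        also have "card (insert h (A - {a, a'})) = Suc (d - 2)"
          using AV a(1) a' by (subst card_insert_disjoint) (auto simp: card_Diff_subset)
        finally show ?thesis using d2 by simp
      qed
      ultimately have "card B < dg B a + dg B a'" using cB d2 by linarith
      then obtain v where v: "v \<in> B" "adj a v" "adj a' v" using common_nbr[OF finB] by metis
      have "cyc [h, a, v, a']"
        using four_cycleI[of h a v a'] ha v ha' a' adj_sym by (auto simp: B_def)
      moreover have "set [h, a, v, a'] \<inter> B \<subseteq> {v}" using a(1) a'(1) by (auto simp: B_def)
      then have "card (set [h, a, v, a'] \<inter> B) \<le> 1" using card_mono[of "{v}"] by fastforce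
      ultimately show ?thesis using a(2) by (intro exI[of _ "[h, a, v, a']"]) auto
    qed
  qed
  then obtain Z where Z: "cyc Z" "L \<subseteq> set Z" "card (set Z \<inter> B) \<le> 1" by blast
  define B' where "B' = B - set Z"
  have BB': "dg B b \<le> dg B' b + 1" for b
  proof -
    have "nb B b \<subseteq> nb B' b \<union> (set Z \<inter> B)" by (auto simp: nb_def B'_def)
    then have "dg B b \<le> card (nb B' b \<union> (set Z \<inter> B))" unfolding dg_def by (intro card_mono) auto
    also have "\<dots> \<le> dg B' b + card (set Z \<inter> B)" by (metis card_Un_le dg_def)
    finally show ?thesis using Z(3) by linarith
  qed
  \<comment> \<open>At most \<open>d\<close> neighbours lie in \<open>A\<close> and one on
    \<open>Z\<close>, so at least \<open>n - 2d - 1 >= (5k - 2) - 2k - 1 = 3k - 3\<close>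
    remain.\<close>
  have deg': "3 * (k - 1) \<le> dg B' b + 1" if b: "b \<in> B'" for b
  proof -
    have bB: "b \<in> B" using b by (simp add: B'_def)
    have "nb V b \<subseteq> nb B b \<union> A" using bB adj_sym by (auto simp: nb_def B_def A_def)
    then have "deg b \<le> card (nb B b \<union> A)" unfolding dg_def using AV(2) by (intro card_mono) auto
    also have "\<dots> \<le> dg B b + d" using card_Un_le[of "nb B b" A] AV(3) by (simp add: dg_def)
    finally show ?thesis using degB[OF bB] BB'[of b] dk n by linarith
  qed
  have "B' \<noteq> {}"
  proof
    assume "B' = {}"
    then have "card B \<le> card (set Z \<inter> B)" unfolding B'_def by (intro card_mono) auto
    then show False using Z(3) cB dk n d2 by linarith
  qed
  have "B' \<subseteq> V" by (auto simp: B'_def B_def)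
  have "\<forall>b\<in>B'. 3 * (k - 1) \<le> dg B' b + 1" using deg' by blast
  from greedy_cycles[OF \<open>B' \<subseteq> V\<close> \<open>B' \<noteq> {}\<close> this] obtain T where T: "T \<subseteq> B'" "pk (k - 1) T" by blast
  have "set Z \<inter> T = {}" using T(1) by (auto simp: B'_def)
  then have "pk k (T \<union> set Z)" using pk_insert[OF T(2) Z(1)] n(1) by simp
  moreover have "\<forall>v\<in>V - (T \<union> set Z). high v" using Z(2) by (auto simp: L_def)
  ultimately show ?thesis by blast
qed

lemma reach_path:
  assumes "(a, b) \<in> {(x, y). adj x y \<and> x \<in> W \<and> y \<in> W}\<^sup>*"
  shows "\<exists>p. pth p \<and> p \<noteq> [] \<and> hd p = a \<and> last p = b \<and> set p \<subseteq> {(x, y). adj x y \<and> x \<in> W \<and> y \<in> W}\<^sup>* `` {a}"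
  using assms
proof (induction rule: rtrancl_induct)
  case base
  then show ?case by (intro exI[of _ "[a]"]) auto
next
  case (step y z)
  then obtain p where p: "pth p" "p \<noteq> []" "hd p = a" "last p = y"
    "set p \<subseteq> {(x, y). adj x y \<and> x \<in> W \<and> y \<in> W}\<^sup>* `` {a}" by blast
  have z: "(a, z) \<in> {(x, y). adj x y \<and> x \<in> W \<and> y \<in> W}\<^sup>*" using step(1,2) by (rule rtrancl_into_rtrancl)
  show ?case
  proof (cases "z \<in> set p")
    case True
    then obtain A B where s: "p = (A @ [z]) @ B" by (metis split_list append.assoc append_Cons append_Nil)
    have "pth (A @ [z])" using p(1) s pth_appendD by blast
    moreover have "hd (A @ [z]) = a" using p(3) s by (cases A) auto
    moreover have "set (A @ [z]) \<subseteq> set p" using s by auto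
    ultimately show ?thesis using p(5) by (intro exI[of _ "A @ [z]"]) auto
  next
    case False
    then have "pth (p @ [z])" using p step(2) by (simp add: pth_append)
    then show ?thesis using p z by (intro exI[of _ "p @ [z]"]) auto
  qed
qed

end

section \<open>Largest families under Ore's condition with minimum degree above k\<close>

context sgraph
begin

text \<open>\<open>H\<close> is a component of the uncovered part and \<open>M\<close> its
  attachment on the cycles. Maximality lets \<open>M\<close> meet each cycle at most once, makes
  \<open>H\<close> acyclic, and allows each vertex of \<open>M\<close> one neighbour in
  \<open>H\<close>. A leaf of \<open>H\<close> has at least \<open>k\<close> neighbours in
  \<open>M\<close>, which has at most \<open>k\<close> vertices; two leaves, or an isolated vertex,
  are then too many.\<close>

lemma ore_max_spanning:
  assumes ore: "\<forall>x\<in>V. \<forall>y\<in>V. x \<noteq> y \<longrightarrow> \<not> adj x y \<longrightarrow> card V \<le> deg x + deg y"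
    and mindeg: "\<forall>v\<in>V. k + 1 \<le> deg v" and k: "1 \<le> k"
    and F: "fam F" "card F = k" and max: "\<forall>S. pk k S \<longrightarrow> card S \<le> card (vs F)"
  shows "vs F = V"
proof (rule ccontr)
  assume "vs F \<noteq> V"
  have vsV: "vs F \<subseteq> V" using fam_V[OF F(1)] .
  define W where "W = V - vs F"
  then obtain w0 where w0: "w0 \<in> W" using vsV \<open>vs F \<noteq> V\<close> by blast
  have finvs: "finite (vs F)" using fam_finite_vs[OF F(1)] .
  have big: False if "pk k S" "card (vs F) < card S" for S using max that by fastforce
  have no_larger_family: False if "pk k S" "vs F \<subset> S" for S
  proof -
    have "finite S" using pk_V[OF that(1)] finV finite_subset by blast
    then show False using big[OF that(1)] psubset_card_mono that(2) by blast
  qed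
  define Rl where "Rl = {(x, y). adj x y \<and> x \<in> W \<and> y \<in> W}"
  define H where "H = Rl\<^sup>* `` {w0}"
  have symR: "sym Rl" using adj_sym by (auto simp: Rl_def sym_def)
  have HW: "H \<subseteq> W"
  proof
    fix y assume "y \<in> H"
    then have "(w0, y) \<in> Rl\<^sup>*" by (simp add: H_def)
    then show "y \<in> W" using w0 by (cases rule: rtranclE) (auto simp: Rl_def)
  qed
  have w0H: "w0 \<in> H" by (simp add: H_def)
  have closed: "z \<in> H" if "y \<in> H" "z \<in> W" "adj y z" for y z
  proof -
    have "(w0, y) \<in> Rl\<^sup>*" "(y, z) \<in> Rl" using that HW by (auto simp: H_def Rl_def)
    then show ?thesis unfolding H_def by (auto intro: rtrancl_into_rtrancl)
  qed
  have Hpath: "\<exists>p. pth p \<and> p \<noteq> [] \<and> hd p = y \<and> last p = z \<and> set p \<subseteq> H" if yz: "y \<in> H" "z \<in> H" for y z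
  proof -
    have a: "(w0, y) \<in> Rl\<^sup>*" "(w0, z) \<in> Rl\<^sup>*" using yz by (simp_all add: H_def)
    have "(y, w0) \<in> Rl\<^sup>*" using a(1) sym_rtrancl[OF symR] by (auto simp: sym_def)
    then have "(y, z) \<in> Rl\<^sup>*" using a(2) by (rule rtrancl_trans)
    then have "\<exists>p. pth p \<and> p \<noteq> [] \<and> hd p = y \<and> last p = z \<and> set p \<subseteq> Rl\<^sup>* `` {y}"
      unfolding Rl_def by (rule reach_path)
    moreover have "Rl\<^sup>* `` {y} \<subseteq> H" using a(1) by (auto simp: H_def intro: rtrancl_trans)
    ultimately show ?thesis by blast
  qed
  define M where "M = {u \<in> vs F. \<exists>h\<in>H. adj u h}"
  have cycF: "cyc c" if "c \<in> F" for c using fam_cyc[OF F(1) that] .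
  have outW: "set c \<inter> W = {}" if "c \<in> F" for c using set_sub_vs[OF that] by (auto simp: W_def)
  have fd: "fam (F - {c})" for c using fam_Diff[OF F(1)] .
  have vd: "vs (F - {c}) = vs F - set c" if "c \<in> F" for c using vs_Diff[OF F(1) that] .
  have Mpath: "\<exists>p. pth p \<and> p \<noteq> [] \<and> set p \<subseteq> H \<and> adj u (hd p) \<and> adj (last p) v" if uv: "u \<in> M" "v \<in> M" for u v
  proof -
    obtain h h' where "h \<in> H" "adj u h" "h' \<in> H" "adj v h'" using uv by (auto simp: M_def)
    then show ?thesis using Hpath[of h h'] adj_sym by blast
  qed
  have rep: False if "c \<in> F" "fam F1" "card F1 = card (F - {c})" "vs F1 = vs (F - {c}) \<union> I" "cyc c'"
    "I \<subseteq> set c" "set c' = (set c - I) \<union> set p" "set p \<subseteq> H" "p \<noteq> []" for c F1 I c' p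
  proof -
    have pv: "set p \<inter> vs F = {}" using that(8) HW unfolding W_def by blast
    have Iv: "I \<subseteq> vs F" using that(6) set_sub_vs[OF that(1)] by blast
    have "set c' \<inter> vs F1 = {}" unfolding that(4,7) vd[OF that(1)] using pv Iv by blast
    note i = fam_insert[OF that(2,5) this]
    have v: "vs (insert c' F1) = vs F \<union> set p"
      unfolding i(3) that(4,7) using vd[OF that(1)] that(6) set_sub_vs[OF that(1)] by auto
    have "pk k (vs F \<union> set p)" using pkI[OF i(1)] i(2) v that(3) fam_card_Diff[OF F(1) that(1)] F(2) by simp
    moreover have "hd p \<in> set p" using that(9) by simp
    then have "vs F \<subset> vs F \<union> set p" using that(8) HW by (auto simp: W_def)
    ultimately show False by (rule no_larger_family)
  qed
  have insert_seg: "\<exists>F1. fam F1 \<and> card F1 = card (F - {c}) \<and> vs F1 = vs (F - {c}) \<union> set I"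
    if a: "c \<in> F" "rot c (xs @ I @ ys)" "\<forall>z\<in>set I. ins (F - {c}) z" for c xs I ys
  proof -
    have pI: "pth I" using rot_pth[OF cycF[OF a(1)] a(2)] .
    have dis: "set I \<inter> vs (F - {c}) = {}" using vd[OF a(1)] rot_props(1)[OF a(2)] by auto
    obtain F1 where "fam F1" "card F1 = card (F - {c})" "vs F1 = vs (F - {c}) \<union> set I"
    proof (rule path_insertion[OF fd pI dis])
      show "ins (F - {c}) z" if "z \<in> set I" for z using a(3) that by blast
    qed
    then show ?thesis by blast
  qed
  \<comment> \<open>If all inner vertices of an arc between two attachments can be moved to other
    cycles, the arc is replaced by a path through \<open>H\<close>.\<close>
  have rc: False if a: "c \<in> F" "rot c (u # A @ v # B)" "u \<in> M" "v \<in> M" "\<forall>z\<in>set A. ins (F - {c}) z" for c u A v B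
  proof -
    have cc: "cyc c" using cycF a(1) .
    have sc: "set (u # A @ v # B) = set c" using rot_props(1)[OF a(2)] .
    have d: "distinct (u # A @ v # B)" using rot_props(3)[OF a(2)] cc by (simp add: cyc_def)
    obtain F1 where F1: "fam F1" "card F1 = card (F - {c})" "vs F1 = vs (F - {c}) \<union> set A"
      using insert_seg[OF a(1), of "[u]" A "v # B"] a(2,5) by auto
    obtain p where p: "pth p" "p \<noteq> []" "set p \<subseteq> H" "adj u (hd p)" "adj (last p) v" using Mpath[OF a(3,4)] by blast
    have "rot c ((v # B) @ (u # A))" using rot_append[of c "u # A" "v # B"] a(2) by simp
    then have s: "pth (v # B @ [u])" using rot_pth[OF cc, of "[]" "v # B @ [u]" A] by simp
    have "1 \<le> length p" using p(2) by (simp add: Suc_le_eq)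
    then have cy: "cyc ((v # B @ [u]) @ p)" using s p outW[OF a(1)] HW sc by (intro link_paths) auto
    have "set ((v # B @ [u]) @ p) = (set c - set A) \<union> set p" using sc d by auto
    moreover have "set A \<subseteq> set c" using sc by auto
    ultimately show False using rep[OF a(1) F1 cy _ _ p(3,2)] by blast
  qed
  have noins: "\<not> ins F h" if hW: "h \<in> W" for h
  proof
    assume high: "ins F h"
    obtain F' where F': "fam F'" "card F' = card F" "vs F' = vs F \<union> set [h]"
    proof (rule path_insertion[OF F(1)])
      show "pth [h]" "set [h] \<inter> vs F = {}" using hW by (auto simp: W_def)
      show "ins F v" if "v \<in> set [h]" for v using that high by simp
    qed
    then have "pk k (vs F \<union> set [h])" using pkI[OF F'(1)] F(2) by simp
    moreover have "vs F \<subset> vs F \<union> set [h]" using hW by (auto simp: W_def)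
    ultimately show False by (rule no_larger_family)
  qed
  obtain f where f: "bij_betw f (vs F) (vs F)" "astep F = {(x, f x) | x. x \<in> vs F}"
    "\<forall>c\<in>F. bij_betw f (set c) (set c)" "\<forall>c\<in>F. csteps c = {(x, f x) | x. x \<in> set c}"
    by (rule fam_succ[OF F(1)])
  have finW: "finite W" using finV by (simp add: W_def)
  have cVW: "card V = card W + card (vs F)"
    unfolding W_def using vsV finV finvs by (metis card_Diff_subset card_mono le_add_diff_inverse2)
  have dgW: "dg W h = dg H h" if "h \<in> H" for h
  proof -
    have "nb W h = nb H h" using that closed HW by (auto simp: nb_def)
    then show ?thesis by (simp add: dg_def)
  qed
  have deg_sp: "deg x = dg W x + dg (vs F) x" for x using dg_split[OF vsV, of x] by (simp add: W_def)
  have finH: "finite H" using HW finW finite_subset by blast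
  \<comment> \<open>Let \<open>y\<close> be the first vertex after \<open>u\<close> that is not
    insertable elsewhere. The count of \<open>deg_sum_small\<close> applies to \<open>w0\<close> and
    \<open>y\<close>; in \<open>W\<close> their neighbours lie in \<open>H\<close> and off
    \<open>H\<close> respectively. The degree sum falls below \<open>n\<close>, against Ore's
    condition.\<close>
  have all_ins: "ins (F - {c}) x" if c: "c \<in> F" "u \<in> M" "u \<in> set c" "x \<in> set c - {u}" for c u x
  proof (rule ccontr)
    assume "\<not> ins (F - {c}) x"
    have cc: "cyc c" using cycF c(1) .
    obtain T where T: "rot c (u # T)" using rot_at c(3) by metis
    have "x \<in> set T" using cyc_path(3)[OF cc T] c(4) by blast
    then have "\<exists>z\<in>set T. \<not> ins (F - {c}) z" using \<open>\<not> ins (F - {c}) x\<close> by blast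
    then obtain I y R where s: "T = I @ y # R" "\<not> ins (F - {c}) y" "\<forall>z\<in>set I. \<not> \<not> ins (F - {c}) z"
      using split_list_first_prop[of T "\<lambda>z. \<not> ins (F - {c}) z"] by blast
    have I: "\<forall>z\<in>set I. ins (F - {c}) z" using s(3) by blast
    have r: "rot c (u # I @ y # R)" using T s(1) by simp
    have sc: "set (u # I @ y # R) = set c" using rot_props(1)[OF r] .
    have d: "distinct (u # I @ y # R)" using rot_props(3)[OF r] cc by (simp add: cyc_def)
    have yc: "y \<in> set c" using sc by auto
    have yM: "y \<notin> M" using rc[OF c(1) r c(2) _ I] by blast
    have IM: "z \<notin> M" if zI: "z \<in> set I" for z
    proof
      assume "z \<in> M"
      obtain I1 I2 where "I = I1 @ z # I2" using split_list[OF zI] by blast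
      then show False using rc[OF c(1), of u I1 z "I2 @ y # R"] r c(2) \<open>z \<in> M\<close> I by simp
    qed
    define Mc where "Mc = M \<inter> set c"
    have uMc: "u \<in> Mc" using c by (simp add: Mc_def)
    have cs: "csteps c = csteps (u # I @ y # R)" using rot_props(4)[OF r] by simp
    have key: "f z \<noteq> y \<and> \<not> adj y (f z)" if z: "z \<in> Mc" "z \<noteq> u" for z
    proof -
      have zM: "z \<in> M" using z(1) by (simp add: Mc_def)
      have "z \<in> set (u # I @ y # R)" using z(1) sc by (simp add: Mc_def)
      then have "z \<in> set R" using z(2) zM IM yM by auto
      then obtain A B' where R: "R = A @ z # B'" using split_list by metis
      show ?thesis
      proof (cases B')
        case Nil
        have "rot c ((u # I @ y # A) @ [z])" using r R Nil by simp
        then have "rot c ([z] @ (u # I @ y # A))" by (rule rot_append)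
        then have "rot c (z # [] @ u # (I @ y # A))" by simp
        from rc[OF c(1) this zM c(2)] show ?thesis by simp
      next
        case (Cons z' B)
        have "(z, z') \<in> steps (z # z' # B)" by simp
        then have "(z, z') \<in> steps ((u # I @ y # A) @ z # z' # B)" using steps_append_subset(2) by blast
        then have "(z, z') \<in> csteps c" unfolding cs R Cons by (simp add: csteps_eq)
        then have fz: "z' = f z" using f(4) c(1) by auto
        have r2: "rot c (u # I @ y # A @ z # z' # B)" using r R Cons by simp
        have sc2: "set (u # I @ y # A @ z # z' # B) = set c" using rot_props(1)[OF r2] .
        have d2: "distinct (u # I @ y # A @ z # z' # B)" using rot_props(3)[OF r2] cc by (simp add: cyc_def)
        have "\<not> adj y z'"
        proof
          assume yz: "adj y z'"
          obtain p where p: "pth p" "p \<noteq> []" "set p \<subseteq> H" "adj u (hd p)" "adj (last p) z" using Mpath[OF c(2) zM] by blast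
          have s2: "pth (y # A @ [z])" using rot_pth[OF cc, of "u # I" "y # A @ [z]" "z' # B"] r2 by simp
          have "rot c ((z' # B) @ (u # I @ y # A @ [z]))" using rot_append[of c "u # I @ y # A @ [z]" "z' # B"] r2 by simp
          then have s1: "pth (z' # B @ [u])" using rot_pth[OF cc, of "[]" "z' # B @ [u]" "I @ y # A @ [z]"] by simp
          have s2': "pth (rev (y # A @ [z]))" using s2 by (simp only: pth_rev)
          have cy: "cyc ((z' # B @ [u]) @ p @ rev (y # A @ [z]))"
          proof (rule link_three[OF s1 p(1) s2'])
            show "set (z' # B @ [u]) \<inter> set p = {}" using outW[OF c(1)] HW sc2 p(3) by auto
            show "set (z' # B @ [u]) \<inter> set (rev (y # A @ [z])) = {}" using d2 by auto
            show "set p \<inter> set (rev (y # A @ [z])) = {}" using outW[OF c(1)] HW sc2 p(3) by auto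
          qed (use p yz adj_sym in auto)
          obtain F1 where F1: "fam F1" "card F1 = card (F - {c})" "vs F1 = vs (F - {c}) \<union> set I"
            using insert_seg[OF c(1), of "[u]" I "y # R"] r I by auto
          have "set ((z' # B @ [u]) @ p @ rev (y # A @ [z])) = (set c - set I) \<union> set p" using sc2 d2 by auto
          moreover have "set I \<subseteq> set c" using sc by auto
          ultimately show False using rep[OF c(1) F1 cy _ _ p(3,2)] by blast
        qed
        moreover have "z' \<noteq> y" using d2 by auto
        ultimately show ?thesis using fz by simp
      qed
    qed
    have fc: "bij_betw f (set c) (set c)" using f(3) c(1) by blast
    have "Mc \<subseteq> set c" by (simp add: Mc_def)
    from succ_count[OF fc this uMc yc] key have y1: "dg (set c) y + card Mc \<le> card (set c)" by blast
    have "nb (set c) w0 \<subseteq> Mc"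
    proof
      fix z assume "z \<in> nb (set c) w0"
      then have z: "z \<in> set c" "adj z w0" using adj_sym by (auto simp: nb_def)
      then show "z \<in> Mc" using set_sub_vs[OF c(1)] w0H unfolding Mc_def M_def by blast
    qed
    then have w1: "dg (set c) w0 \<le> card Mc" unfolding dg_def by (intro card_mono) (simp_all add: Mc_def)
    have nw: "\<not> ins (F - {c}) w0" using noins[OF w0] ins_mono[of "F - {c}" w0 F] by blast
    have halves: "2 * dg (vs (F - {c})) w0 \<le> card (vs (F - {c}))" "2 * dg (vs (F - {c})) y \<le> card (vs (F - {c}))"
      using not_ins_dg[OF fd nw] not_ins_dg[OF fd s(2)] .
    have yv: "y \<in> vs F" using yc set_sub_vs[OF c(1)] by blast
    have nyH: "\<not> adj y h" if "h \<in> H" for h using yM yv that by (auto simp: M_def)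
    have "nb W y \<subseteq> W - H" using nyH by (auto simp: nb_def)
    then have "dg W y \<le> card (W - H)" unfolding dg_def using finW by (intro card_mono) auto
    moreover have "card (W - H) + card H = card W" using HW finW finH
      by (metis card_Diff_subset card_mono le_add_diff_inverse2)
    moreover have "dg W w0 < card H" using dgW[OF w0H] dg_less_card[OF finH w0H] by simp
    moreover have "dg (vs F) w0 = dg (set c) w0 + dg (vs (F - {c})) w0"
      "dg (vs F) y = dg (set c) y + dg (vs (F - {c})) y"
      using dg_split[OF set_sub_vs[OF c(1)]] vd[OF c(1)] by simp_all
    moreover have "card (vs F) = card (set c) + card (vs (F - {c}))"
      using vd[OF c(1)] set_sub_vs[OF c(1)] finvs by (metis card_Diff_subset card_mono finite_set le_add_diff_inverse)
    ultimately have "deg w0 + deg y < card V"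
      using y1 w1 halves deg_sp[of w0] deg_sp[of y] cVW by linarith
    moreover have "w0 \<noteq> y" "\<not> adj w0 y" "w0 \<in> V" "y \<in> V"
      using w0 yv nyH[OF w0H] adj_sym vsV by (auto simp: W_def)
    ultimately show False using ore by fastforce
  qed
  have one: "card (M \<inter> set c) \<le> 1" if c: "c \<in> F" for c
  proof (rule ccontr)
    assume "\<not> ?thesis"
    then have "2 \<le> card (M \<inter> set c)" by simp
    then have "\<not> (\<forall>u\<in>M \<inter> set c. \<forall>v\<in>M \<inter> set c. u = v)" using card_le_Suc0_iff_eq[of "M \<inter> set c"] by simp
    then obtain u v where uv: "u \<in> M \<inter> set c" "v \<in> M \<inter> set c" "u \<noteq> v" by blast
    obtain A B where r: "rot c (u # A @ v # B)" by (rule rot_two[of u c v]) (use uv in auto)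
    have d: "distinct (u # A @ v # B)" using rot_props(3)[OF r] cycF[OF c] by (simp add: cyc_def)
    have "set A \<subseteq> set c - {u}" using rot_props(1)[OF r] d by auto
    then have "\<forall>z\<in>set A. ins (F - {c}) z" using all_ins[OF c] uv(1) by blast
    then show False using rc[OF c r] uv by blast
  qed
  \<comment> \<open>The cycle through \<open>u\<close> is dissolved: all its other vertices move to
    other cycles, and \<open>t\<close> takes its place. At most \<open>u\<close> is lost, while
    \<open>t\<close> has at least three vertices.\<close>
  have nocyc: False if u: "u \<in> M" and t: "cyc t" "set t \<subseteq> insert u H" for u t
  proof -
    obtain c where c: "c \<in> F" "u \<in> set c" using u by (auto simp: M_def vs_def)
    obtain T where T: "rot c (u # T)" using rot_at c(2) by metis
    have sT: "set T = set c - {u}" using cyc_path(3)[OF cycF[OF c(1)] T] .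
    have "\<forall>z\<in>set T. ins (F - {c}) z" using all_ins[OF c(1) u c(2)] sT by blast
    then obtain F1 where F1: "fam F1" "card F1 = card (F - {c})" "vs F1 = vs (F - {c}) \<union> set T"
      using insert_seg[OF c(1), of "[u]" T "[]"] T by auto
    have uv: "u \<in> vs F" using u by (simp add: M_def)
    have v1: "vs F1 = vs F - {u}" using F1(3) vd[OF c(1)] sT set_sub_vs[OF c(1)] c(2) by auto
    have dis: "set t \<inter> vs F1 = {}" using t(2) v1 HW by (auto simp: W_def)
    note i = fam_insert[OF F1(1) t(1) dis]
    have "pk k (set t \<union> (vs F - {u}))" using pkI[OF i(1)] i(2,3) v1 F1(2) fam_card_Diff[OF F(1) c(1)] F(2) by simp
    moreover have "card (set t \<union> (vs F - {u})) = card (set t) + card (vs F - {u})"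
      using dis v1 finvs by (intro card_Un_disjoint) auto
    moreover have "card (vs F - {u}) + 1 = card (vs F)" using uv finvs by (metis Suc_eq_plus1 card_Suc_Diff1)
    moreover have "3 \<le> card (set t)" using cyc_card[OF t(1)] by blast
    ultimately show False using big[of "set t \<union> (vs F - {u})"] by linarith
  qed
  have nbM: "nb (vs F) h \<subseteq> M" if "h \<in> H" for h using that adj_sym by (auto simp: nb_def M_def)
  have finM: "finite M" using finvs by (simp add: M_def)
  \<comment> \<open>Without attachments no edge leaves \<open>H\<close>, and Ore's condition fails
    for \<open>w0\<close> and any covered vertex.\<close>
  have "M \<noteq> {}"
  proof
    assume "M = {}"
    then have "dg (vs F) w0 = 0" using nbM[OF w0H] by (auto simp: dg_def)
    then have "deg w0 < card H" using deg_sp[of w0] dgW[OF w0H] dg_less_card[OF finH w0H] by simp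
    moreover obtain c where c: "c \<in> F" using F(2) k by (metis card.empty ex_in_conv not_one_le_zero)
    obtain v where v: "v \<in> set c" using cyc_ne[OF cycF[OF c]] by (metis list.set_sel(1))
    have vv: "v \<in> vs F" using v set_sub_vs[OF c] by blast
    have nv: "\<not> adj v h" if "h \<in> H" for h using that vv \<open>M = {}\<close> by (auto simp: M_def)
    have "nb V v \<subseteq> V - H - {v}" using nv adj_irrefl by (auto simp: nb_def)
    then have "deg v \<le> card (V - H - {v})" unfolding dg_def using finV by (intro card_mono) auto
    moreover have "card (V - H - {v}) + 1 = card (V - H)"
    proof -
      have "v \<in> V - H" using vv vsV HW by (auto simp: W_def)
      then show ?thesis using finV by (metis Suc_eq_plus1 card_Suc_Diff1 finite_Diff)
    qed
    moreover have "card (V - H) + card H = card V"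
    proof -
      have "H \<subseteq> V" using HW by (auto simp: W_def)
      then show ?thesis using finV finH by (metis card_Diff_subset card_mono le_add_diff_inverse2)
    qed
    moreover have "w0 \<noteq> v" "\<not> adj w0 v" "w0 \<in> V" "v \<in> V" using w0 vv nv[OF w0H] adj_sym vsV by (auto simp: W_def)
    then have "card V \<le> deg w0 + deg v" using ore by blast
    ultimately show False by linarith
  qed
  then obtain u0 where u0: "u0 \<in> M" by blast
  have aH: "acyc H" unfolding acyc_def using nocyc[OF u0] by blast
  \<comment> \<open>Two neighbours of \<open>u\<close> in \<open>H\<close> would be joined by a path
    in \<open>H\<close> and close a cycle with \<open>u\<close>.\<close>
  have uniq: "h = h'" if a: "u \<in> M" "h \<in> H" "h' \<in> H" "adj u h" "adj u h'" for u h h'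
  proof (rule ccontr)
    assume "h \<noteq> h'"
    obtain p where p: "pth p" "p \<noteq> []" "hd p = h" "last p = h'" "set p \<subseteq> H" using Hpath[OF a(2,3)] by blast
    have "u \<notin> set p" using a(1) p(5) HW by (auto simp: M_def W_def)
    moreover have "h \<in> set p" "h' \<in> set p" using p(2,3,4) by auto
    ultimately obtain t where "cyc t" "set t \<subseteq> insert u (set p)"
      using two_nbr_path_cycle[OF p(1) _ _ _ \<open>h \<noteq> h'\<close> a(4,5)] by blast
    then show False using nocyc[OF a(1), of t] p(5) by blast
  qed
  have cM: "card M \<le> k"
  proof -
    have "M \<subseteq> vs F" by (auto simp: M_def)
    from card_Int_vs[OF F(1) this] have "card M = (\<Sum>c\<in>F. card (M \<inter> set c))" .
    also have "\<dots> \<le> (\<Sum>c\<in>F. 1)" using one by (rule sum_mono)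
    finally show ?thesis using F(2) by simp
  qed
  have Hne: "H \<noteq> {}" using w0H by blast
  obtain p where p: "pth p" "set p \<subseteq> H" "p \<noteq> []" "\<forall>q. pth q \<and> set q \<subseteq> H \<longrightarrow> length q \<le> length p"
    "length p = 1 \<longrightarrow> nb H (hd p) = {}"
    "2 \<le> length p \<longrightarrow> nb H (hd p) = {p ! 1}"
    "2 \<le> length p \<longrightarrow> nb H (last p) = {p ! (length p - 2)}"
    by (rule acyc_longest_path[OF finH Hne aH])
  have hl: "hd p \<in> H" "last p \<in> H" using p(2,3) by auto
  have dge: "k + 1 \<le> dg H h + dg (vs F) h" if "h \<in> H" for h
  proof -
    have "h \<in> V" using that HW by (auto simp: W_def)
    then show ?thesis using mindeg deg_sp[of h] dgW[OF that] by fastforce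
  qed
  have le: "dg (vs F) h \<le> card M" if "h \<in> H" for h unfolding dg_def using finM nbM[OF that] by (rule card_mono)
  show False
  proof (cases "2 \<le> length p")
    case False
    moreover have "length p \<noteq> 0" using p(3) by simp
    ultimately have "length p = 1" by linarith
    then have "dg H (hd p) = 0" using p(5) by (simp add: dg_def)
    then show False using dge[OF hl(1)] le[OF hl(1)] cM by linarith
  next
    case True
    then have "dg H (hd p) = 1" "dg H (last p) = 1" using p(6,7) by (simp_all add: dg_def)
    then have ge: "k \<le> dg (vs F) (hd p)" "k \<le> dg (vs F) (last p)" using dge[OF hl(1)] dge[OF hl(2)] by linarith+
    have ne: "hd p \<noteq> last p" using True p(1) by (cases p) (auto dest!: pth_distinct)
    have "nb (vs F) (hd p) \<inter> nb (vs F) (last p) = {}"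
    proof (rule ccontr)
      assume "\<not> ?thesis"
      then obtain u where u: "u \<in> nb (vs F) (hd p)" "u \<in> nb (vs F) (last p)" by blast
      then have "u \<in> M" "adj u (hd p)" "adj u (last p)" using nbM[OF hl(1)] adj_sym by (auto simp: nb_def)
      then show False using uniq hl ne by blast
    qed
    then have "dg (vs F) (hd p) + dg (vs F) (last p) = card (nb (vs F) (hd p) \<union> nb (vs F) (last p))"
      by (simp add: dg_def card_Un_disjoint)
    also have "\<dots> \<le> card M" using finM nbM[OF hl(1)] nbM[OF hl(2)] by (intro card_mono) auto
    finally show False using ge cM k by linarith
  qed
qed

end

section \<open>The main theorem for abstract graphs\<close>

context sgraph
begin

text \<open>A largest cover is extremal in the sense of \<open>max_cover\<close>; what has to be
  checked is that \<open>N\<close> is large. It separates \<open>W\<close> from the other covered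
  vertices, which gives \<open>m\<close>; for \<open>r = 1\<close> two vertices suffice and come
  from one pair with large degree sum.\<close>

lemma spanning_of_cover_low:
  assumes k: "1 \<le> k" and S0: "pk k S0" "\<forall>v\<in>V - S0. high v"
    and low: "\<forall>X. X \<subseteq> V \<longrightarrow> (\<forall>x\<in>X. \<not> high x) \<longrightarrow> (\<forall>x\<in>X. \<forall>y\<in>X. \<not> adj x y) \<longrightarrow> card X \<le> r"
    and pair: "\<forall>X. X \<subseteq> V \<longrightarrow> (\<forall>x\<in>X. \<forall>y\<in>X. \<not> adj x y) \<longrightarrow> card X = r + 1 \<longrightarrow>
      (\<exists>x\<in>X. \<exists>y\<in>X. x \<noteq> y \<and> card V \<le> deg x + deg y)"
    and r: "2 \<le> r \<and> conn m \<and> k * (r - 1) < m \<or> r = 1"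
  shows "pk k V"
proof -
  define P where "P S \<longleftrightarrow> pk k S \<and> (\<forall>v\<in>V - S. high v)" for S
  have "card S < Suc (card V)" if "P S" for S
    using pk_V[of k S] that finV by (auto simp: P_def less_Suc_eq_le intro: card_mono)
  then obtain S where S: "P S" "\<forall>S'. P S' \<longrightarrow> card S' \<le> card S"
    using ex_has_greatest_nat[of P S0 card "Suc (card V)"] S0 by (auto simp: P_def)
  then obtain F where F: "fam F" "card F = k" "vs F = S" by (auto simp: P_def pk_def)
  have "S = V"
  proof (rule ccontr)
    assume "S \<noteq> V"
    interpret max_cover V adj F k
    proof (unfold_locales)
      show "fam F" "card F = k" by fact+
      show "high v" if "v \<in> V - vs F" for v using that S(1) F(3) by (simp add: P_def)
      show "card S' \<le> card (vs F)" if "pk k S'" "\<forall>v\<in>V - S'. high v" for S' using S(2) that F(3) by (simp add: P_def)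
      show "V - vs F \<noteq> {}" using \<open>S \<noteq> V\<close> F(3) fam_V[OF F(1)] by blast
    qed
    have "F \<noteq> {}" using F(2) k by auto
    then obtain c where c: "c \<in> F" by blast
    have "3 \<le> card (set c)" using cyc_card[OF cycF[OF c]] by blast
    also have "\<dots> \<le> card (vs F)" using set_sub_vs[OF c] finvs by (rule card_mono[rotated])
    \<comment> \<open>\<open>N\<close> is at most half of the covered vertices, so there is
      something for it to separate from \<open>W\<close>.\<close>
    finally have "card N < card (vs F)" using cardvs by linarith
    then have "vs F - N \<noteq> {}" using Nsub by auto
    then obtain v where v: "v \<in> vs F - N" by blast
    have nW: "\<not> adj x w" if "x \<in> vs F - N" "w \<in> W" for x w using that by (auto simp: N_def)
    have "2 \<le> r \<and> k * (r - 1) < card N \<or> r = 1 \<and> 2 \<le> card N"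
      using r
    proof
      assume a: "2 \<le> r \<and> conn m \<and> k * (r - 1) < m"
      have "m \<le> card N"
      proof (rule ccontr)
        assume "\<not> m \<le> card N"
        moreover have "W \<union> (vs F - N) = V - N" using vsV Nsub by blast
        moreover have "W \<inter> (vs F - N) = {}" by blast
        moreover have "card N < m" using \<open>\<not> m \<le> card N\<close> by simp
        moreover have "conn m" using a by blast
        note this[unfolded conn_def, THEN spec, THEN spec, THEN spec, THEN mp, THEN mp, THEN mp, THEN mp, THEN mp, THEN mp,
          of W "vs F - N" N]
        ultimately obtain x y where "x \<in> W" "y \<in> vs F - N" "adj x y"
          using Wne \<open>vs F - N \<noteq> {}\<close> finN by blast
        then show False using nW adj_sym by blast
      qed
      then show ?thesis using a by linarith
    next
      assume r1: "r = 1"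
      obtain w where w: "w \<in> W" using Wne by blast
      have wv: "w \<noteq> v" "\<not> adj w v" "\<not> adj v w" using w v nW adj_sym by blast+
      have "{w, v} \<subseteq> V" "card {w, v} = r + 1" using w v vsV wv(1) r1 by auto
      moreover have "\<forall>x\<in>{w, v}. \<forall>y\<in>{w, v}. \<not> adj x y" using wv adj_irrefl by blast
      ultimately obtain x y where "x \<in> {w, v}" "y \<in> {w, v}" "x \<noteq> y" "card V \<le> deg x + deg y"
        using pair[THEN spec, THEN mp, THEN mp, THEN mp, of "{w, v}"] by blast
      then have "card V \<le> deg w + deg v" by (auto simp: add.commute)
      moreover have "deg w = dg (vs F) w + dg W w" "deg v = dg (vs F) v + dg W v" using dg_split[OF vsV] by blast+
      moreover have "dg (vs F) w \<le> card N" using dgF_N[OF w] by simp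
      moreover have "dg W w < card W" using dg_less_card[OF finW w] .
      moreover have "dg (vs F) v < card (vs F)" using dg_less_card[OF finvs] v by blast
      moreover have "dg W v = 0" using nW[OF v] by (rule dg_0)
      ultimately have "2 \<le> card N" using cardV by linarith
      then show ?thesis using r1 by blast
    qed
    then show False by (rule max_cover_False[OF low pair])
  qed
  then show ?thesis using S(1) by (simp add: P_def)
qed

theorem spanning_disjoint_cycles:
  assumes conn: "conn m" and mindeg: "\<forall>v\<in>V. m \<le> deg v" and k: "1 \<le> k" and n: "5 * k \<le> card V + 2"
    and r: "1 \<le> r" "k * (r - 1) < m"
    and pair: "\<forall>X. X \<subseteq> V \<longrightarrow> (\<forall>x\<in>X. \<forall>y\<in>X. \<not> adj x y) \<longrightarrow> card X = r + 1 \<longrightarrow>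
      (\<exists>x\<in>X. \<exists>y\<in>X. x \<noteq> y \<and> card V \<le> deg x + deg y)"
  shows "pk k V"
proof -
  have low: "\<forall>X. X \<subseteq> V \<longrightarrow> (\<forall>x\<in>X. \<not> high x) \<longrightarrow> (\<forall>x\<in>X. \<forall>y\<in>X. \<not> adj x y) \<longrightarrow> card X \<le> r"
  proof (intro allI impI, rule ccontr)
    fix X assume X: "X \<subseteq> V" "\<forall>x\<in>X. \<not> high x" "\<forall>x\<in>X. \<forall>y\<in>X. \<not> adj x y" "\<not> card X \<le> r"
    then have "r + 1 \<le> card X" by simp
    then obtain X' where X': "X' \<subseteq> X" "card X' = r + 1" using obtain_subset_with_card_n by metis
    have "X' \<subseteq> V" "\<forall>x\<in>X'. \<forall>y\<in>X'. \<not> adj x y" using X' X by blast+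
    from pair[THEN spec, THEN mp, THEN mp, THEN mp, OF this X'(2)]
    obtain x y where xy: "x \<in> X'" "y \<in> X'" "card V \<le> deg x + deg y" by blast
    then have "\<not> high x" "\<not> high y" using X(2) X'(1) by blast+
    then show False using xy(3) by (simp add: high_def)
  qed
  show ?thesis
  proof (cases "r = 1")
    case False
    then have r2: "2 \<le> r" using r(1) by simp
    have km: "k * (r - 1) + 1 \<le> m" using r(2) by simp
    \<comment> \<open>With \<open>r >= 2\<close> the bound on \<open>m\<close> gives
      \<open>m >= k + 1\<close>, the minimum degree required for disjoint cycles.\<close>
    have "1 \<le> r - 1" using r2 by simp
    from mult_le_mono2[OF this, of k] have k1: "k + 1 \<le> m" using km by linarith
    have tri: "\<forall>x\<in>V. \<forall>y\<in>V. \<forall>z\<in>V. x \<noteq> y \<longrightarrow> x \<noteq> z \<longrightarrow> y \<noteq> z \<longrightarrow> \<not> adj x y \<longrightarrow> \<not> adj x z \<longrightarrow> \<not> adj y z \<longrightarrow>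
      6 * k \<le> deg x + deg y + deg z + 1"
    proof (intro ballI impI)
      fix x y z assume a: "x \<in> V" "y \<in> V" "z \<in> V" "x \<noteq> y" "x \<noteq> z" "y \<noteq> z" "\<not> adj x y" "\<not> adj x z" "\<not> adj y z"
      have d: "m \<le> deg x" "m \<le> deg y" "m \<le> deg z" using mindeg a by blast+
      show "6 * k \<le> deg x + deg y + deg z + 1"
      proof (cases "r = 2")
        case True
        have X: "{x, y, z} \<subseteq> V" "card {x, y, z} = r + 1" using a True by auto
        have "\<forall>u\<in>{x, y, z}. \<forall>v\<in>{x, y, z}. \<not> adj u v" using a adj_sym adj_irrefl by blast
        from pair[THEN spec, THEN mp, THEN mp, THEN mp, OF X(1) this X(2)]
        obtain u v where "u \<in> {x, y, z}" "v \<in> {x, y, z}" "u \<noteq> v" "card V \<le> deg u + deg v" by blast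
        \<comment> \<open>Two of the three contribute \<open>n\<close> and the third
          \<open>m\<close>: at least \<open>(5k - 2) + (k + 1) = 6k - 1\<close>.\<close>
        then have "card V + m \<le> deg x + deg y + deg z" using d by auto
        then show ?thesis using n k1 by linarith
      next
        case False
        then have "2 \<le> r - 1" using r2 by simp
        \<comment> \<open>From \<open>r >= 3\<close> on, connectivity alone suffices:
          \<open>m >= 2k + 1\<close>, and each of the three degrees is at least
          \<open>m\<close>.\<close>
        from mult_le_mono2[OF this, of k] show ?thesis using km d k by linarith
      qed
    qed
    have "\<forall>v\<in>V. k + 1 \<le> deg v" using mindeg k1 by (meson le_trans)
    from disjoint_cycles_exist[OF k n this tri] obtain S where S: "pk k S" by blast
    have low': "\<And>X. X \<subseteq> V \<Longrightarrow> \<forall>x\<in>X. \<not> high x \<Longrightarrow> \<forall>x\<in>X. \<forall>y\<in>X. \<not> adj x y \<Longrightarrow> card X \<le> r"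
      by (rule low[THEN spec, THEN mp, THEN mp, THEN mp])
    obtain S0 where "pk k S0" "\<forall>v\<in>V - S0. high v" using cover_low[OF conn r2 k r(2) low' S] by blast
    then show ?thesis using spanning_of_cover_low[OF k _ _ low pair, of S0 m] r2 conn r(2) by blast
  next
    case True
    have ore: "\<forall>x\<in>V. \<forall>y\<in>V. x \<noteq> y \<longrightarrow> \<not> adj x y \<longrightarrow> card V \<le> deg x + deg y"
    proof (intro ballI impI)
      fix x y assume a: "x \<in> V" "y \<in> V" "x \<noteq> y" "\<not> adj x y"
      have X: "{x, y} \<subseteq> V" "card {x, y} = r + 1" using a True by auto
      have "\<forall>u\<in>{x, y}. \<forall>v\<in>{x, y}. \<not> adj u v" using a adj_sym adj_irrefl by blast
      from pair[THEN spec, THEN mp, THEN mp, THEN mp, OF X(1) this X(2)]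
      obtain u v where "u \<in> {x, y}" "v \<in> {x, y}" "u \<noteq> v" "card V \<le> deg u + deg v" by blast
      then show "card V \<le> deg x + deg y" by (auto simp: add.commute)
    qed
    show ?thesis
    proof (cases "\<forall>v\<in>V. k + 1 \<le> deg v")
      case md: True
      have "\<forall>x\<in>V. \<forall>y\<in>V. \<forall>z\<in>V. x \<noteq> y \<longrightarrow> x \<noteq> z \<longrightarrow> y \<noteq> z \<longrightarrow> \<not> adj x y \<longrightarrow> \<not> adj x z \<longrightarrow> \<not> adj y z \<longrightarrow>
        6 * k \<le> deg x + deg y + deg z + 1"
      proof (intro ballI impI)
        fix x y z assume a: "x \<in> V" "y \<in> V" "z \<in> V" "x \<noteq> y" "\<not> adj x y"
        have "card V \<le> deg x + deg y" "k + 1 \<le> deg z" using ore md a by blast+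
        then show "6 * k \<le> deg x + deg y + deg z + 1" using n by linarith
      qed
      from disjoint_cycles_exist[OF k n md this] obtain S0 where S0: "pk k S0" by blast
      have "card S < Suc (card V)" if "pk k S" for S
        using pk_V[OF that] finV by (auto simp: less_Suc_eq_le intro: card_mono)
      then obtain S where S: "pk k S" "\<forall>S'. pk k S' \<longrightarrow> card S' \<le> card S"
        using ex_has_greatest_nat[of "pk k" S0 card "Suc (card V)"] S0 by blast
      then obtain F where F: "fam F" "card F = k" "vs F = S" by (auto simp: pk_def)
      have "vs F = V" using ore_max_spanning[OF ore md k F(1,2)] S(2) F(3) by simp
      then show ?thesis using S(1) F(3) by simp
    next
      case False
      then obtain h where h: "h \<in> V" "deg h \<le> k" by fastforce
      obtain S0 where "pk k S0" "\<forall>v\<in>V - S0. high v" using cover_low_ore[OF ore k n h] by blast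
      then show ?thesis using spanning_of_cover_low[OF k _ _ low pair, of S0 m] True by blast
    qed
  qed
qed

end

section \<open>Transfer to digraphs\<close>

lemma steps_connect:
  assumes "p \<noteq> []" "x \<in> set p"
  shows "(hd p, x) \<in> (steps p)\<^sup>*"
  using assms
proof (induction p rule: induct_list012)
  case (3 y z zs)
  have mono: "(steps (z # zs))\<^sup>* \<subseteq> (steps (y # z # zs))\<^sup>*" by (rule rtrancl_mono) auto
  show ?case
  proof (cases "x = y")
    case False
    then have "(z, x) \<in> (steps (y # z # zs))\<^sup>*" using 3 mono by auto
    moreover have "(hd (y # z # zs), z) \<in> steps (y # z # zs)" by simp
    ultimately show ?thesis by (rule converse_rtrancl_into_rtrancl[rotated])
  qed simp
qed auto

context graph
begin

interpretation S: sgraph "verts G" "\<lambda>u v. u \<rightarrow>\<^bsub>G\<^esub> v"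
proof
  show "finite (verts G)" by simp
  show "x \<rightarrow> y \<Longrightarrow> y \<rightarrow> x" for x y by (rule graph_symmetric)
  show "\<not> x \<rightarrow> x" for x using adj_not_same by blast
  show "x \<rightarrow> y \<Longrightarrow> x \<in> verts G \<and> y \<in> verts G" for x y using adj_in_verts by blast
qed

lemma out_degree_eq_deg: "out_degree G v = S.deg v"
proof -
  have "inj_on (head G) (out_arcs G v)"
  proof (rule inj_onI)
    fix e f assume "e \<in> out_arcs G v" "f \<in> out_arcs G v" "head G e = head G f"
    then show "e = f" using no_multi_arcs[of e f] by (simp add: arc_to_ends_def)
  qed
  moreover have "head G ` out_arcs G v = S.nb (verts G) v"
    unfolding S.nb_def by (auto simp: arcs_ends_conv image_iff)
  ultimately show ?thesis by (metis S.dg_def card_image out_degree_def)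
qed

lemma vertex_connectivity_le_separating:
  assumes "\<not> complete_digraph (card (verts G)) G" "separating_set G S"
  shows "vertex_connectivity G \<le> card S"
proof -
  have "{card S | S. separating_set G S} \<subseteq> {..card (verts G)}"
    by (auto simp: separating_set_def intro!: card_mono)
  then have "finite {card S | S. separating_set G S}" by (rule finite_subset) simp
  then have "Min {card S | S. separating_set G S} \<le> card S" using assms(2) by (intro Min_le) auto
  then show ?thesis using assms(1) by (simp add: vertex_connectivity_def)
qed

lemma complete_iff: "complete_digraph (card (verts G)) G \<longleftrightarrow> (\<forall>u\<in>verts G. \<forall>v\<in>verts G. u \<noteq> v \<longrightarrow> u \<rightarrow> v)"
proof -
  have "graph G" by unfold_locales
  moreover have "arcs_ends G \<subseteq> {(u, v). (u, v) \<in> verts G \<times> verts G \<and> u \<noteq> v}"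
    using adj_in_verts adj_not_same by blast
  ultimately show ?thesis unfolding complete_digraph_def by blast
qed

text \<open>If no edge leaves \<open>A\<close>, reachability off \<open>S\<close> stays in
  \<open>A\<close>. The nonadjacent pair \<open>a\<close>, \<open>b\<close> also shows that the
  graph is not complete, so its connectivity is the minimum over separating sets.\<close>

lemma m_connected_conn:
  assumes m: "m_connected m G"
  shows "S.conn m"
  unfolding S.conn_def
proof (intro allI impI, rule ccontr)
  fix A B S
  assume ne: "A \<noteq> {}" "B \<noteq> {}" and dis: "A \<inter> B = {}" and un: "A \<union> B = verts G - S"
    and c: "card S < m" "finite S" and no: "\<not> (\<exists>a\<in>A. \<exists>b\<in>B. a \<rightarrow> b)"
  obtain a b where ab: "a \<in> A" "b \<in> B" using ne by blast
  then have "a \<noteq> b" "a \<in> verts G" "b \<in> verts G" "\<not> a \<rightarrow> b" using dis un no by blast+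
  then have nc: "\<not> complete_digraph (card (verts G)) G" unfolding complete_iff by blast
  \<comment> \<open>\<open>S\<close> may contain elements that are not vertices; a separating set
    may not.\<close>
  define S' where "S' = S \<inter> verts G"
  have "card S' \<le> card S" unfolding S'_def using c(2) by (intro card_mono) auto
  then have "\<not> separating_set G S'"
    using vertex_connectivity_le_separating[OF nc, of S'] m c(1) by (force simp: m_connected_def)
  moreover have "S' \<subset> verts G" using ab(1) un by (auto simp: S'_def)
  ultimately have "connected (G \<restriction> (verts G - S'))" by (simp add: separating_set_def)
  moreover have "a \<in> verts G - S'" "b \<in> verts G - S'" using ab un by (auto simp: S'_def)
  ultimately have "a \<rightarrow>\<^sup>*\<^bsub>with_proj (mk_symmetric (G \<restriction> (verts G - S')))\<^esub> b"
    unfolding connected_def strongly_connected_def by simp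
  then have "(a, b) \<in> (arcs_ends (with_proj (mk_symmetric (G \<restriction> (verts G - S')))))\<^sup>*"
    by (rule reachable_rtranclI)
  then have "b \<in> A"
  proof (induction rule: rtrancl_induct)
    case base
    then show ?case using ab by simp
  next
    case (step y z)
    have "(y, z) \<in> parcs (mk_symmetric (G \<restriction> (verts G - S')))" using step(2) by simp
    then have "(y \<rightarrow> z \<or> z \<rightarrow> y) \<and> z \<in> verts G - S'"
      by (auto simp: parcs_mk_symmetric arcs_ends_conv)
    then have "y \<rightarrow> z" "z \<in> A \<union> B" using graph_symmetric un by (auto simp: S'_def)
    then show ?case using no step(3) by blast
  qed
  then show False using ab dis by blast
qed

text \<open>The neighbourhood of \<open>v\<close> separates it from any vertex it misses. If it
  misses none, then either the graph is complete and its connectivity is \<open>n - 1\<close> by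
  definition, or some nonadjacent pair is separated by the other \<open>n - 2\<close>
  vertices.\<close>

lemma m_connected_min_degree:
  assumes m: "m_connected m G" and v: "v \<in> verts G"
  shows "m \<le> S.deg v"
proof (cases "\<forall>w\<in>verts G - {v}. v \<rightarrow> w")
  case True
  then have "S.nb (verts G) v = verts G - {v}" using S.adj_irrefl by (auto simp: S.nb_def)
  then have d: "S.deg v = card (verts G) - 1" using v by (simp add: S.dg_def)
  show ?thesis
  proof (cases "complete_digraph (card (verts G)) G")
    case True
    then show ?thesis using m d by (simp add: m_connected_def vertex_connectivity_def)
  next
    case False
    then obtain u w where uw: "u \<in> verts G" "w \<in> verts G" "u \<noteq> w" "\<not> u \<rightarrow> w" unfolding complete_iff by blast
    then have "\<not> card (verts G - {u, w}) < m"
      using m_connected_conn[OF m, unfolded S.conn_def, THEN spec, THEN spec, THEN spec, of "{u}" "{w}" "verts G - {u, w}"]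
      by auto
    moreover have "card (verts G - {u, w}) \<le> card (verts G) - 1"
      using uw(1) card_mono[of "verts G - {u}" "verts G - {u, w}"] by auto
    ultimately show ?thesis using d by linarith
  qed
next
  case False
  then obtain w where w: "w \<in> verts G" "w \<noteq> v" "\<not> v \<rightarrow> w" by blast
  define B where "B = verts G - S.nb (verts G) v - {v}"
  have wB: "w \<in> B" using w by (simp add: B_def S.nb_def)
  have "v \<notin> S.nb (verts G) v" using S.adj_irrefl by (simp add: S.nb_def)
  then have B: "{v} \<inter> B = {}" "{v} \<union> B = verts G - S.nb (verts G) v" using v by (auto simp: B_def)
  have no: "\<not> (\<exists>b\<in>B. v \<rightarrow> b)" by (auto simp: B_def S.nb_def)
  have "\<not> card (S.nb (verts G) v) < m"
    using m_connected_conn[OF m, unfolded S.conn_def, THEN spec, THEN spec, THEN spec,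
        of "{v}" B "S.nb (verts G) v"] B wB no by auto
  then show ?thesis by (simp add: S.dg_def)
qed

text \<open>The set \<open>X\<close> itself rules out the infinite value of \<open>sigma\<close>.
  The remaining work is finiteness, on which the meaning of \<open>Min\<close> and
  \<open>Max\<close> depends, and nonemptiness for the maximum.\<close>

lemma sigma_2_pair:
  assumes s: "enat n \<le> sigma G 2 s" and s2: "2 \<le> s"
    and X: "X \<subseteq> verts G" "\<forall>x\<in>X. \<forall>y\<in>X. \<not> x \<rightarrow> y" "card X = s"
  shows "\<exists>x\<in>X. \<exists>y\<in>X. x \<noteq> y \<and> n \<le> S.deg x + S.deg y"
proof -
  have iX: "independent_set G X" using X by (simp add: independent_set_def)
  have finX: "finite X" using X(1) by (rule finite_subset) simp
  have "{card X | X. independent_set G X} \<subseteq> {..card (verts G)}"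
    by (auto simp: independent_set_def intro!: card_mono)
  then have "finite {card X | X. independent_set G X}" by (rule finite_subset) simp
  then have "s \<le> independence_number G"
    unfolding independence_number_def using iX X(3) by (intro Max_ge) auto
  then have "n \<le> Min {max_degree_sum G 2 X | X. independent_set G X \<and> card X = s}"
    using s by (simp add: sigma_def)
  also have "\<dots> \<le> max_degree_sum G 2 X"
  proof (rule Min_le)
    have "{max_degree_sum G 2 X | X. independent_set G X \<and> card X = s} \<subseteq> max_degree_sum G 2 ` Pow (verts G)"
      by (auto simp: independent_set_def)
    then show "finite {max_degree_sum G 2 X | X. independent_set G X \<and> card X = s}"
      by (rule finite_subset) simp
    show "max_degree_sum G 2 X \<in> {max_degree_sum G 2 X | X. independent_set G X \<and> card X = s}"
      using iX X(3) by blast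
  qed
  finally have le: "n \<le> max_degree_sum G 2 X" .
  let ?D = "{\<Sum>x\<in>Y. out_degree G x | Y. Y \<subseteq> X \<and> card Y = 2}"
  have "?D \<subseteq> (\<lambda>Y. \<Sum>x\<in>Y. out_degree G x) ` Pow X" by auto
  then have "finite ?D" by (rule finite_subset) (simp add: finX)
  moreover obtain Y where "Y \<subseteq> X" "card Y = 2" using obtain_subset_with_card_n[of 2 X] s2 X(3) by auto
  then have "?D \<noteq> {}" by blast
  ultimately have "Max ?D \<in> ?D" by (rule Max_in)
  then obtain Y where Y: "Y \<subseteq> X" "card Y = 2" "max_degree_sum G 2 X = (\<Sum>x\<in>Y. out_degree G x)"
    by (auto simp: max_degree_sum_def)
  from Y(2) obtain x y where xy: "Y = {x, y}" "x \<noteq> y" by (auto simp: card_2_iff)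
  then have "n \<le> S.deg x + S.deg y" using le Y(3) by (simp add: out_degree_eq_deg)
  then show ?thesis using xy Y(1) by blast
qed

lemma graph_restrict_arcs:
  assumes "sym T"
  shows "graph (G\<lparr>arcs := {e \<in> arcs G. arc_to_ends G e \<in> T}\<rparr>)" (is "graph ?H")
    and "spanning (G\<lparr>arcs := {e \<in> arcs G. arc_to_ends G e \<in> T}\<rparr>) G"
    and "arcs_ends (G\<lparr>arcs := {e \<in> arcs G. arc_to_ends G e \<in> T}\<rparr>) = arcs_ends G \<inter> T"
proof -
  show ae: "arcs_ends ?H = arcs_ends G \<inter> T" by (auto simp: arcs_ends_def arc_to_ends_def)
  show "graph ?H"
  proof
    show "symmetric ?H" unfolding symmetric_def ae using assms sym_arcs by (auto simp: symmetric_def sym_def)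
  qed (auto simp: no_loops intro: no_multi_arcs simp: arc_to_ends_def)
  then interpret H: graph ?H .
  show "spanning ?H G"
    unfolding spanning_def subgraph_def compatible_def using wf_digraph H.wf_digraph by auto
qed

lemma cas_map_zip:
  assumes "\<And>u v. (u, v) \<in> set (zip (x # xs) (xs @ [z])) \<Longrightarrow> tail G (f (u, v)) = u \<and> head G (f (u, v)) = v"
  shows "cas x (map f (zip (x # xs) (xs @ [z]))) z"
  using assms
proof (induction xs arbitrary: x)
  case (Cons y ys)
  have "cas y (map f (zip (y # ys) (ys @ [z]))) z" by (rule Cons.IH) (use Cons.prems in auto)
  then show ?case using Cons.prems[of x y] by simp
qed auto

text \<open>Only one direction of each edge is traversed: \<open>f\<close> picks the arc over each
  forward step, and the opposite arcs are accounted for by the converse.\<close>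

lemma cycle_graphI:
  assumes c: "3 \<le> length c" "distinct c" "verts G = set c" "arcs_ends G = csteps c \<union> (csteps c)\<inverse>"
  shows "cycle_graph G"
proof -
  define f where "f = inv_into (arcs G) (arc_to_ends G)"
  define p where "p = map f (zip c (rotate1 c))"
  obtain x xs where x: "c = x # xs" using c(1) by (cases c) auto
  have f: "f e \<in> arcs G \<and> arc_to_ends G (f e) = e" if "e \<in> csteps c" for e
    using that c(4) f_inv_into_f[of e "arc_to_ends G" "arcs G"] inv_into_into[of e "arc_to_ends G" "arcs G"]
    by (auto simp: f_def arcs_ends_def)
  have th: "tail G (f (u, v)) = u \<and> head G (f (u, v)) = v" if "(u, v) \<in> set (zip c (rotate1 c))" for u v
    using f[of "(u, v)"] that by (simp add: csteps_def arc_to_ends_def)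
  have cas: "cas x p x" unfolding p_def x using th cas_map_zip[of x xs x f] by (simp add: x)
  have "map (head G) p = map snd (zip c (rotate1 c))" "map (tail G) p = map fst (zip c (rotate1 c))"
    unfolding p_def map_map by (rule map_cong[OF refl]; use th in \<open>auto simp: comp_def\<close>)+
  then have hd: "map (head G) p = rotate1 c" and tl: "map (tail G) p = c" by simp_all
  have len: "length p = length c" by (simp add: p_def)
  have sp: "set p = f ` csteps c" by (simp add: p_def csteps_def)
  have "awalk x p x" unfolding awalk_def using cas c(3) x sp f by auto
  moreover have "distinct (tl (awalk_verts x p))" "p \<noteq> []"
    using awalk_verts_conv'[OF cas] hd c(1,2) len by auto
  ultimately have "cycle p" unfolding cycle_def by blast
  moreover have "verts G = tail G ` set p" using c(3) tl by (metis list.set_map)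
  moreover have "arc_to_ends G ` set p = csteps c" unfolding sp image_image using f by simp
  moreover have "graph G" by unfold_locales
  ultimately show ?thesis unfolding cycle_graph_def using c(1,4) len by (intro conjI exI[of _ p]) auto
qed

text \<open>Keep the arcs over the steps of the family in both directions. Such an arc never leaves
  the vertex set of its cycle, and a cycle is connected by its own steps, so the components are
  exactly the cycles.\<close>

lemma two_factor_of_cycles:
  assumes "S.pk k (verts G)"
  shows "\<exists>H. two_factor H G \<and> card (pre_digraph.sccs H) = k"
proof -
  obtain F where F: "S.fam F" "card F = k" "S.vs F = verts G" using assms by (auto simp: S.pk_def)
  define T where "T = S.astep F \<union> (S.astep F)\<inverse>"
  define H where "H = G\<lparr>arcs := {e \<in> arcs G. arc_to_ends G e \<in> T}\<rparr>"
  have symT: "sym T" by (auto simp: T_def sym_def)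
  have gH: "graph H" and sH: "spanning H G" using graph_restrict_arcs[OF symT] by (simp_all add: H_def)
  have cyc: "S.cyc c" if "c \<in> F" for c using S.fam_cyc[OF F(1) that] .
  have disj: "c = d" if "c \<in> F" "d \<in> F" "x \<in> set c" "x \<in> set d" for c d x
    using F(1) that by (auto simp: S.fam_def)
  have "T \<subseteq> arcs_ends G"
    using cyc graph_symmetric by (fastforce simp: T_def S.astep_def S.cyc_def)
  then have aH: "arcs_ends H = T" using graph_restrict_arcs(3)[OF symT] by (auto simp: H_def)
  have vH: "verts H = verts G" by (simp add: H_def)
  interpret H: graph H by fact
  have closed: "v \<in> set c" if c: "c \<in> F" "u \<in> set c" and uv: "(u, v) \<in> T" for c u v
  proof -
    obtain d where "d \<in> F" "(u, v) \<in> csteps d \<or> (v, u) \<in> csteps d"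
      using uv by (auto simp: T_def S.astep_def)
    then have "d \<in> F" "u \<in> set d" "v \<in> set d" using csteps_in_set[of u v d] csteps_in_set[of v u d] by blast+
    then show ?thesis using disj[OF c(1) _ c(2)] by blast
  qed
  have scc: "set c \<in> H.sccs_verts" if c: "c \<in> F" for c
    unfolding H.in_sccs_verts_conv_reachable
  proof (intro conjI ballI allI impI)
    show "set c \<noteq> {}" using S.cyc_ne[OF cyc[OF c]] by simp
    have cne: "c \<noteq> []" using S.cyc_ne[OF cyc[OF c]] .
    have "steps c \<subseteq> T" using c cne by (auto simp: T_def S.astep_def csteps_eq)
    then have "(hd c, x) \<in> (arcs_ends H)\<^sup>*" if "x \<in> set c" for x
      using steps_connect[OF cne that] rtrancl_mono[of "steps c" T] aH by auto
    moreover have "set c \<subseteq> verts H" using S.set_sub_vs[OF c] F(3) vH by simp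
    ultimately have r: "hd c \<rightarrow>\<^sup>*\<^bsub>H\<^esub> x" if "x \<in> set c" for x
      using that cne by (auto simp: H.reachable_conv)
    show "u \<rightarrow>\<^sup>*\<^bsub>H\<^esub> v" if "u \<in> set c" "v \<in> set c" for u v
      using H.symmetric_reachable'[OF r[OF that(1)]] r[OF that(2)] by (rule H.reachable_trans)
  next
    fix u v assume u: "u \<in> set c" and v: "v \<notin> set c"
    have "x \<in> set c" if "(u, x) \<in> (arcs_ends H)\<^sup>*" for x
      using that
    proof (induction rule: rtrancl_induct)
      case (step y z)
      then show ?case using closed[OF c] aH by blast
    qed (rule u)
    then have "\<not> u \<rightarrow>\<^sup>*\<^bsub>H\<^esub> v" using v reachable_rtranclI[where G = H and u = u and v = v] by blast
    then show "\<not> u \<rightarrow>\<^sup>*\<^bsub>H\<^esub> v \<or> \<not> v \<rightarrow>\<^sup>*\<^bsub>H\<^esub> u" by blast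
  qed
  have sv: "H.sccs_verts = set ` F"
  proof
    show "set ` F \<subseteq> H.sccs_verts" using scc by blast
    show "H.sccs_verts \<subseteq> set ` F"
    proof
      fix U assume U: "U \<in> H.sccs_verts"
      then obtain u where u: "u \<in> U" by (auto simp: H.in_sccs_verts_conv_reachable)
      then have "u \<in> S.vs F" using H.sccs_verts_subsets[OF U] F(3) vH by blast
      then obtain c where c: "c \<in> F" "u \<in> set c" by (auto simp: S.vs_def)
      then have "U = set c" using H.sccs_verts_disjoint[OF U scc[OF c(1)]] u by blast
      then show "U \<in> set ` F" using c(1) by blast
    qed
  qed
  have "inj_on set F"
  proof (rule inj_onI)
    fix c d assume a: "c \<in> F" "d \<in> F" "set c = set d"
    have "hd c \<in> set c" using S.cyc_ne[OF cyc[OF a(1)]] by simp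
    then show "c = d" using disj[OF a(1,2)] a(3) by blast
  qed
  then have "card H.sccs = k" using H.card_sccs_verts sv F(2) by (simp add: card_image)
  moreover have "cycle_graph C" if C: "C \<in> H.sccs" for C
  proof -
    have "C \<in> (\<restriction>) H ` (set ` F)" using C unfolding H.sccs_conv_sccs_verts sv .
    then obtain c where c: "c \<in> F" "C = H \<restriction> set c" by blast
    have ind: "induced_subgraph C H" using C by (rule H.in_sccs_imp_induced)
    have "graph C"
      using H.digraphI_induced[OF ind] induced_graph_imp_symmetric[OF H.sym_arcs ind] by (rule digraph.graphI)
    then interpret C: graph C .
    have "arcs_ends C = arcs_ends H \<inter> set c \<times> set c"
      by (auto simp: c(2) arcs_ends_conv)
    also have "\<dots> = csteps c \<union> (csteps c)\<inverse>"
    proof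
      show "csteps c \<union> (csteps c)\<inverse> \<subseteq> arcs_ends H \<inter> set c \<times> set c"
        using c(1) by (auto simp: aH T_def S.astep_def dest: csteps_in_set)
      show "arcs_ends H \<inter> set c \<times> set c \<subseteq> csteps c \<union> (csteps c)\<inverse>"
      proof
        fix e assume e: "e \<in> arcs_ends H \<inter> set c \<times> set c"
        obtain u v where uv: "e = (u, v)" by fastforce
        have u: "u \<in> set c" and "(u, v) \<in> T" using e uv aH by auto
        then obtain d where d: "d \<in> F" "(u, v) \<in> csteps d \<or> (v, u) \<in> csteps d"
          by (auto simp: T_def S.astep_def)
        then have "u \<in> set d" using csteps_in_set[of u v d] csteps_in_set[of v u d] by blast
        then have "d = c" using disj[OF d(1) c(1)] u by blast
        then show "e \<in> csteps c \<union> (csteps c)\<inverse>" using d(2) uv by blast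
      qed
    qed
    finally have "arcs_ends C = csteps c \<union> (csteps c)\<inverse>" .
    moreover have "verts C = set c" by (simp add: c(2))
    ultimately show ?thesis using C.cycle_graphI[of c] cyc[OF c(1)] by (simp add: S.cyc_def)
  qed
  ultimately show ?thesis unfolding two_factor_def using gH sH by blast
qed

lemma two_factor_exists:
  assumes k: "1 \<le> k" and m: "1 \<le> m" and con: "m_connected m G" and n: "5 * k \<le> card (verts G) + 2"
    and s: "enat (card (verts G)) \<le> sigma G 2 (nat \<lceil>real m / real k\<rceil> + 1)"
  shows "\<exists>H. two_factor H G \<and> card (pre_digraph.sccs H) = k"
proof (rule two_factor_of_cycles)
  define r where "r = nat \<lceil>real m / real k\<rceil>"
  have pos: "0 < real m / real k" using k m by simp
  then have r1: "1 \<le> r" unfolding r_def by linarith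
  \<comment> \<open>The ceiling enters only through this strict inequality, which becomes the
    pigeonhole bound \<open>k (r - 1) < m\<close>.\<close>
  have "real r - 1 < real m / real k" unfolding r_def using pos by linarith
  then have "real k * (real r - 1) < real m" using k by (simp add: field_simps)
  then have "real (k * (r - 1)) < real m" using r1 by (simp add: of_nat_diff)
  then have km: "k * (r - 1) < m" by linarith
  show "S.pk k (verts G)"
  proof (rule S.spanning_disjoint_cycles[OF m_connected_conn[OF con] _ k n r1 km])
    show "\<forall>v\<in>verts G. m \<le> S.deg v" using m_connected_min_degree[OF con] by blast
    show "\<forall>X. X \<subseteq> verts G \<longrightarrow> (\<forall>x\<in>X. \<forall>y\<in>X. \<not> x \<rightarrow> y) \<longrightarrow> card X = r + 1 \<longrightarrow>
      (\<exists>x\<in>X. \<exists>y\<in>X. x \<noteq> y \<and> card (verts G) \<le> S.deg x + S.deg y)"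
      using sigma_2_pair[OF s[folded r_def]] r1 by simp
  qed
qed

end

theorem theorem1:
  fixes G :: "('a,'b) pre_digraph" and k m n :: nat
  assumes "graph G"
    and "k \<ge> 1" and "m \<ge> 1"
    and "m_connected m G"
    and "n = card (verts G)" and "n \<ge> 5 * k - 2"
    and "sigma G 2 (nat \<lceil>real m / real k\<rceil> + 1) \<ge> enat n"
  shows "\<exists>H. two_factor H G \<and> card (pre_digraph.sccs H) = k"
proof -
  interpret graph G by fact
  \<comment> \<open>The difference \<open>5 * k - 2\<close> of natural numbers is passed on as
    \<open>5 * k <= n + 2\<close>.\<close>
  show ?thesis using two_factor_exists[of k m] assms by auto
qed

end
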